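(* (Same statement as the preceding block.) Let $n\ge2$, $L>n$, $\mathbf{m}=(m_0,\dots,m_n)$ with all $m_\alpha\ge1$ and $\sum m_\alpha=L$. There is a nonzero $C(\mathbf{m})\in\mathbb{Q}(t)$ such that for every $\boldsymbol\sigma\in\{0,\dots,n\}^L$ with particle content $\mathbf{m}$, the coefficient of $|\boldsymbol\sigma\rangle$ in $|P_{\mathrm{MLQ}}(\mathbf{m})_{q=1}\rangle$ equals $C(\mathbf{m})\,\mathrm{tr}_{F^{\otimes n(n-1)/2}}(X^{(n)}_{\sigma_1}(1)\cdots X^{(n)}_{\sigma_L}(1))$.
   Context: Oscillators: $F=\bigoplus_{d\ge0}\mathbb{Q}(t)|d\rangle$, $\mathbf{a}^+|d\rangle=|d+1\rangle$, $\mathbf{a}^-|d\rangle=(1-t^d)|d-1\rangle$ ($|-1\rangle=0$), $\mathbf{k}|d\rangle=t^d|d\rangle$. On $F^{\otimes N}$, $\mathbf{a}^\pm_r,\mathbf{k}_r$ act on the $r$-th factor. Operators $X^{(n)}_\alpha(z)$: put $N_n=n(n-1)/2$. For $n\ge1$, $0\le i\le n-1$, $0\le\alpha\le n$, define operators on $F^{\otimes(n-1)}$: $T^{(n)}(z)_{i0}=\mathbf{a}^+_i$ (with $\mathbf{a}^+_0:=1$), and for $\alpha\ge1$: $T^{(n)}(z)_{i\alpha}=z\,\mathbf{k}_\alpha\mathbf{k}_{\alpha+1}\cdots\mathbf{k}_{n-1}$ if $\alpha=i+1$; $T^{(n)}(z)_{i\alpha}=z\,\mathbf{a}^+_i\mathbf{a}^-_{\alpha-1}\mathbf{k}_\alpha\cdots\mathbf{k}_{n-1}$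 if $\alpha\ge i+2$; $T^{(n)}(z)_{i\alpha}=0$ if $\alpha\le i$ (empty products are $1$). Set $X^{(0)}_0(z)=1$ and for $n\ge1$ \[ X^{(n)}_\alpha(z)=\sum_{i=0}^{n-1}\widetilde X^{(n-1)}_i(z)\,T^{(n)}(z)_{i\alpha}\in\mathrm{End}(F^{\otimes N_n}), \] where $T^{(n)}(z)_{i\alpha}$ acts on tensor factors $1,\dots,n-1$ and $\widetilde X^{(n-1)}_i(z)$ is $X^{(n-1)}_i(z)$ acting on factors $n,\dots,N_n$ (its $r$-th factor placed at position $r+n-1$). (E.g. $X^{(1)}_0=1$, $X^{(1)}_1=z$.) $|P_{\mathrm{MLQ}}(\mathbf{m})_q\rangle$ (multiline queues): let $B_l=\{\mathbf{i}\in\{0,1\}^L:|\mathbf{i}|=l\}$, $l_i=m_i+\dots+m_n$. A ball system is $(\mathbf{b}_n,\dots,\mathbf{b}_1)$, $\mathbf{b}_r\in B_{l_r}$, drawn as $n$ rows of $L$ columns (Row 1 on top), Row $r$ having a ball in column $k$ iff the $k$-th entry of $\mathbf{b}_r$ is $1$. A multiline queue $Q$ is a ball system with a pairing built in rounds $c=n,n-1,\dots,2$: at the start of round $c$ all not-yet-colored balls of Row $c$ get color $c$; then for $r=c,c-1,\dots,2$ the color-$c$ balls of Row $r$ are processed from left to right, each paired with a distinct free (not yet paired/colored) ball of Row $r-1$, where if the box directly above holds a free ball it must be chosen; chosen balls get color $c$. Finally remaining balls of Row 1 get color $1$. A pairing from Row $r$ column $j$ (color $c$) to Row $r-1$ column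 $j'$ has weight $1$ if $j'=j$, else $\frac{(1-t)t^{s}q^{(c-r+1)w}}{1-q^{c-r+1}t^f}$, with $f$ = number of free balls of Row $r-1$ just before the choice, $s$ = number of them in columns $j'+1,\dots,j-1$ (mod $L$), $w=\theta(j<j')$. $\mathrm{wt}_{q,t}(Q)$ = product of pairing weights; $\pi(Q)_k$ = color of the Row-1 ball in column $k$, or $0$. $|P_{\mathrm{MLQ}}(\mathbf{m})_q\rangle=\sum_Q\mathrm{wt}_{q,t}(Q)|\pi(Q)\rangle$. *)

theory Defs
  imports "HOL-Computational_Algebra.Computational_Algebra"
begin

text \<open>A basis vector |d_1,...,d_N> of F^{\<otimes> N} is the list [d_1,...,d_N].
  Operators on F^{\<otimes> N} are given by their matrix entries
  M e d = <e|M|d> \<in> Q[t] (all operators below have polynomial entries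
  and finitely many nonzero entries in each column).\<close>

type_synonym fstate = "nat list"
type_synonym fop = "fstate \<Rightarrow> fstate \<Rightarrow> rat poly"

definition tt :: "rat poly" where "tt = [:0, 1:]"

definition op_id :: fop where "op_id e d = (if e = d then 1 else 0)"
definition op_zero :: fop where "op_zero e d = 0"
definition op_add :: "fop \<Rightarrow> fop \<Rightarrow> fop" where "op_add A B e d = A e d + B e d"
definition op_scale :: "rat poly \<Rightarrow> fop \<Rightarrow> fop" where "op_scale z A e d = z * A e d"
text \<open>Composition A B (first B, then A); columns are finitely supported.\<close>
definition op_mul :: "fop \<Rightarrow> fop \<Rightarrow> fop" where
  "op_mul A B e d = (\<Sum>d'\<in>{d'. B d' d \<noteq> 0}. A e d' * B d' d)"

text \<open>a^+_r, a^-_r, k_r acting on the r-th tensor factor (r \<ge> 1).\<close>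
definition op_ap :: "nat \<Rightarrow> fop" where
  "op_ap r e d = (if e = d[r - 1 := d ! (r - 1) + 1] then 1 else 0)"
definition op_am :: "nat \<Rightarrow> fop" where
  "op_am r e d = (if 0 < d ! (r - 1) \<and> e = d[r - 1 := d ! (r - 1) - 1]
                  then 1 - tt ^ (d ! (r - 1)) else 0)"
definition op_k :: "nat \<Rightarrow> fop" where
  "op_k r e d = (if e = d then tt ^ (d ! (r - 1)) else 0)"

definition op_ap0 :: "nat \<Rightarrow> fop" where
  "op_ap0 i = (if i = 0 then op_id else op_ap i)"

definition op_kprod :: "nat \<Rightarrow> nat \<Rightarrow> fop" where
  "op_kprod a b = foldr op_mul (map op_k [a..<Suc b]) op_id"

definition op_sum :: "nat list \<Rightarrow> (nat \<Rightarrow> fop) \<Rightarrow> fop" where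
  "op_sum is F = foldr (\<lambda>i acc. op_add (F i) acc) is op_zero"

definition Tmat :: "nat \<Rightarrow> nat \<Rightarrow> nat \<Rightarrow> rat poly \<Rightarrow> fop" where
  "Tmat n i \<alpha> z =
     (if \<alpha> = 0 then op_ap0 i
      else if \<alpha> = i + 1 then op_scale z (op_kprod \<alpha> (n - 1))
      else if i + 2 \<le> \<alpha> then op_scale z (op_mul (op_ap0 i) (op_mul (op_am (\<alpha> - 1)) (op_kprod \<alpha> (n - 1))))
      else op_zero)"

definition op_shift :: "nat \<Rightarrow> fop \<Rightarrow> fop" where
  "op_shift p A e d = (if take p e = take p d then A (drop p e) (drop p d) else 0)"

fun Xop :: "nat \<Rightarrow> nat \<Rightarrow> rat poly \<Rightarrow> fop" where
  "Xop 0 \<alpha> z = (if \<alpha> = 0 then op_id else op_zero)"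
| "Xop (Suc m) \<alpha> z =
     op_sum [0..<Suc m] (\<lambda>i. op_mul (op_shift m (Xop m i z)) (Tmat (Suc m) i \<alpha> z))"

definition Nn :: "nat \<Rightarrow> nat" where "Nn n = n * (n - 1) div 2"

definition Xprod :: "nat \<Rightarrow> nat list \<Rightarrow> fop" where
  "Xprod n \<sigma> = foldr (\<lambda>s acc. op_mul (Xop n s 1) acc) \<sigma> op_id"

text \<open>Trace over F^{\<otimes> N}: the (t-adically convergent) sum of diagonal entries
  over all basis states; convergence means that each power of t receives
  contributions from only finitely many basis states.\<close>
definition trace_conv :: "nat \<Rightarrow> fop \<Rightarrow> bool" where
  "trace_conv N M = (\<forall>k. finite {d. length d = N \<and> coeff (M d d) k \<noteq> 0})"

definition op_trace :: "nat \<Rightarrow> fop \<Rightarrow> rat fps" where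
  "op_trace N M = Abs_fps (\<lambda>k. \<Sum>d\<in>{d. length d = N \<and> coeff (M d d) k \<noteq> 0}. coeff (M d d) k)"

text \<open>Row contents: None = no ball, Some 0 = free (uncolored, unpaired) ball,
  Some c (c \<ge> 1) = ball of color c. Columns are 0..L-1.\<close>

type_synonym mrow = "nat option list"

definition cyc_between :: "nat \<Rightarrow> nat \<Rightarrow> nat \<Rightarrow> nat \<Rightarrow> bool" where
  "cyc_between L j' j x = (0 < (x + L - j') mod L \<and> (x + L - j') mod L < (j + L - j') mod L)"

definition pair_wt :: "'a::field \<Rightarrow> 'a \<Rightarrow> nat \<Rightarrow> nat \<Rightarrow> nat \<Rightarrow> nat list \<Rightarrow> nat \<Rightarrow> nat \<Rightarrow> 'a" where
  "pair_wt t q c r L free j j' =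
     (let f = length free;
          s = length (filter (cyc_between L j' j) free);
          w = (if j < j' then 1 else 0 :: nat)
      in (1 - t) * t ^ s * q ^ ((c - r + 1) * w) / (1 - q ^ (c - r + 1) * t ^ f))"

text \<open>Pair the color-c balls of Row r (in columns J, left to right) with balls of
  Row r-1 (current contents "row"); returns all possible outcomes with weights.\<close>
fun pair_step :: "'a::field \<Rightarrow> 'a \<Rightarrow> nat \<Rightarrow> nat \<Rightarrow> nat list \<Rightarrow> mrow \<Rightarrow> ('a \<times> mrow) list" where
  "pair_step t q c r [] row = [(1, row)]"
| "pair_step t q c r (j # js) row =
     (let free = filter (\<lambda>x. row ! x = Some 0) [0..<length row] in
      if row ! j = Some 0 then pair_step t q c r js (row[j := Some c])
      else concat (map (\<lambda>j'. map (\<lambda>(w, row'). (pair_wt t q c r (length row) free j j' * w, row'))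
                                 (pair_step t q c r js (row[j' := Some c]))) free))"

definition color_cols :: "nat \<Rightarrow> mrow \<Rightarrow> nat list" where
  "color_cols c row = filter (\<lambda>x. row ! x = Some c) [0..<length row]"

fun sub_rounds :: "'a::field \<Rightarrow> 'a \<Rightarrow> nat \<Rightarrow> nat \<Rightarrow> (nat \<Rightarrow> mrow) \<Rightarrow> ('a \<times> (nat \<Rightarrow> mrow)) list" where
  "sub_rounds t q c 0 G = [(1, G)]"
| "sub_rounds t q c (Suc 0) G = [(1, G)]"
| "sub_rounds t q c (Suc (Suc k)) G =
     concat (map (\<lambda>(w, row'). map (\<lambda>(w', G'). (w * w', G'))
                                   (sub_rounds t q c (Suc k) (G(Suc k := row'))))
                 (pair_step t q c (Suc (Suc k)) (color_cols c (G (Suc (Suc k)))) (G (Suc k))))"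

fun rounds :: "'a::field \<Rightarrow> 'a \<Rightarrow> nat \<Rightarrow> (nat \<Rightarrow> mrow) \<Rightarrow> ('a \<times> (nat \<Rightarrow> mrow)) list" where
  "rounds t q 0 G = [(1, G)]"
| "rounds t q (Suc 0) G = [(1, G)]"
| "rounds t q (Suc (Suc k)) G =
     (let c = Suc (Suc k);
          G1 = G(c := map (\<lambda>x. if x = Some 0 then Some c else x) (G c))
      in concat (map (\<lambda>(w, G'). map (\<lambda>(w', G''). (w * w', G'')) (rounds t q (Suc k) G'))
                     (sub_rounds t q c c G1)))"

definition final_config :: "mrow \<Rightarrow> nat list" where
  "final_config row = map (\<lambda>x. case x of None \<Rightarrow> 0 | Some 0 \<Rightarrow> 1 | Some c \<Rightarrow> c) row"

definition lvec :: "nat list \<Rightarrow> nat \<Rightarrow> nat" where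
  "lvec m r = (\<Sum>i\<in>{r..<length m}. m ! i)"

definition ball_systems :: "nat \<Rightarrow> nat \<Rightarrow> nat list \<Rightarrow> (nat \<Rightarrow> bool list) set" where
  "ball_systems n L m = {bs. (\<forall>r\<in>{1..n}. length (bs r) = L \<and> count_list (bs r) True = lvec m r)
                            \<and> (\<forall>r. r \<notin> {1..n} \<longrightarrow> bs r = [])}"

definition init_grid :: "(nat \<Rightarrow> bool list) \<Rightarrow> nat \<Rightarrow> mrow" where
  "init_grid bs r = map (\<lambda>b. if b then Some 0 else None) (bs r)"

definition P_MLQ :: "'a::field \<Rightarrow> 'a \<Rightarrow> nat \<Rightarrow> nat \<Rightarrow> nat list \<Rightarrow> nat list \<Rightarrow> 'a" where
  "P_MLQ t q n L m \<sigma> =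
     (\<Sum>bs\<in>ball_systems n L m.
        sum_list (map fst (filter (\<lambda>(w, G). final_config (G 1) = \<sigma>) (rounds t q n (init_grid bs)))))"

definition poly_fls :: "rat poly \<Rightarrow> rat fls" where
  "poly_fls p = fps_to_fls (fps_of_poly p)"

end

theory Submission
  imports Defs
begin

text \<open>
  At $q = 1$ the weight of a pairing does not depend on the rows involved, so the weight of a
  coloured grid factorises over pairs of adjacent rows and, for each pair, over colours. The
  factor of one colour is $(1 - t^K)$ times the trace over a single oscillator space $F$ of a
  word with one letter per column. Write $J$ for the columns of the balls to be paired, $A$ for
  the free boxes of the row above, $S \subseteq A$ for the boxes chosen, and $K = |A| - |S|$. A
  column outside $A$ carries the letter $a^+$ if it lies in $J$ and $1$ otherwise; a column in
  $A$ outside $S$ carries $k$; a column of $S$ carries $1$ if it lies in $J$ and $a^-$ otherwise.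
  Carrying one $a^+$ once around the trace by means of $k a^+ = t a^+ k$ and
  $a^- a^+ = t a^+ a^- + (1 - t)$ reproduces exactly the recursion defining the pairing weights.
  On the other side, the recursive definition of $X^{(n)}$ expands the trace into a sum over the
  second row, with a product over the oscillator spaces of these same one-space traces.
\<close>


section \<open>Words of oscillators and their traces\<close>

text \<open>For colour c between Rows r and r - 1 the exponent K equals
  \<open>m_(r-1) + ... + m_(c-1)\<close>. It depends on the particle content alone and is positive,
  so the factors 1 - t^K leave the sum, and their product over 2 <= r <= c <= n is C(m). The two
  index sets still have to be matched. Different pairings can lead to the same coloured grid, so
  weights are first added over all pairings with a fixed final grid; such grids are chains of
  configurations, one per row, whose content loses its lowest species at each step. The expanded
  trace runs over all second rows instead; there charge conservation in each oscillator space kills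
  the rows of wrong content, and the vanishing entries of T impose, column by column, the rule that
  a free ball directly above must be chosen. Traces are power series, so every exchange of sums
  needs convergence. It always comes from a letter k, that is, from a box of A outside S, which
  exists because the content is positive; k suppresses high occupation numbers.\<close>

definition fam_conv :: "'b set \<Rightarrow> ('b \<Rightarrow> 'a::zero fps) \<Rightarrow> bool" where
  "fam_conv X F \<longleftrightarrow> (\<forall>k. finite {x\<in>X. F x $ k \<noteq> 0})"

text \<open>Sums are taken coefficient by coefficient, as in the trace of the statement; under
  \<open>fam_conv\<close> every coefficient is a finite sum.\<close>

definition fam_sum :: "'b set \<Rightarrow> ('b \<Rightarrow> 'a::comm_monoid_add fps) \<Rightarrow> 'a fps" where
  "fam_sum X F = Abs_fps (\<lambda>k. \<Sum>x | x \<in> X \<and> F x $ k \<noteq> 0. F x $ k)"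

lemma fam_sum_nth:
  assumes "finite Y" "Y \<subseteq> X" "\<And>x. x \<in> X - Y \<Longrightarrow> F x $ k = 0"
  shows "fam_sum X F $ k = (\<Sum>x\<in>Y. F x $ k)"
  unfolding fam_sum_def fps_nth_Abs_fps
  by (rule sum.mono_neutral_left) (use assms in auto)

lemma fam_convI:
  assumes "\<And>k. \<exists>Y. finite Y \<and> (\<forall>x\<in>X - Y. F x $ k = 0)"
  shows "fam_conv X F"
  unfolding fam_conv_def
proof
  fix k obtain Y where "finite Y" "\<forall>x\<in>X - Y. F x $ k = 0" using assms by blast
  then show "finite {x\<in>X. F x $ k \<noteq> 0}" by (auto intro: finite_subset[of _ Y])
qed

lemma fam_conv_cong: "(\<And>x. x \<in> X \<Longrightarrow> F x = G x) \<Longrightarrow> fam_conv X F \<longleftrightarrow> fam_conv X G"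
proof -
  assume "\<And>x. x \<in> X \<Longrightarrow> F x = G x"
  then have "{x\<in>X. F x $ k \<noteq> 0} = {x\<in>X. G x $ k \<noteq> 0}" for k by auto
  then show ?thesis by (simp add: fam_conv_def)
qed

lemma fam_sum_cong: "(\<And>x. x \<in> X \<Longrightarrow> F x = G x) \<Longrightarrow> fam_sum X F = fam_sum X G"
  unfolding fam_sum_def by (intro arg_cong[where f=Abs_fps] ext sum.cong) auto

lemma fam_sum_neutral:
  assumes "Y \<subseteq> X" "\<And>x. x \<in> X - Y \<Longrightarrow> F x = 0"
  shows "fam_sum X F = fam_sum Y F"
proof -
  have "{x. x \<in> X \<and> F x $ k \<noteq> 0} = {x. x \<in> Y \<and> F x $ k \<noteq> 0}" for k
    using assms by force
  then show ?thesis by (simp add: fam_sum_def)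
qed

lemma fam_sum_reindex:
  assumes "inj_on h X"
  shows "fam_sum (h ` X) F = fam_sum X (\<lambda>x. F (h x))"
proof (rule fps_ext)
  fix k
  have "{y. y \<in> h ` X \<and> F y $ k \<noteq> 0} = h ` {x. x \<in> X \<and> F (h x) $ k \<noteq> 0}" by auto
  moreover have "inj_on h {x. x \<in> X \<and> F (h x) $ k \<noteq> 0}"
    using assms by (rule inj_on_subset) auto
  ultimately show "fam_sum (h ` X) F $ k = fam_sum X (\<lambda>x. F (h x)) $ k"
    by (simp add: fam_sum_def sum.reindex)
qed

lemma fam_conv_reindex:
  assumes "inj_on h X"
  shows "fam_conv (h ` X) F \<longleftrightarrow> fam_conv X (\<lambda>x. F (h x))"
proof -
  have "{y \<in> h ` X. F y $ k \<noteq> 0} = h ` {x \<in> X. F (h x) $ k \<noteq> 0}" for k by auto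
  moreover have "inj_on h {x \<in> X. F (h x) $ k \<noteq> 0}" for k
    using assms by (rule inj_on_subset) auto
  ultimately show ?thesis by (simp add: fam_conv_def finite_image_iff)
qed

lemma fam_sum_add:
  assumes "fam_conv X F" "fam_conv X G"
  shows "fam_conv X (\<lambda>x. F x + G x)" "fam_sum X (\<lambda>x. F x + G x) = fam_sum X F + fam_sum X G"
proof -
  let ?Y = "\<lambda>k. {x\<in>X. F x $ k \<noteq> 0} \<union> {x\<in>X. G x $ k \<noteq> 0}"
  have f: "finite (?Y k)" for k using assms by (simp add: fam_conv_def)
  show "fam_conv X (\<lambda>x. F x + G x)"
  proof (rule fam_convI)
    fix k show "\<exists>Y. finite Y \<and> (\<forall>x\<in>X - Y. (F x + G x) $ k = 0)"
      by (rule exI[of _ "?Y k"]) (use f[of k] in auto)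
  qed
  show "fam_sum X (\<lambda>x. F x + G x) = fam_sum X F + fam_sum X G"
  proof (rule fps_ext)
    fix k
    have "fam_sum X F $ k = (\<Sum>x\<in>?Y k. F x $ k)"
      by (rule fam_sum_nth[OF f]) auto
    moreover have "fam_sum X G $ k = (\<Sum>x\<in>?Y k. G x $ k)"
      by (rule fam_sum_nth[OF f]) auto
    moreover have "fam_sum X (\<lambda>x. F x + G x) $ k = (\<Sum>x\<in>?Y k. (F x + G x) $ k)"
      by (rule fam_sum_nth[OF f]) auto
    ultimately show "fam_sum X (\<lambda>x. F x + G x) $ k = (fam_sum X F + fam_sum X G) $ k"
      by (simp add: sum.distrib)
  qed
qed

lemma fam_sum_sum:
  assumes "finite I" "\<And>i. i \<in> I \<Longrightarrow> fam_conv X (F i)"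
  shows "fam_conv X (\<lambda>x. \<Sum>i\<in>I. F i x) \<and> fam_sum X (\<lambda>x. \<Sum>i\<in>I. F i x) = (\<Sum>i\<in>I. fam_sum X (F i))"
  using assms
proof (induction I rule: finite_induct)
  case empty
  then show ?case by (simp add: fam_conv_def fam_sum_def fps_eq_iff)
next
  case (insert a I)
  then show ?case using fam_sum_add[of X "F a" "\<lambda>x. \<Sum>i\<in>I. F i x"] by simp
qed

text \<open>The coefficient of degree k of a product involves only degrees up to k of the factors,
  so finitely many indices on either side matter and the Cauchy product can be regrouped. This turns
  a trace over a tensor product into a product of traces.\<close>

lemma fam_sum_times:
  fixes F :: "'b \<Rightarrow> 'a::comm_ring_1 fps"
  assumes "fam_conv X F" "fam_conv Y G"
  shows "fam_conv (X \<times> Y) (\<lambda>(x,y). F x * G y)"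
    "fam_sum (X \<times> Y) (\<lambda>(x,y). F x * G y) = fam_sum X F * fam_sum Y G"
proof -
  define U where "U k = (\<Union>i\<le>k. {x\<in>X. F x $ i \<noteq> 0})" for k
  define V where "V k = (\<Union>i\<le>k. {x\<in>Y. G x $ i \<noteq> 0})" for k
  have fU: "finite (U k)" and fV: "finite (V k)" for k
    using assms by (auto simp: U_def V_def fam_conv_def)
  have UF: "F x $ i = 0" if "x \<in> X - U k" "i \<le> k" for x i k using that by (auto simp: U_def)
  have VG: "G x $ i = 0" if "x \<in> Y - V k" "i \<le> k" for x i k using that by (auto simp: V_def)
  have z: "(case p of (x,y) \<Rightarrow> F x * G y) $ k = 0" if p: "p \<in> X \<times> Y - U k \<times> V k" for p k
  proof -
    obtain x y where [simp]: "p = (x,y)" by (cases p)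
    have "F x $ i * G y $ (k - i) = 0" if "i \<le> k" for i
      using p UF[of x k i] VG[of y k "k - i"] that by auto
    then show ?thesis by (simp add: fps_mult_nth)
  qed
  show "fam_conv (X \<times> Y) (\<lambda>(x,y). F x * G y)"
  proof (rule fam_convI)
    fix k show "\<exists>Z. finite Z \<and> (\<forall>p\<in>X \<times> Y - Z. (case p of (x,y) \<Rightarrow> F x * G y) $ k = 0)"
      by (rule exI[of _ "U k \<times> V k"], intro conjI ballI finite_cartesian_product fU fV z)
  qed
  show "fam_sum (X \<times> Y) (\<lambda>(x,y). F x * G y) = fam_sum X F * fam_sum Y G"
  proof (rule fps_ext)
    fix k
    have "fam_sum (X \<times> Y) (\<lambda>(x,y). F x * G y) $ k = (\<Sum>p\<in>U k \<times> V k. (case p of (x,y) \<Rightarrow> F x * G y) $ k)"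
      by (rule fam_sum_nth[OF finite_cartesian_product[OF fU fV] _ z]) (auto simp: U_def V_def)
    also have "\<dots> = (\<Sum>x\<in>U k. \<Sum>y\<in>V k. \<Sum>i=0..k. F x $ i * G y $ (k - i))"
      by (subst sum.cartesian_product) (rule sum.cong[OF refl], clarsimp simp: fps_mult_nth)
    also have "\<dots> = (\<Sum>x\<in>U k. \<Sum>i=0..k. \<Sum>y\<in>V k. F x $ i * G y $ (k - i))"
      by (intro sum.cong refl) (rule sum.swap)
    also have "\<dots> = (\<Sum>i=0..k. \<Sum>x\<in>U k. \<Sum>y\<in>V k. F x $ i * G y $ (k - i))"
      by (rule sum.swap)
    also have "\<dots> = (\<Sum>i=0..k. (\<Sum>x\<in>U k. F x $ i) * (\<Sum>y\<in>V k. G y $ (k - i)))"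
      by (simp add: sum_product)
    also have "\<dots> = (\<Sum>i=0..k. fam_sum X F $ i * fam_sum Y G $ (k - i))"
    proof (rule sum.cong[OF refl])
      fix i assume i: "i \<in> {0..k}"
      have "fam_sum X F $ i = (\<Sum>x\<in>U k. F x $ i)"
        by (rule fam_sum_nth[OF fU _ UF[of _ k]]) (use i in \<open>auto simp: U_def\<close>)
      moreover have "fam_sum Y G $ (k - i) = (\<Sum>x\<in>V k. G x $ (k - i))"
        by (rule fam_sum_nth[OF fV _ VG[of _ k]]) (auto simp: V_def)
      ultimately show "(\<Sum>x\<in>U k. F x $ i) * (\<Sum>y\<in>V k. G y $ (k - i)) = fam_sum X F $ i * fam_sum Y G $ (k - i)" by simp
    qed
    finally show "fam_sum (X \<times> Y) (\<lambda>(x,y). F x * G y) $ k = (fam_sum X F * fam_sum Y G) $ k"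
      by (simp add: fps_mult_nth)
  qed
qed

text \<open>A constant is the sum of a family over a one-point index set, so this is an instance of
  the product rule.\<close>

lemma fam_sum_cmult:
  fixes F :: "'b \<Rightarrow> 'a::comm_ring_1 fps"
  assumes "fam_conv X F"
  shows "fam_conv X (\<lambda>x. c * F x)" "fam_sum X (\<lambda>x. c * F x) = c * fam_sum X F"
proof -
  have 1: "fam_conv {()} (\<lambda>_. c)" by (simp add: fam_conv_def)
  have s: "fam_sum {()} (\<lambda>_. c) = c"
    by (rule fps_ext, subst fam_sum_nth[of "{()}"]) auto
  have inj: "inj_on (Pair ()) X" by (simp add: inj_on_def)
  have im: "{()} \<times> X = Pair () ` X" by auto
  note t = fam_sum_times[OF 1 assms]
  show "fam_conv X (\<lambda>x. c * F x)"
    using t(1) unfolding im fam_conv_reindex[OF inj] by simp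
  show "fam_sum X (\<lambda>x. c * F x) = c * fam_sum X F"
    using t(2) unfolding im fam_sum_reindex[OF inj] s by simp
qed

text \<open>Trace of a tensor product of N one-factor operators: a basis state is the list of the N
  occupation numbers, and the product rule is applied once per factor.\<close>

lemma fam_prod_lists:
  fixes F :: "nat \<Rightarrow> 'b \<Rightarrow> 'a::comm_ring_1 fps"
  assumes "\<And>r. r < N \<Longrightarrow> fam_conv UNIV (F r)"
  shows "fam_conv {u. length u = N} (\<lambda>u. \<Prod>r<N. F r (u ! r)) \<and>
    fam_sum {u. length u = N} (\<lambda>u. \<Prod>r<N. F r (u ! r)) = (\<Prod>r<N. fam_sum UNIV (F r))"
  using assms
proof (induction N arbitrary: F)
  case 0
  have "fam_sum {[]} (\<lambda>u. 1 :: 'a fps) = 1"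
    by (rule fps_ext, subst fam_sum_nth[of "{[]}"]) auto
  then show ?case by (simp add: fam_conv_def)
next
  case (Suc N)
  let ?h = "\<lambda>(x,u). x # u"
  have im: "{u. length u = Suc N} = ?h ` (UNIV \<times> {u. length u = N})"
    by (auto simp: length_Suc_conv image_iff)
  have inj: "inj_on ?h (UNIV \<times> {u. length u = N})" by (auto simp: inj_on_def)
  have eq: "(\<lambda>p. \<Prod>r<Suc N. F r (?h p ! r)) = (\<lambda>(x,u). F 0 x * (\<Prod>r<N. F (Suc r) (u ! r)))"
    by (auto simp: prod.lessThan_Suc_shift simp del: prod.lessThan_Suc)
  have IH: "fam_conv {u. length u = N} (\<lambda>u. \<Prod>r<N. F (Suc r) (u ! r)) \<and>
    fam_sum {u. length u = N} (\<lambda>u. \<Prod>r<N. F (Suc r) (u ! r)) = (\<Prod>r<N. fam_sum UNIV (F (Suc r)))"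
    by (rule Suc.IH) (use Suc.prems in auto)
  have F0: "fam_conv UNIV (F 0)" using Suc.prems by simp
  show ?case
    unfolding im fam_conv_reindex[OF inj] fam_sum_reindex[OF inj] eq
    using fam_sum_times[OF F0 conjunct1[OF IH]] IH
    by (simp add: prod.lessThan_Suc_shift del: prod.lessThan_Suc)
qed

section \<open>Words in the oscillator letters: matrix entries, convergence and cyclicity of the
  trace\<close>

datatype letter = Lid | Lk | Lplus | Lminus

text \<open>A word is an operator product whose rightmost letter acts first. The recursion peels off
  the leftmost letter and follows the row index e, so a raising letter asks for e - 1 and a lowering
  letter for e + 1.\<close>

fun word_entry :: "letter list \<Rightarrow> nat \<Rightarrow> nat \<Rightarrow> rat poly" where
  "word_entry [] e d = (if e = d then 1 else 0)"
| "word_entry (Lid # w) e d = word_entry w e d"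
| "word_entry (Lk # w) e d = tt ^ e * word_entry w e d"
| "word_entry (Lplus # w) e d = (if e = 0 then 0 else word_entry w (e - 1) d)"
| "word_entry (Lminus # w) e d = (1 - tt ^ (e + 1)) * word_entry w (e + 1) d"

definition word_trace :: "letter list \<Rightarrow> rat fps" where
  "word_trace w = fam_sum UNIV (\<lambda>d. fps_of_poly (word_entry w d d))"

lemma word_entry_snoc:
  "word_entry (w @ [Lid]) e d = word_entry w e d"
  "word_entry (w @ [Lk]) e d = tt ^ d * word_entry w e d"
  "word_entry (w @ [Lplus]) e d = word_entry w e (d + 1)"
  "word_entry (w @ [Lminus]) e d = (if d = 0 then 0 else (1 - tt ^ d) * word_entry w e (d - 1))"
  by (induction w e d rule: word_entry.induct) (auto simp: mult_ac)

text \<open>On the diagonal this forces as many raising as lowering letters, which later singles out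
  the admissible particle content.\<close>

lemma word_entry_charge: "word_entry w e d \<noteq> 0 \<Longrightarrow> e + count_list w Lminus = d + count_list w Lplus"
  by (induction w e d rule: word_entry.induct) (auto split: if_splits)

text \<open>Each letter changes the occupation number by at most one. Read back from the final state
  e, the letter k therefore acts on a state of at least \<open>e - length w\<close> quanta and
  contributes at least that power of t.\<close>

lemma word_entry_dvd: "Lk \<in> set w \<Longrightarrow> tt ^ (e - length w) dvd word_entry w e d"
proof (induction w arbitrary: e)
  case (Cons x w)
  show ?case
  proof (cases x)
    case Lid
    then have "tt ^ (e - length w) dvd word_entry w e d" using Cons by auto
    moreover have "tt ^ (e - length (x # w)) dvd tt ^ (e - length w)" by (rule le_imp_power_dvd) auto
    ultimately show ?thesis using Lid by (auto intro: dvd_trans)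
  next
    case Lk
    then show ?thesis by (auto intro!: dvd_mult2 le_imp_power_dvd)
  next
    case Lplus
    then have "tt ^ (e - 1 - length w) dvd word_entry w (e - 1) d" using Cons.IH[of "e - 1"] Cons.prems by simp
    moreover have "e - length (x # w) = e - 1 - length w" by simp
    ultimately have "tt ^ (e - length (x # w)) dvd word_entry w (e - 1) d" by metis
    then show ?thesis unfolding Lplus word_entry.simps by simp
  next
    case Lminus
    then have "tt ^ (Suc e - length w) dvd word_entry w (Suc e) d" using Cons by auto
    moreover have "tt ^ (e - length (x # w)) dvd tt ^ (Suc e - length w)"
      by (rule le_imp_power_dvd) auto
    ultimately show ?thesis using Lminus by (auto intro: dvd_mult dvd_trans)
  qed
qed simp

lemma tt_power: "tt ^ n = monom 1 n"
  by (simp add: tt_def monom_altdef)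

lemma word_trace_conv:
  assumes "Lk \<in> set w"
  shows "fam_conv UNIV (\<lambda>d. fps_of_poly (word_entry w d d))"
proof (rule fam_convI)
  fix k
  have "coeff (word_entry w d d) k = 0" if "d > k + length w" for d
  proof -
    obtain p where "word_entry w d d = tt ^ (d - length w) * p"
      using word_entry_dvd[OF assms, of d d] by (elim dvdE)
    with that show ?thesis by (simp add: tt_power coeff_monom_mult)
  qed
  then show "\<exists>Y. finite Y \<and> (\<forall>x\<in>UNIV - Y. fps_of_poly (word_entry w x x) $ k = 0)"
    by (intro exI[of _ "{..k + length w}"]) auto
qed

lemma fam_sum_drop0:
  fixes F :: "nat \<Rightarrow> 'a::comm_monoid_add fps"
  assumes "F 0 = 0" shows "fam_sum UNIV F = fam_sum UNIV (\<lambda>d. F (Suc d))"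
proof -
  have "fam_sum UNIV F = fam_sum (range Suc) F"
  proof (rule fam_sum_neutral)
    show "F x = 0" if "x \<in> UNIV - range Suc" for x using that assms by (cases x) auto
  qed simp
  then show ?thesis by (simp add: fam_sum_reindex)
qed

text \<open>For a raising or lowering letter the diagonal entries before and after the move agree up
  to a shift of the state by one; the unmatched entry at state 0 is zero.\<close>

lemma word_trace_cyclic1: "word_trace (x # w) = word_trace (w @ [x])"
proof (cases x)
  case Lplus
  have "word_trace (Lplus # w) = fam_sum UNIV (\<lambda>d. fps_of_poly (word_entry (Lplus # w) (Suc d) (Suc d)))"
    unfolding word_trace_def by (rule fam_sum_drop0) simp
  then show ?thesis by (simp add: Lplus word_trace_def word_entry_snoc)
next
  case Lminus
  have "word_trace (w @ [Lminus]) = fam_sum UNIV (\<lambda>d. fps_of_poly (word_entry (w @ [Lminus]) (Suc d) (Suc d)))"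
    unfolding word_trace_def by (rule fam_sum_drop0) (simp add: word_entry_snoc)
  then show ?thesis by (simp add: Lminus word_trace_def word_entry_snoc)
qed (simp_all add: word_trace_def word_entry_snoc)

lemma word_trace_cyclic: "word_trace (u @ v) = word_trace (v @ u)"
proof (induction u arbitrary: v)
  case (Cons x u)
  have "word_trace ((x # u) @ v) = word_trace (u @ (v @ [x]))" using word_trace_cyclic1[of x "u @ v"] by simp
  also have "\<dots> = word_trace ((v @ [x]) @ u)" by (rule Cons.IH)
  finally show ?case by simp
qed simp

section \<open>Carrying a raising letter through a word indexed by columns\<close>

definition column_letter :: "nat set \<Rightarrow> nat set \<Rightarrow> nat set \<Rightarrow> nat \<Rightarrow> letter" where
  "column_letter J A S x = (if x \<in> A then if x \<in> S then if x \<in> J then Lid else Lminus else Lk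
                   else if x \<in> J then Lplus else Lid)"

abbreviation "word J A S xs \<equiv> map (column_letter J A S) xs"

lemma word_entry_Cons_linear:
  assumes "\<And>e. word_entry u e d = a * word_entry v e d + b * (\<Sum>i\<in>I. c i * word_entry (f i) e d)"
  shows "word_entry (x # u) e d = a * word_entry (x # v) e d + b * (\<Sum>i\<in>I. c i * word_entry (x # f i) e d)"
proof -
  have *: "p * (a * y + b * (\<Sum>i\<in>I. c i * g i)) = a * (p * y) + b * (\<Sum>i\<in>I. c i * (p * g i))"
    for p y g by (simp add: distrib_left sum_distrib_left mult.left_commute)
  show ?thesis by (cases x) (simp_all add: assms *)
qed

text \<open>A column outside A commutes with the raising letter; a column of A outside S gives
  \<open>k a+ = t a+ k\<close>; a column of S outside J gives
  \<open>a- a+ = t a+ a- + (1 - t)\<close>. A column of S in J carries the identity, and its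
  relation is the trivial splitting \<open>a+ = t a+ + (1 - t) a+\<close>: taking away the box above
  a ball of J turns the letter of that column from the identity into a raising letter.\<close>

lemma word_entry_column_letter_plus:
  assumes "S \<subseteq> A" "J \<inter> A \<subseteq> S"
  shows "word_entry (column_letter J A S x # Lplus # v) e d =
    tt ^ (if x \<in> A then 1 else 0) * word_entry (Lplus # column_letter J A S x # v) e d +
    (1 - tt) * (if x \<in> S then word_entry (column_letter J (A - {x}) (S - {x}) x # v) e d else 0)"
  using assms by (cases e) (auto simp: column_letter_def algebra_simps)

text \<open>The columns that a raising letter coming from the right end has crossed before it
  reaches column j.\<close>

definition after :: "nat \<Rightarrow> nat list \<Rightarrow> nat set" where
  "after j xs = set (tl (dropWhile (\<lambda>x. x \<noteq> j) xs))"

lemma column_letter_Diff: "x \<noteq> j \<Longrightarrow> column_letter J (A - {j}) (S - {j}) x = column_letter J A S x"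
  by (simp add: column_letter_def)

lemma word_Diff: "j \<notin> set xs \<Longrightarrow> word J (A - {j}) (S - {j}) xs = word J A S xs"
  by (rule map_cong[OF refl]) (metis column_letter_Diff)

text \<open>Every column of A that is crossed costs a factor t. At a column of S the raising letter
  may stop, with factor 1 - t, and the column then leaves both A and S. The terms of the sum are
  sorted by the stopping column; the first term is the passage through the whole word.\<close>

lemma word_entry_move_plus:
  assumes "distinct xs" "S \<subseteq> A" "J \<inter> A \<subseteq> S"
  shows "word_entry (word J A S xs @ Lplus # v) e d =
    tt ^ card (A \<inter> set xs) * word_entry (Lplus # word J A S xs @ v) e d +
    (1 - tt) * (\<Sum>j\<in>S \<inter> set xs. tt ^ card (A \<inter> after j xs) * word_entry (word J (A - {j}) (S - {j}) xs @ v) e d)"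
  using assms(1)
proof (induction xs arbitrary: e)
  case (Cons x xs)
  then have x: "x \<notin> set xs" and d: "distinct xs" by auto
  let ?l = "column_letter J A S x" and ?w = "word J A S xs @ v"
  let ?W = "\<lambda>j. word J (A - {j}) (S - {j}) (x # xs) @ v"
  have af: "after j (x # xs) = after j xs" if "j \<in> set xs" for j
    using that x by (auto simp: after_def)
  have ax: "after x (x # xs) = set xs" by (simp add: after_def)
  have Sx: "S \<inter> set (x # xs) = (if x \<in> S then insert x (S \<inter> set xs) else S \<inter> set xs)" by auto
  have Wj: "?W j = ?l # word J (A - {j}) (S - {j}) xs @ v" if "j \<in> S \<inter> set xs" for j
  proof -
    have "x \<noteq> j" using that x by auto
    then show ?thesis by (simp only: list.map append.simps column_letter_Diff not_False_eq_True)
  qed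
  have Wx: "?W x = column_letter J (A - {x}) (S - {x}) x # ?w"
    using x by (simp add: word_Diff)
  have card: "card (A \<inter> set (x # xs)) = card (A \<inter> set xs) + (if x \<in> A then 1 else 0)"
    using x by (auto simp: Int_insert_right)
  have "word_entry (word J A S (x # xs) @ Lplus # v) e d = word_entry (?l # word J A S xs @ Lplus # v) e d" by simp
  also have "\<dots> = tt ^ card (A \<inter> set xs) * word_entry (?l # Lplus # ?w) e d +
    (1 - tt) * (\<Sum>j\<in>S \<inter> set xs. tt ^ card (A \<inter> after j xs) * word_entry (?l # word J (A - {j}) (S - {j}) xs @ v) e d)"
    by (rule word_entry_Cons_linear) (rule Cons.IH[OF d])
  also have "(\<Sum>j\<in>S \<inter> set xs. tt ^ card (A \<inter> after j xs) * word_entry (?l # word J (A - {j}) (S - {j}) xs @ v) e d)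
     = (\<Sum>j\<in>S \<inter> set xs. tt ^ card (A \<inter> after j (x # xs)) * word_entry (?W j) e d)"
    by (intro sum.cong refl) (use Wj af in auto)
  also have "word_entry (?l # Lplus # ?w) e d = tt ^ (if x \<in> A then 1 else 0) * word_entry (Lplus # ?l # ?w) e d +
      (1 - tt) * (if x \<in> S then word_entry (?W x) e d else 0)"
    unfolding Wx by (rule word_entry_column_letter_plus) (use assms in auto)
  also have "tt ^ card (A \<inter> set xs) * (tt ^ (if x \<in> A then 1 else 0) * word_entry (Lplus # ?l # ?w) e d +
      (1 - tt) * (if x \<in> S then word_entry (?W x) e d else 0)) +
      (1 - tt) * (\<Sum>j\<in>S \<inter> set xs. tt ^ card (A \<inter> after j (x # xs)) * word_entry (?W j) e d) =
      tt ^ card (A \<inter> set (x # xs)) * word_entry (Lplus # ?l # ?w) e d +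
      (1 - tt) * (\<Sum>j\<in>S \<inter> set (x # xs). tt ^ card (A \<inter> after j (x # xs)) * word_entry (?W j) e d)"
  proof -
    define g where "g j = tt ^ card (A \<inter> after j (x # xs)) * word_entry (?W j) e d" for j
    have gx: "g x = tt ^ card (A \<inter> set xs) * word_entry (?W x) e d" unfolding g_def ax ..
    have *: "sum g (S \<inter> set (x # xs)) = (if x \<in> S then g x else 0) + sum g (S \<inter> set xs)"
      unfolding Sx using x by (cases "x \<in> S") auto
    have alg: "p * (q * y + b * (if P then z else 0)) + b * r = p * q * y + b * ((if P then p * z else 0) + r)"
      for p q y b z r :: "rat poly" and P by (simp add: distrib_left mult.assoc mult.left_commute)
    show ?thesis unfolding g_def[symmetric] * gx card power_add by (rule alg)
  qed
  finally show ?case by simp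
qed simp

text \<open>A linear identity between entries passes to traces once every word on the right has a
  convergent trace, hence a letter k in each of them.\<close>

lemma word_trace_sum:
  assumes "finite I" "Lk \<in> set w" "\<And>i. i \<in> I \<Longrightarrow> Lk \<in> set (f i)"
    "\<And>d. word_entry u d d = a * word_entry w d d + b * (\<Sum>i\<in>I. c i * word_entry (f i) d d)"
  shows "word_trace u = fps_of_poly a * word_trace w + fps_of_poly b * (\<Sum>i\<in>I. fps_of_poly (c i) * word_trace (f i))"
proof -
  let ?p = "fps_of_poly" and ?F = "\<lambda>w d. fps_of_poly (word_entry w d d)"
  have cf: "fam_conv UNIV (?F w)" "\<And>i. i \<in> I \<Longrightarrow> fam_conv UNIV (?F (f i))"
    using assms by (auto intro: word_trace_conv)
  have cs: "fam_conv UNIV (\<lambda>d. ?p (c i) * ?F (f i) d)"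
    "fam_sum UNIV (\<lambda>d. ?p (c i) * ?F (f i) d) = ?p (c i) * word_trace (f i)" if "i \<in> I" for i
    using fam_sum_cmult[OF cf(2)[OF that]] by (auto simp: word_trace_def)
  have s: "fam_conv UNIV (\<lambda>d. \<Sum>i\<in>I. ?p (c i) * ?F (f i) d)"
    "fam_sum UNIV (\<lambda>d. \<Sum>i\<in>I. ?p (c i) * ?F (f i) d) = (\<Sum>i\<in>I. ?p (c i) * word_trace (f i))"
    using fam_sum_sum[OF assms(1) cs(1)] cs(2) by auto
  have "word_trace u = fam_sum UNIV (\<lambda>d. ?p a * ?F w d + ?p b * (\<Sum>i\<in>I. ?p (c i) * ?F (f i) d))"
    by (simp add: word_trace_def assms(4) fps_of_poly_add fps_of_poly_mult fps_of_poly_sum)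
  also have "\<dots> = ?p a * word_trace w + ?p b * (\<Sum>i\<in>I. ?p (c i) * word_trace (f i))"
    using fam_sum_add(2)[OF fam_sum_cmult(1)[OF cf(1), of "?p a"] fam_sum_cmult(1)[OF s(1), of "?p b"]]
      fam_sum_cmult(2)[OF cf(1), of "?p a"] fam_sum_cmult(2)[OF s(1), of "?p b"] s(2)
    by (simp add: word_trace_def)
  finally show ?thesis .
qed

lemma fps_of_poly_tt: "fps_of_poly tt = fps_X"
  by (simp add: tt_def fps_of_poly_pCons)

lemma cyc_between_iff:
  assumes "i < L" "j < L" "x < L" "i \<noteq> j"
  shows "cyc_between L i j x \<longleftrightarrow> (if i < j then i < x \<and> x < j else i < x \<or> x < j)"
proof -
  have m: "(y + L - i) mod L = (if i \<le> y then y - i else y + L - i)" if "y < L" for y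
  proof (cases "i \<le> y")
    case True
    then have "y + L - i = (y - i) + L" by simp
    with True that show ?thesis by (simp only: mod_add_self2) simp
  qed (use that in simp)
  show ?thesis unfolding cyc_between_def m[OF assms(2)] m[OF assms(3)] using assms by auto
qed

lemma after_append_Cons: "i \<notin> set ys \<Longrightarrow> after i (ys @ i # zs) = set zs"
  unfolding after_def by (induction ys) auto

text \<open>With the columns listed cyclically from j + 1 round to j - 1, the crossed columns are
  those strictly between i and j. The exponent collected by the raising letter is thus the exponent
  s of the pairing weight.\<close>

lemma after_rotated:
  assumes i: "i < L" "i \<noteq> j" and j: "j < L"
  shows "after i ([Suc j..<L] @ [0..<j]) = {x. x < L \<and> cyc_between L i j x}"
proof (cases "i < j")
  case True
  have "[0..<j] = [0..<i] @ i # [Suc i..<j]"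
    using upt_add_eq_append[of 0 i "j - i"] upt_conv_Cons[of i j] True by simp
  then have "[Suc j..<L] @ [0..<j] = ([Suc j..<L] @ [0..<i]) @ i # [Suc i..<j]" by simp
  then have "after i ([Suc j..<L] @ [0..<j]) = set [Suc i..<j]"
    using True after_append_Cons[of i "[Suc j..<L] @ [0..<i]"] by simp
  also have "\<dots> = {x. x < L \<and> cyc_between L i j x}"
    using True j i cyc_between_iff[OF i(1) j _ i(2)] by auto
  finally show ?thesis .
next
  case False
  then have ij: "j < i" using i by simp
  have "[Suc j..<L] = [Suc j..<i] @ i # [Suc i..<L]"
    using upt_add_eq_append[of "Suc j" i "L - i"] upt_conv_Cons[of i L] ij i by simp
  then have "[Suc j..<L] @ [0..<j] = [Suc j..<i] @ i # ([Suc i..<L] @ [0..<j])" by simp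
  then have "after i ([Suc j..<L] @ [0..<j]) = set ([Suc i..<L] @ [0..<j])"
    using ij after_append_Cons[of i "[Suc j..<i]"] by simp
  also have "\<dots> = {x. x < L \<and> cyc_between L i j x}"
    using ij j i cyc_between_iff[OF i(1) j _ i(2)] by auto
  finally show ?thesis .
qed

text \<open>One letter $a^+$, at column \<open>j\<close>, is carried once around the trace.\<close>
lemma word_trace_pair:
  assumes "j \<in> J" "j \<notin> A" "j < L" "S \<subseteq> A" "A \<subseteq> {..<L}" "J \<inter> A \<subseteq> S" "A \<noteq> S"
  shows "(1 - fps_X ^ card A) * word_trace (word J A S [0..<L]) =
    (1 - fps_X) * (\<Sum>i\<in>S. fps_X ^ card {x\<in>A. cyc_between L i j x} *
       word_trace (word (J - {j}) (A - {i}) (S - {i}) [0..<L]))"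
proof -
  \<comment> \<open>Cyclic order starting just to the right of j: the letter of column j stands
    alone in front and meets this place again after a full turn.\<close>
  let ?xs = "[Suc j..<L] @ [0..<j]"
  have split: "[0..<L] = [0..<j] @ j # [Suc j..<L]"
    using upt_add_eq_append[of 0 j "L - j"] upt_conv_Cons[of j L] assms(3) by simp
  have set_xs: "set ?xs = {..<L} - {j}" using assms(3) by auto
  have dist: "distinct ?xs" by auto
  have rot: "word_trace (word J' A' S' [0..<L]) = word_trace (column_letter J' A' S' j # word J' A' S' ?xs)" for J' A' S'
  proof -
    have "word_trace (word J' A' S' [0..<L]) = word_trace (word J' A' S' [0..<j] @ (column_letter J' A' S' j # word J' A' S' [Suc j..<L]))"
      unfolding split by simp
    also have "\<dots> = word_trace ((column_letter J' A' S' j # word J' A' S' [Suc j..<L]) @ word J' A' S' [0..<j])"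
      by (rule word_trace_cyclic)
    finally show ?thesis by simp
  qed
  have Axs: "A \<inter> set ?xs = A" "S \<inter> set ?xs = S" unfolding set_xs using assms by auto
  have lj: "column_letter J A S j = Lplus" using assms by (simp add: column_letter_def)
  have "finite S" using assms(4,5) by (meson finite_lessThan finite_subset subset_trans)
  have wj: "word (J - {j}) A' S' ?xs = word J A' S' ?xs" for A' S'
    by (rule map_cong[OF refl]) (auto simp: column_letter_def)
  \<comment> \<open>A box of A outside S survives every choice of i in S, so all words of the
    identity keep a letter k.\<close>
  obtain k where k: "k \<in> A" "k \<notin> S" using assms by auto
  have k': "k \<in> set ?xs" using k assms unfolding set_xs by auto
  have Lk: "Lk \<in> set (word J A S ?xs)"
    using k k' by (auto simp: column_letter_def image_iff intro!: bexI[of _ k])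
  have Lki: "Lk \<in> set (word J (A - {i}) (S - {i}) ?xs)" if "i \<in> S" for i
    using k k' that by (auto simp: column_letter_def image_iff intro!: bexI[of _ k])
  have afteri: "A \<inter> after i ?xs = {x\<in>A. cyc_between L i j x}" if "i \<in> S" for i
  proof -
    have i: "i < L" "i \<noteq> j" using that assms by auto
    show ?thesis unfolding after_rotated[OF i assms(3)] using assms(5) by auto
  qed
  have "word_trace (word J A S [0..<L]) = word_trace (Lplus # word J A S ?xs)" unfolding rot lj ..
  also have "\<dots> = word_trace (word J A S ?xs @ [Lplus])" by (rule word_trace_cyclic1)
  also have "\<dots> = fps_of_poly (tt ^ card A) * word_trace (Lplus # word J A S ?xs) + fps_of_poly (1 - tt) *
     (\<Sum>i\<in>S. fps_of_poly (tt ^ card {x\<in>A. cyc_between L i j x}) * word_trace (word J (A - {i}) (S - {i}) ?xs))"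
  proof (rule word_trace_sum)
    fix d
    show "word_entry (word J A S ?xs @ [Lplus]) d d = tt ^ card A * word_entry (Lplus # word J A S ?xs) d d +
      (1 - tt) * (\<Sum>i\<in>S. tt ^ card {x\<in>A. cyc_between L i j x} * word_entry (word J (A - {i}) (S - {i}) ?xs) d d)"
      using word_entry_move_plus[OF dist assms(4,6), of "[]" d d] afteri unfolding Axs
      by (simp del: word_entry.simps map_append cong: sum.cong)
  qed (use Lk Lki \<open>finite S\<close> in auto)
  also have "word_trace (Lplus # word J A S ?xs) = word_trace (word J A S [0..<L])" unfolding rot lj ..
  also have "(\<Sum>i\<in>S. fps_of_poly (tt ^ card {x\<in>A. cyc_between L i j x}) * word_trace (word J (A - {i}) (S - {i}) ?xs)) =
    (\<Sum>i\<in>S. fps_X ^ card {x\<in>A. cyc_between L i j x} * word_trace (word (J - {j}) (A - {i}) (S - {i}) [0..<L]))"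
  proof (intro sum.cong refl)
    fix i
    \<comment> \<open>Once its raising letter is absorbed, column j carries the identity and
      disappears from the word.\<close>
    have "column_letter (J - {j}) (A - {i}) (S - {i}) j = Lid" using assms by (simp add: column_letter_def)
    then have "word_trace (word (J - {j}) (A - {i}) (S - {i}) [0..<L]) = word_trace (Lid # word J (A - {i}) (S - {i}) ?xs)"
      unfolding rot wj by simp
    then show "fps_of_poly (tt ^ card {x\<in>A. cyc_between L i j x}) * word_trace (word J (A - {i}) (S - {i}) ?xs) =
      fps_X ^ card {x\<in>A. cyc_between L i j x} * word_trace (word (J - {j}) (A - {i}) (S - {i}) [0..<L])"
      by (simp add: fps_of_poly_power fps_of_poly_tt word_trace_def)
  qed
  finally have "word_trace (word J A S [0..<L]) = fps_X ^ card A * word_trace (word J A S [0..<L]) + (1 - fps_X) *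
    (\<Sum>i\<in>S. fps_X ^ card {x\<in>A. cyc_between L i j x} * word_trace (word (J - {j}) (A - {i}) (S - {i}) [0..<L]))"
    by (simp only: fps_of_poly_power fps_of_poly_tt fps_of_poly_diff fps_of_poly_1)
  moreover have "(1 - p) * y = q" if "y = p * y + q" for p q y :: "rat fps"
    using that by (simp add: left_diff_distrib diff_eq_eq add.commute)
  ultimately show ?thesis by blast
qed

text \<open>Only letters k and identities remain, so state d contributes t^(|A| d) and the trace is
  a geometric series. It is summed by splitting off the term d = 0; the rest is t^|A| times the
  whole series.\<close>

lemma word_trace_empty:
  assumes "A \<subseteq> {..<L}" "A \<noteq> {}"
  shows "(1 - fps_X ^ card A) * word_trace (word {} A {} [0..<L]) = 1"
proof -
  have "word_entry (word {} A {} xs) d d = tt ^ (card (A \<inter> set xs) * d)" if "distinct xs" for xs d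
    using that
  proof (induction xs)
    case (Cons x xs)
    then show ?case by (auto simp: column_letter_def Int_insert_right power_add)
  qed simp
  from this[of "[0..<L]"] assms(1)
  have w: "word_entry (word {} A {} [0..<L]) d d = tt ^ (card A * d)" for d
    by (simp add: Int_absorb2 lessThan_atLeast0)
  define F :: "nat \<Rightarrow> rat fps" where "F d = fps_X ^ (card A * d)" for d
  have tr: "word_trace (word {} A {} [0..<L]) = fam_sum UNIV F"
    by (simp add: word_trace_def w F_def[abs_def] fps_of_poly_power fps_of_poly_tt)
  have cA: "card A > 0" using assms finite_subset by (auto simp: card_gt_0_iff)
  have "Lk \<in> set (word {} A {} [0..<L])"
    using assms by (force simp: column_letter_def image_iff)
  from word_trace_conv[OF this] have conv: "fam_conv UNIV F"
    by (simp add: w F_def[abs_def] fps_of_poly_power fps_of_poly_tt)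
  have FS: "fps_X ^ card A * F d = F (Suc d)" for d by (simp add: F_def power_add)
  define G where "G d = (if d = 0 then 0 else F d)" for d
  define H :: "nat \<Rightarrow> rat fps" where "H d = (if d = 0 then 1 else 0)" for d
  have FG: "F = (\<lambda>d. H d + G d)" by (auto simp: G_def F_def H_def)
  have cS: "fam_conv UNIV (\<lambda>d. F (Suc d))"
    using fam_sum_cmult(1)[OF conv, of "fps_X ^ card A"] FS by simp
  have cG: "fam_conv UNIV G"
    using conv unfolding fam_conv_def G_def by (auto elim!: finite_subset[rotated] split: if_splits)
  have cH: "fam_conv UNIV H"
    unfolding fam_conv_def H_def by (auto intro: finite_subset[of _ "{0}"])
  have "fam_sum UNIV G = fam_sum UNIV (\<lambda>d. F (Suc d))"
    by (subst fam_sum_drop0) (simp_all add: G_def)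
  also have "\<dots> = fps_X ^ card A * fam_sum UNIV F"
    using fam_sum_cmult(2)[OF conv, of "fps_X ^ card A"] FS by simp
  finally have G: "fam_sum UNIV G = fps_X ^ card A * fam_sum UNIV F" .
  have "fam_sum UNIV H = 1"
    by (rule fps_ext, subst fam_sum_nth[of "{0}"]) (auto simp: H_def)
  then have "fam_sum UNIV F = 1 + fps_X ^ card A * fam_sum UNIV F"
    using fam_sum_add(2)[OF cH cG] G unfolding FG[symmetric] by simp
  then show ?thesis unfolding tr by (simp add: algebra_simps)
qed

section \<open>Weight of pairing two adjacent rows\<close>

text \<open>The linear functional attached to a list of weighted outcomes. With an indicator as
  argument it gives the total weight of one outcome, and by \<open>wsum_bind\<close> nested
  branching becomes composition of functionals.\<close>

definition wsum :: "('w::comm_semiring_1 \<times> 'b) list \<Rightarrow> ('b \<Rightarrow> 'w) \<Rightarrow> 'w" where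
  "wsum l f = (\<Sum>(w,x)\<leftarrow>l. w * f x)"

lemma wsum_simps [simp]:
  "wsum [] f = 0" "wsum ((w, x) # l) f = w * f x + wsum l f"
  by (simp_all add: wsum_def)

lemma wsum_append: "wsum (l @ l') f = wsum l f + wsum l' f"
  by (simp add: wsum_def)

lemma wsum_scale: "wsum (map (\<lambda>(w, x). (a * w, x)) l) f = a * wsum l f"
  by (induction l) (auto simp: distrib_left mult.assoc)

lemma wsum_concat: "wsum (concat ls) f = (\<Sum>l\<leftarrow>ls. wsum l f)"
  by (induction ls) (auto simp: wsum_append)

lemma wsum_bind:
  "wsum (concat (map (\<lambda>(w, x). map (\<lambda>(w', y). (w * w', y)) (k x)) l)) f = wsum l (\<lambda>x. wsum (k x) f)"
  by (induction l) (auto simp: wsum_append wsum_scale)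

lemma wsum_cong:
  "(\<And>x. x \<in> snd ` set l \<Longrightarrow> f x = g x) \<Longrightarrow> wsum l f = wsum l g"
  by (induction l) auto

lemma wsum_eq_0: "(\<And>x. x \<in> snd ` set l \<Longrightarrow> f x = 0) \<Longrightarrow> wsum l f = 0"
  by (induction l) auto

lemma wsum_mult_right: "wsum l (\<lambda>x. f x * a) = wsum l f * a"
  by (induction l) (auto simp: distrib_right mult.assoc)

lemma wsum_sum: "wsum l (\<lambda>x. \<Sum>i\<in>I. f i x) = (\<Sum>i\<in>I. wsum l (f i))"
  by (induction l) (auto simp: sum_distrib_left sum.distrib)

section \<open>Outcomes of pairing the balls of one colour\<close>

definition paint :: "nat set \<Rightarrow> nat \<Rightarrow> mrow \<Rightarrow> mrow" where
  "paint S c row = map (\<lambda>x. if x \<in> S then Some c else row ! x) [0..<length row]"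

definition free_cols :: "mrow \<Rightarrow> nat set" where
  "free_cols row = {x. x < length row \<and> row ! x = Some 0}"

lemma length_paint [simp]: "length (paint S c row) = length row"
  by (simp add: paint_def)

lemma nth_paint: "x < length row \<Longrightarrow> paint S c row ! x = (if x \<in> S then Some c else row ! x)"
  by (simp add: paint_def)

lemma free_cols_update:
  "c \<noteq> 0 \<Longrightarrow> free_cols (row[j := Some c]) = free_cols row - {j}"
proof (rule set_eqI)
  fix x assume "c \<noteq> 0"
  then show "x \<in> free_cols (row[j := Some c]) \<longleftrightarrow> x \<in> free_cols row - {j}"
    by (cases "x = j") (auto simp: free_cols_def)
qed

lemma paint_update:
  "j \<in> S \<Longrightarrow> paint (S - {j}) c (row[j := Some c]) = paint S c row"
  by (rule nth_equalityI) (auto simp: nth_paint nth_list_update)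

lemma paint_update_insert:
  "j < length row \<Longrightarrow> paint S c (row[j := Some c]) = paint (insert j S) c row"
  by (rule nth_equalityI) (auto simp: nth_paint nth_list_update)

lemma paint_empty: "paint {} c row = row"
  by (simp add: paint_def map_nth)

lemma finite_free_cols [simp]: "finite (free_cols row)"
  by (simp add: free_cols_def)

text \<open>An outcome remembers which boxes were chosen but not by which ball, so several branches
  can share an outcome and their weights add up.\<close>

lemma pair_step_outcome:
  assumes "\<rho> \<in> snd ` set (pair_step t q c r js row)" "c \<noteq> 0" "set js \<subseteq> {..<length row}"
  shows "\<exists>S\<subseteq>free_cols row. card S = length js \<and> \<rho> = paint S c row"
  using assms(1,3)
proof (induction js arbitrary: row)
  case Nil
  then show ?case by (auto simp: paint_empty)
next
  case (Cons j js)
  have step: ?case if i: "i \<in> free_cols row" and o: "\<rho> \<in> snd ` set (pair_step t q c r js (row[i := Some c]))" for i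
  proof -
    obtain S where S: "S \<subseteq> free_cols (row[i := Some c])" "card S = length js"
      "\<rho> = paint S c (row[i := Some c])"
      using Cons.IH[OF o] Cons.prems(2) by auto
    have "i \<notin> S" "S \<subseteq> free_cols row" "finite S" "i < length row"
      using S(1) i finite_subset[OF S(1)] unfolding free_cols_update[OF assms(2)] by (auto simp: free_cols_def)
    then have "insert i S \<subseteq> free_cols row" "card (insert i S) = length (j # js)" "\<rho> = paint (insert i S) c row"
      using S(2,3) i by (simp_all add: paint_update_insert)
    then show ?thesis by blast
  qed
  show ?case
  proof (cases "row ! j = Some 0")
    case True
    then show ?thesis using Cons.prems by (intro step[of j]) (auto simp: free_cols_def)
  next
    case False
    then have "\<rho> \<in> (\<Union>i\<in>free_cols row. snd ` set (pair_step t q c r js (row[i := Some c])))"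
      using Cons.prems(1) by (simp add: Let_def free_cols_def image_UN image_image case_prod_unfold)
    then show ?thesis using step by blast
  qed
qed

lemma pair_wt_1:
  "pair_wt t 1 c r (length row) (filter (\<lambda>x. row ! x = Some 0) [0..<length row]) j i =
   (1 - t) * t ^ card {x \<in> free_cols row. cyc_between (length row) i j x} / (1 - t ^ card (free_cols row))"
proof -
  have s: "length (filter (cyc_between (length row) i j) (filter (\<lambda>x. row ! x = Some 0) [0..<length row]))
     = card {x \<in> free_cols row. cyc_between (length row) i j x}"
    unfolding filter_filter
    by (subst distinct_length_filter, simp, rule arg_cong[where f=card]) (auto simp: free_cols_def)
  have f: "length (filter (\<lambda>x. row ! x = Some 0) [0..<length row]) = card (free_cols row)"
    by (subst distinct_length_filter) (auto simp: free_cols_def intro!: arg_cong[where f=card])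
  show ?thesis unfolding pair_wt_def Let_def s f by simp
qed

section \<open>Closed form for the weight of a one-colour pairing\<close>

lemma fps_X_power_neq_1: "0 < n \<Longrightarrow> (1 :: 'a::{comm_ring_1} fps) - fps_X ^ n \<noteq> 0"
proof
  assume n: "0 < n" and "(1 :: 'a fps) - fps_X ^ n = 0"
  then have "((1 :: 'a fps) - fps_X ^ n) $ 0 = 0 $ 0" by metis
  with n show False by (simp add: fps_X_power_nth)
qed

text \<open>Total weight of all pairings of the balls J with exactly the boxes S, out of the free
  boxes A. The indicator expresses that a free box directly above a ball is always chosen. The
  exponent \<open>card A - card S\<close> is unchanged by each single pairing, and the prefactor
  makes the weight 1 when nothing is left to pair.\<close>

definition pair_tr :: "nat set \<Rightarrow> nat set \<Rightarrow> nat set \<Rightarrow> nat \<Rightarrow> rat fps" where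
  "pair_tr J A S L = of_bool (J \<inter> A \<subseteq> S) * ((1 - fps_X ^ (card A - card S)) * word_trace (word J A S [0..<L]))"

text \<open>A forced pairing straight up has weight 1, and the word does not see it: a column in J,
  A and S carries the identity, and so does a column in none of them.\<close>

lemma pair_tr_free:
  assumes "j \<notin> J" "j \<in> S" "S \<subseteq> A" "finite A"
  shows "pair_tr J (A - {j}) (S - {j}) L = pair_tr (insert j J) A S L"
proof -
  have "column_letter J (A - {j}) (S - {j}) = column_letter (insert j J) A S"
    by (rule ext) (use assms in \<open>auto simp: column_letter_def\<close>)
  moreover have "J \<inter> (A - {j}) \<subseteq> S - {j} \<longleftrightarrow> insert j J \<inter> A \<subseteq> S" using assms by auto
  moreover have "card (A - {j}) - card (S - {j}) = card A - card S"
  proof -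
    have "j \<in> A" "finite S" "card S > 0" using assms finite_subset by (auto simp: card_gt_0_iff)
    then show ?thesis using assms by simp
  qed
  ultimately show ?thesis unfolding pair_tr_def by (simp only:)
qed

text \<open>The weight recursion for a ball j with no free box above it: 1 - t^|A| is the
  denominator of a pairing weight, and the coefficients on the right are the numerators. If the
  indicator on the left fails, the offending box lies in J and outside S, hence differs from every i
  in S and makes each summand vanish as well.\<close>

lemma pair_tr_choose:
  assumes "j \<notin> J" "j \<notin> A" "j < L" "S \<subseteq> A" "A \<subseteq> {..<L}" "A \<noteq> S"
  shows "(1 - fps_X ^ card A) * pair_tr (insert j J) A S L =
    (\<Sum>i\<in>S. (1 - fps_X) * fps_X ^ card {x\<in>A. cyc_between L i j x} * pair_tr J (A - {i}) (S - {i}) L)"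
proof (cases "insert j J \<inter> A \<subseteq> S")
  case True
  have fin: "finite A" by (rule finite_subset[OF assms(5)]) simp
  then have finS: "finite S" using assms(4) by (rule finite_subset[rotated])
  have J: "insert j J - {j} = J" using assms(1) by auto
  have c1: "card (A - {i}) - card (S - {i}) = card A - card S" if "i \<in> S" for i
  proof -
    have "i \<in> A" using that assms(4) by auto
    moreover have "card S > 0" using that finS by (auto simp: card_gt_0_iff)
    ultimately show ?thesis using that by (simp add: card_Diff_singleton)
  qed
  have c2: "J \<inter> (A - {i}) \<subseteq> S - {i}" for i using True by auto
  have tr: "pair_tr J (A - {i}) (S - {i}) L =
      (1 - fps_X ^ (card A - card S)) * word_trace (word J (A - {i}) (S - {i}) [0..<L])" if "i \<in> S" for i
    using c1[OF that] c2[of i] by (simp only: pair_tr_def of_bool_eq mult_1_left if_True)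
  have "(1 - fps_X ^ card A) * pair_tr (insert j J) A S L =
    (1 - fps_X ^ (card A - card S)) * ((1 - fps_X ^ card A) * word_trace (word (insert j J) A S [0..<L]))"
    using True by (simp only: pair_tr_def of_bool_eq mult_1_left mult.left_commute)
  also have "(1 - fps_X ^ card A) * word_trace (word (insert j J) A S [0..<L]) =
     (1 - fps_X) * (\<Sum>i\<in>S. fps_X ^ card {x\<in>A. cyc_between L i j x} * word_trace (word J (A - {i}) (S - {i}) [0..<L]))"
    using word_trace_pair[of j "insert j J", OF _ assms(2-5) True assms(6)] unfolding J by simp
  also have "(1 - fps_X ^ (card A - card S)) * \<dots> = (\<Sum>i\<in>S. (1 - fps_X) * fps_X ^ card {x\<in>A. cyc_between L i j x} * pair_tr J (A - {i}) (S - {i}) L)"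
    unfolding sum_distrib_left
  proof (rule sum.cong[OF refl])
    fix i assume "i \<in> S"
    have "a * (b * (c * d)) = b * c * (a * d)" for a b c d :: "rat fps" by (simp only: mult_ac)
    then show "(1 - fps_X ^ (card A - card S)) * ((1 - fps_X) * (fps_X ^ card {x\<in>A. cyc_between L i j x} *
        word_trace (word J (A - {i}) (S - {i}) [0..<L]))) =
      (1 - fps_X) * fps_X ^ card {x\<in>A. cyc_between L i j x} * pair_tr J (A - {i}) (S - {i}) L"
      unfolding tr[OF \<open>i \<in> S\<close>] by blast
  qed
  finally show ?thesis .
next
  case False
  then have "\<not> J \<inter> (A - {i}) \<subseteq> S - {i}" if "i \<in> S" for i using assms that by auto
  with False show ?thesis by (simp add: pair_tr_def)
qed

lemma fps_to_fls_sum: "fps_to_fls (\<Sum>i\<in>I. f i) = (\<Sum>i\<in>I. fps_to_fls (f i))"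
  by (induction I rule: infinite_finite_induct) simp_all

lemma fps_to_fls_prod: "fps_to_fls (\<Prod>i\<in>I. f i) = (\<Prod>i\<in>I. fps_to_fls (f i))"
  by (induction I rule: infinite_finite_induct) (simp_all add: fls_times_fps_to_fls)

text \<open>Induction on the balls still to be paired, by the two recursions above. The closed form
  depends on \<open>js\<close> only through its set, so the order of processing does not influence
  the total weight. The strict inequality leaves a box unchosen, which keeps the traces
  convergent.\<close>

lemma pair_step_weight:
  assumes "c \<noteq> 0" "distinct js" "set js \<subseteq> {..<length row}" "S \<subseteq> free_cols row"
    "card S = length js" "length js < card (free_cols row)"
  shows "wsum (pair_step fls_X 1 c r js row) (\<lambda>\<rho>. of_bool (\<rho> = paint S c row)) =
    fps_to_fls (pair_tr (set js) (free_cols row) S (length row))"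
  using assms(2-)
proof (induction js arbitrary: row S)
  case Nil
  then have "S = {}" using finite_subset[of S "free_cols row"] by auto
  moreover have "free_cols row \<noteq> {}" using Nil by auto
  moreover have "free_cols row \<subseteq> {..<length row}" by (auto simp: free_cols_def)
  ultimately show ?case
    using word_trace_empty[of "free_cols row" "length row"] by (simp add: paint_empty pair_tr_def)
next
  case (Cons j js)
  let ?A = "free_cols row" and ?L = "length row"
  let ?f = "\<lambda>\<rho>. of_bool (\<rho> = paint S c row) :: rat fls"
  have j: "j \<notin> set js" "j < ?L" "distinct js" "set js \<subseteq> {..<?L}" using Cons.prems by auto
  have fin: "finite S" by (rule finite_subset[OF Cons.prems(3)]) simp
  \<comment> \<open>A box taken outside S would end with colour c, whereas the target leaves it
    free.\<close>
  have out: "wsum (pair_step fls_X 1 c r js (row[i := Some c])) ?f = 0" if i: "i \<in> ?A - S" for i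
  proof (rule wsum_eq_0)
    fix \<rho> assume "\<rho> \<in> snd ` set (pair_step fls_X 1 c r js (row[i := Some c]))"
    then obtain S' where "\<rho> = paint S' c (row[i := Some c])" using pair_step_outcome[of \<rho>] assms(1) j by (metis length_list_update)
    then have "\<rho> ! i = Some c" using i by (auto simp: nth_paint free_cols_def)
    moreover have "paint S c row ! i = Some 0" using i by (auto simp: nth_paint free_cols_def)
    ultimately have "\<rho> \<noteq> paint S c row" using assms(1) by force
    then show "?f \<rho> = 0" by simp
  qed
  have IH: "wsum (pair_step fls_X 1 c r js (row[i := Some c])) ?f =
     fps_to_fls (pair_tr (set js) (?A - {i}) (S - {i}) ?L)" if i: "i \<in> S" for i
  proof -
    have iA: "i \<in> ?A" using i Cons.prems by auto
    have "S - {i} \<subseteq> free_cols (row[i := Some c])" "card (S - {i}) = length js"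
      "length js < card (free_cols (row[i := Some c]))" "set js \<subseteq> {..<length (row[i := Some c])}"
      unfolding free_cols_update[OF assms(1)] card_Diff_singleton[OF i] card_Diff_singleton[OF iA]
      using Cons.prems by auto
    from Cons.IH[OF j(3) this(4,1,2,3)] show ?thesis
      by (simp only: paint_update[OF i] free_cols_update[OF assms(1)] length_list_update)
  qed
  show ?case
  proof (cases "row ! j = Some 0")
    case True
    then have jA: "j \<in> ?A" using j by (auto simp: free_cols_def)
    have eq: "wsum (pair_step fls_X 1 c r (j # js) row) ?f = wsum (pair_step fls_X 1 c r js (row[j := Some c])) ?f"
      using True by (simp add: Let_def)
    show ?thesis
    proof (cases "j \<in> S")
      case True
      then show ?thesis unfolding eq using IH[OF True] pair_tr_free[OF j(1) True] Cons.prems by simp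
    next
      case False
      \<comment> \<open>The forced box is not in the target set: no branch reaches the target, and
        the indicator in \<open>pair_tr\<close> fails because j lies in J and A but not in
        S.\<close>
      then show ?thesis unfolding eq using out[of j] jA by (auto simp: pair_tr_def)
    qed
  next
    case False
    then have jA: "j \<notin> ?A" by (auto simp: free_cols_def)
    let ?wt = "\<lambda>i. (1 - fls_X) * fls_X ^ card {x \<in> ?A. cyc_between ?L i j x} / (1 - fls_X ^ card ?A) :: rat fls"
    let ?fr = "filter (\<lambda>x. row ! x = Some 0) [0..<?L]"
    have AL: "?A \<subseteq> {..<?L}" by (auto simp: free_cols_def)
    have AS: "?A \<noteq> S" using Cons.prems(4,5) by auto
    have fr: "distinct ?fr" "set ?fr = ?A" by (auto simp: free_cols_def)
    have "wsum (pair_step fls_X 1 c r (j # js) row) ?f =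
      (\<Sum>i\<leftarrow>?fr. ?wt i * wsum (pair_step fls_X 1 c r js (row[i := Some c])) ?f)"
      using False by (simp only: pair_step.simps Let_def if_False wsum_concat map_map comp_def wsum_scale pair_wt_1)
    also have "\<dots> = (\<Sum>i\<in>?A. ?wt i * wsum (pair_step fls_X 1 c r js (row[i := Some c])) ?f)"
      by (simp only: sum_list_distinct_conv_sum_set[OF fr(1)] fr(2))
    also have "\<dots> = (\<Sum>i\<in>S. ?wt i * fps_to_fls (pair_tr (set js) (?A - {i}) (S - {i}) ?L))"
    proof (rule sum.mono_neutral_cong_right)
      show "\<forall>i\<in>?A - S. ?wt i * wsum (pair_step fls_X 1 c r js (row[i := Some c])) ?f = 0"
      proof
        fix i assume "i \<in> ?A - S"
        then show "?wt i * wsum (pair_step fls_X 1 c r js (row[i := Some c])) ?f = 0"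
          by (simp only: out mult_zero_right)
      qed
      show "?wt i * wsum (pair_step fls_X 1 c r js (row[i := Some c])) ?f
        = ?wt i * fps_to_fls (pair_tr (set js) (?A - {i}) (S - {i}) ?L)" if "i \<in> S" for i
        by (simp only: IH[OF that])
    qed (rule finite_free_cols Cons.prems(3))+
    also have "\<dots> = fps_to_fls (\<Sum>i\<in>S. (1 - fps_X) * fps_X ^ card {x \<in> ?A. cyc_between ?L i j x} * pair_tr (set js) (?A - {i}) (S - {i}) ?L) / (1 - fls_X ^ card ?A)"
      by (simp only: fps_to_fls_sum sum_divide_distrib fls_times_fps_to_fls fps_to_fls_minus fps_to_fls_power
          fps_X_to_fls fps_one_to_fls times_divide_eq_left)
    also have "\<dots> = fps_to_fls ((1 - fps_X ^ card ?A) * pair_tr (insert j (set js)) ?A S ?L) / (1 - fls_X ^ card ?A)"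
      by (simp only: pair_tr_choose[OF j(1) jA j(2) Cons.prems(3) AL AS])
    also have "\<dots> = fps_to_fls (pair_tr (insert j (set js)) ?A S ?L)"
    proof -
      have "(1 - fls_X ^ card ?A :: rat fls) = fps_to_fls (1 - fps_X ^ card ?A)"
        by (simp only: fps_to_fls_power fps_to_fls_minus fps_X_to_fls fps_one_to_fls)
      moreover have "fps_to_fls (1 - fps_X ^ card ?A :: rat fps) \<noteq> 0"
        using fps_X_power_neq_1[of "card ?A"] Cons.prems by (subst fps_to_fls_eq_0_iff) auto
      ultimately show ?thesis
        by (simp only: fls_times_fps_to_fls nonzero_mult_div_cancel_left not_False_eq_True)
    qed
    finally show ?thesis by (simp only: list.set)
  qed
qed

section \<open>Round-by-round evaluation of a multiline queue\<close>

definition cols :: "'b list \<Rightarrow> 'b \<Rightarrow> nat set" where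
  "cols xs y = {x. x < length xs \<and> xs ! x = y}"

lemma finite_cols [simp]: "finite (cols xs y)"
  by (simp add: cols_def)

lemma count_list_cols: "count_list xs y = card (cols xs y)"
  by (simp add: count_list_eq_length_filter length_filter_conv_card cols_def eq_commute)

lemma color_cols:
  "distinct (color_cols c row)" "set (color_cols c row) = cols row (Some c)"
  by (auto simp: color_cols_def cols_def)

lemma length_color_cols: "length (color_cols c row) = card (cols row (Some c))"
  using distinct_card[OF color_cols(1)] by (simp add: color_cols(2))

lemma cols_paint:
  assumes "S \<subseteq> free_cols row" "c \<noteq> 0"
  shows "cols (paint S c row) (Some c) = cols row (Some c) \<union> S"
    "S \<inter> cols row (Some c) = {}"
    "d \<noteq> 0 \<Longrightarrow> d \<noteq> c \<Longrightarrow> cols (paint S c row) (Some d) = cols row (Some d)"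
    "cols (paint S c row) None = cols row None"
  using assms by (auto simp: cols_def nth_paint free_cols_def split: if_splits)

lemma bind_outcome:
  fixes l :: "('w::times \<times> 'b) list" and k :: "'b \<Rightarrow> ('w \<times> 'c) list"
  shows "y \<in> snd ` set (concat (map (\<lambda>(w, x). map (\<lambda>(w', y). (w * w', y)) (k x)) l)) \<longleftrightarrow>
     (\<exists>w x. (w, x) \<in> set l \<and> y \<in> snd ` set (k x))"
proof -
  have *: "snd ` set (map (\<lambda>(w', y). (w * w', y)) l') = snd ` set l'" for w :: 'w and l' :: "('w \<times> 'c) list"
    by (simp add: image_image case_prod_unfold)
  show ?thesis
  proof (induction l)
    case (Cons p l)
    obtain w x where p: "p = (w, x)" by (cases p)
    have "y \<in> snd ` set (concat (map (\<lambda>(w, x). map (\<lambda>(w', y). (w * w', y)) (k x)) (p # l))) \<longleftrightarrow>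
      y \<in> snd ` set (map (\<lambda>(w', y). (w * w', y)) (k x)) \<or>
      y \<in> snd ` set (concat (map (\<lambda>(w, x). map (\<lambda>(w', y). (w * w', y)) (k x)) l))"
      by (simp only: p list.map concat.simps set_append image_Un Un_iff prod.case)
    also have "\<dots> \<longleftrightarrow> y \<in> snd ` set (k x) \<or> (\<exists>w x. (w, x) \<in> set l \<and> y \<in> snd ` set (k x))"
      unfolding * Cons.IH ..
    also have "\<dots> \<longleftrightarrow> (\<exists>w x. (w, x) \<in> set (p # l) \<and> y \<in> snd ` set (k x))"
      unfolding p by auto
    finally show ?case .
  qed simp
qed

text \<open>The number of balls of colour c is handed on unchanged from row to row, because each
  ball to be paired claims one new box.\<close>

lemma sub_rounds_outcome:
  assumes "G' \<in> snd ` set (sub_rounds t q c k G)" "c \<noteq> 0"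
    "\<And>r. r \<in> {1..k} \<Longrightarrow> length (G r) = L"
    "\<And>r. r \<in> {1..<k} \<Longrightarrow> cols (G r) (Some c) = {}"
  shows "(\<forall>r. r \<notin> {1..<k} \<longrightarrow> G' r = G r) \<and>
    (\<forall>r\<in>{1..<k}. \<exists>S\<subseteq>free_cols (G r). card S = card (cols (G k) (Some c)) \<and> G' r = paint S c (G r))"
  using assms
proof (induction t q c k G rule: sub_rounds.induct)
  case (3 t q c k G)
  let ?k = "Suc (Suc k)"
  from "3.prems"(1) obtain w \<rho> where
    \<rho>: "(w, \<rho>) \<in> set (pair_step t q c ?k (color_cols c (G ?k)) (G (Suc k)))"
    and G': "G' \<in> snd ` set (sub_rounds t q c (Suc k) (G(Suc k := \<rho>)))"
    unfolding sub_rounds.simps bind_outcome by blast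
  have len: "length (G ?k) = L" "length (G (Suc k)) = L" using "3.prems"(3) by auto
  have p1: "\<rho> \<in> snd ` set (pair_step t q c ?k (color_cols c (G ?k)) (G (Suc k)))"
    using \<rho> by (rule image_eqI[rotated]) simp
  have p2: "set (color_cols c (G ?k)) \<subseteq> {..<length (G (Suc k))}"
    unfolding color_cols len cols_def by auto
  obtain S where S: "S \<subseteq> free_cols (G (Suc k))" "card S = card (cols (G ?k) (Some c))" "\<rho> = paint S c (G (Suc k))"
    using pair_step_outcome[OF p1 "3.prems"(2) p2] unfolding length_color_cols by (elim exE conjE) rule
  have "cols (G (Suc k)) (Some c) = {}" using "3.prems"(4) by simp
  then have cS: "cols \<rho> (Some c) = S" using cols_paint(1)[OF S(1) "3.prems"(2)] S(3) by simp
  have "(\<forall>r. r \<notin> {1..<Suc k} \<longrightarrow> G' r = (G(Suc k := \<rho>)) r) \<and>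
    (\<forall>r\<in>{1..<Suc k}. \<exists>S\<subseteq>free_cols ((G(Suc k := \<rho>)) r).
      card S = card (cols ((G(Suc k := \<rho>)) (Suc k)) (Some c)) \<and> G' r = paint S c ((G(Suc k := \<rho>)) r))"
  proof (rule "3.IH")
    show "(w, \<rho>) \<in> set (pair_step t q c ?k (color_cols c (G ?k)) (G (Suc k)))" by (rule \<rho>)
    show "(w, \<rho>) = (w, \<rho>)" ..
    show "G' \<in> snd ` set (sub_rounds t q c (Suc k) (G(Suc k := \<rho>)))" by (rule G')
    show "c \<noteq> 0" by (rule "3.prems"(2))
    show "length ((G(Suc k := \<rho>)) r) = L" if "r \<in> {1..Suc k}" for r
    proof (cases "r = Suc k")
      case True
      then show ?thesis using len(2) S(3) by simp
    next
      case False
      then show ?thesis using "3.prems"(3)[of r] that by simp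
    qed
    show "cols ((G(Suc k := \<rho>)) r) (Some c) = {}" if "r \<in> {1..<Suc k}" for r
      using that "3.prems"(4)[of r] by simp
  qed
  note o = this
  have a: "G' r = (G(Suc k := \<rho>)) r" if "r \<notin> {1..<Suc k}" for r
    using conjunct1[OF o] that by (simp only: simp_thms)
  have b: "\<exists>S\<subseteq>free_cols ((G(Suc k := \<rho>)) r). card S = card (cols ((G(Suc k := \<rho>)) (Suc k)) (Some c)) \<and>
       G' r = paint S c ((G(Suc k := \<rho>)) r)" if "r \<in> {1..<Suc k}" for r
    by (rule bspec[OF conjunct2[OF o] that])
  show ?case
  proof (intro conjI allI ballI impI)
    fix r assume "r \<notin> {1..<?k}"
    then have "r \<notin> {1..<Suc k}" "r \<noteq> Suc k" by auto
    then show "G' r = G r" using a[of r] by simp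
  next
    fix r assume r: "r \<in> {1..<?k}"
    show "\<exists>S\<subseteq>free_cols (G r). card S = card (cols (G ?k) (Some c)) \<and> G' r = paint S c (G r)"
    proof (cases "r = Suc k")
      case True
      have "G' r = \<rho>" using a[of "Suc k"] True by simp
      then show ?thesis using S True by blast
    next
      case False
      then have r': "r \<in> {1..<Suc k}" using r by auto
      then have "(G(Suc k := \<rho>)) r = G r" "cols ((G(Suc k := \<rho>)) (Suc k)) (Some c) = S" using cS by simp_all
      then show ?thesis using b[OF r'] S(2) by simp
    qed
  qed
next
  case (1 t q c G)
  then have "G' = G" by simp
  then show ?case by simp
next
  case (2 t q c G)
  then have "G' = G" by simp
  then show ?case by simp
qed

text \<open>The balls to be paired are read off from the target H instead of the current grid. On a
  branch that ends in H this is the same, since later steps of the round touch only rows of smaller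
  index. It decouples the pairs of adjacent rows, so the weight becomes a product.\<close>

lemma sub_rounds_weight:
  "wsum (sub_rounds t q c k G) (\<lambda>G'. of_bool (G' = H)) =
    of_bool (\<forall>r. r \<notin> {1..<k} \<longrightarrow> G r = H r) *
    (\<Prod>r=2..k. wsum (pair_step t q c r (color_cols c (H r)) (G (r - 1))) (\<lambda>\<rho>. of_bool (\<rho> = H (r - 1))))"
proof (induction t q c k G rule: sub_rounds.induct)
  case (1 t q c G)
  then show ?case by (auto simp: fun_eq_iff)
next
  case (2 t q c G)
  then show ?case by (auto simp: fun_eq_iff)
next
  case (3 t q c k G)
  let ?k = "Suc (Suc k)"
  let ?l = "pair_step t q c ?k (color_cols c (G ?k)) (G (Suc k))"
  let ?p = "\<lambda>G r. wsum (pair_step t q c r (color_cols c (H r)) (G (r - 1))) (\<lambda>\<rho>. of_bool (\<rho> = H (r - 1)))"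
  have eq: "wsum (sub_rounds t q c (Suc k) (G(Suc k := \<rho>))) (\<lambda>G'. of_bool (G' = H)) =
      of_bool (\<rho> = H (Suc k)) * (of_bool (\<forall>r. r \<notin> {1..<?k} \<longrightarrow> G r = H r) * (\<Prod>r=2..Suc k. ?p G r))"
    if "\<rho> \<in> snd ` set ?l" for \<rho>
  proof -
    from that obtain w where w: "(w, \<rho>) \<in> set ?l" by force
    have "(\<Prod>r=2..Suc k. ?p (G(Suc k := \<rho>)) r) = (\<Prod>r=2..Suc k. ?p G r)"
      by (intro prod.cong) auto
    moreover have "(\<forall>r. r \<notin> {1..<Suc k} \<longrightarrow> (G(Suc k := \<rho>)) r = H r) \<longleftrightarrow>
      \<rho> = H (Suc k) \<and> (\<forall>r. r \<notin> {1..<?k} \<longrightarrow> G r = H r)"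
    proof (intro iffI conjI allI impI)
      assume h: "\<forall>r. r \<notin> {1..<Suc k} \<longrightarrow> (G(Suc k := \<rho>)) r = H r"
      have "(G(Suc k := \<rho>)) (Suc k) = H (Suc k)" using h[rule_format, of "Suc k"] by simp
      then show "\<rho> = H (Suc k)" by simp
      fix r assume "r \<notin> {1..<?k}"
      then show "G r = H r" using h[rule_format, of r] by auto
    next
      fix r assume h: "\<rho> = H (Suc k) \<and> (\<forall>r. r \<notin> {1..<?k} \<longrightarrow> G r = H r)" and r: "r \<notin> {1..<Suc k}"
      show "(G(Suc k := \<rho>)) r = H r"
      proof (cases "r = Suc k")
        case False
        then have "r \<notin> {1..<?k}" using r by auto
        then show ?thesis using h False by simp
      qed (use h in simp)
    qed
    ultimately show ?thesis using "3.IH"[OF w refl] by (simp only: of_bool_conj mult.assoc)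
  qed
  have "wsum (sub_rounds t q c ?k G) (\<lambda>G'. of_bool (G' = H)) =
    wsum ?l (\<lambda>\<rho>. wsum (sub_rounds t q c (Suc k) (G(Suc k := \<rho>))) (\<lambda>G'. of_bool (G' = H)))"
    by (simp only: sub_rounds.simps wsum_bind)
  also have "\<dots> = wsum ?l (\<lambda>\<rho>. of_bool (\<rho> = H (Suc k)) * (of_bool (\<forall>r. r \<notin> {1..<?k} \<longrightarrow> G r = H r) * (\<Prod>r=2..Suc k. ?p G r)))"
    by (rule wsum_cong) (rule eq)
  also have "\<dots> = wsum ?l (\<lambda>\<rho>. of_bool (\<rho> = H (Suc k))) * (of_bool (\<forall>r. r \<notin> {1..<?k} \<longrightarrow> G r = H r) * (\<Prod>r=2..Suc k. ?p G r))"
    by (rule wsum_mult_right)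
  also have "\<dots> = of_bool (\<forall>r. r \<notin> {1..<?k} \<longrightarrow> G r = H r) * (\<Prod>r=2..?k. ?p G r)"
  proof (cases "\<forall>r. r \<notin> {1..<?k} \<longrightarrow> G r = H r")
    case True
    then have "G ?k = H ?k" by simp
    then show ?thesis using True by (simp add: prod.atLeast_Suc_atMost mult.commute prod.nat_ivl_Suc')
  next
    case False
    then show ?thesis by (simp only: of_bool_eq mult_zero_left mult_zero_right if_False)
  qed
  finally show ?case .
qed

section \<open>Invariants of rows and grids between rounds\<close>

definition uncolor :: "nat \<Rightarrow> mrow \<Rightarrow> mrow" where
  "uncolor c row = map (map_option (\<lambda>x. if x < c then 0 else x)) row"

text \<open>Colours are assigned in decreasing order, so turning all colours below a back into free
  balls rewinds the queue to the stage where only colours from a upwards were present. Rewinding may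
  be done in several steps.\<close>

lemma uncolor_uncolor: "b \<le> a \<Longrightarrow> uncolor a (uncolor b row) = uncolor a row"
  unfolding uncolor_def map_map
  by (rule map_cong[OF refl]) (auto simp: option.map_comp intro!: option.map_cong0)

text \<open>Row \<open>r\<close> at the moment when exactly the colours above \<open>k\<close> have been assigned;
  \<open>\<mu> c\<close> is the number of particles of colour \<open>c\<close>.\<close>
definition row_ok :: "nat \<Rightarrow> nat \<Rightarrow> (nat \<Rightarrow> nat) \<Rightarrow> nat \<Rightarrow> nat \<Rightarrow> mrow \<Rightarrow> bool" where
  "row_ok n L \<mu> k r row \<longleftrightarrow> length row = L \<and>
     (\<forall>c>0. card (cols row (Some c)) = (if k < c \<and> c \<le> n then \<mu> c else 0)) \<and>
     card {x. x < L \<and> row ! x \<noteq> None} = (\<Sum>i=r..n. \<mu> i)"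

lemma row_ok_color:
  assumes "row_ok n L \<mu> k r row" "x < L" "row ! x = Some c" "c > 0"
  shows "k < c \<and> c \<le> n"
proof (rule ccontr)
  assume "\<not> (k < c \<and> c \<le> n)"
  then have "card (cols row (Some c)) = 0" using assms(1,4) by (auto simp: row_ok_def)
  then have "cols row (Some c) = {}" by simp
  then show False using assms by (auto simp: cols_def row_ok_def)
qed

text \<open>The balls of a row split into the free ones and the colour classes above k. Two cases
  are used repeatedly: for k = r there are \<mu> r free balls, and for k = r - 1 there are
  none.\<close>

lemma row_ok_free:
  assumes "row_ok n L \<mu> k r row" "k \<le> n"
  shows "card (free_cols row) = (\<Sum>i=r..n. \<mu> i) - (\<Sum>i=Suc k..n. \<mu> i)"
proof -
  have len: "length row = L" using assms(1) by (simp add: row_ok_def)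
  have eq: "{x. x < L \<and> row ! x \<noteq> None} = free_cols row \<union> (\<Union>c\<in>{Suc k..n}. cols row (Some c))"
  proof (rule set_eqI)
    fix x
    show "x \<in> {x. x < L \<and> row ! x \<noteq> None} \<longleftrightarrow> x \<in> free_cols row \<union> (\<Union>c\<in>{Suc k..n}. cols row (Some c))"
    proof (cases "row ! x")
      case None
      then show ?thesis by (auto simp: free_cols_def cols_def)
    next
      case (Some c)
      then show ?thesis using row_ok_color[OF assms(1), of x c] len
        by (cases "c = 0") (auto simp: free_cols_def cols_def)
    qed
  qed
  have "(\<Sum>i=r..n. \<mu> i) = card (free_cols row \<union> (\<Union>c\<in>{Suc k..n}. cols row (Some c)))"
    unfolding eq[symmetric] using assms(1) by (simp add: row_ok_def)
  also have "\<dots> = card (free_cols row) + card (\<Union>c\<in>{Suc k..n}. cols row (Some c))"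
    by (rule card_Un_disjoint) (auto simp: free_cols_def cols_def)
  also have "card (\<Union>c\<in>{Suc k..n}. cols row (Some c)) = (\<Sum>c=Suc k..n. card (cols row (Some c)))"
    by (rule card_UN_disjoint) (auto simp: cols_def)
  also have "\<dots> = (\<Sum>c=Suc k..n. \<mu> c)"
    using assms(1) by (intro sum.cong) (auto simp: row_ok_def)
  finally show ?thesis by simp
qed

lemma row_ok_uncolor:
  assumes "row_ok n L \<mu> k r row" shows "uncolor (Suc k) row = row"
proof (rule nth_equalityI)
  fix x assume x: "x < length (uncolor (Suc k) row)"
  then have "x < L" "x < length row" using assms by (auto simp: uncolor_def row_ok_def)
  then show "uncolor (Suc k) row ! x = row ! x"
    using row_ok_color[OF assms, of x "the (row ! x)"]
    by (cases "row ! x"; cases "the (row ! x) = 0") (auto simp: uncolor_def)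
qed (simp add: uncolor_def)

lemma row_ok_paint:
  assumes ok: "row_ok n L \<mu> k r row" and S: "S \<subseteq> free_cols row" "card S = \<mu> k" and k: "0 < k" "k \<le> n"
  shows "row_ok n L \<mu> (k - 1) r (paint S k row)" "uncolor (Suc k) (paint S k row) = row"
proof -
  have len: "length row = L" using ok by (simp add: row_ok_def)
  have k0: "k \<noteq> 0" using k by simp
  have 1: "card (cols row (Some c)) = (if k < c \<and> c \<le> n then \<mu> c else 0)" if "c > 0" for c
    using ok that by (simp add: row_ok_def)
  from 1[of k] k have "cols row (Some k) = {}" by auto
  then have ck: "cols (paint S k row) (Some k) = S" using cols_paint(1)[OF S(1) k0] by simp
  have "card (cols (paint S k row) (Some c)) = (if k - 1 < c \<and> c \<le> n then \<mu> c else 0)" if c: "c > 0" for c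
  proof (cases "c = k")
    case True
    then show ?thesis using ck S(2) k by simp
  next
    case False
    moreover from False k have "(k - 1 < c) = (k < c)" by auto
    ultimately show ?thesis using cols_paint(3)[OF S(1) k0, of c] 1[OF c] c by simp
  qed
  moreover have "{x. x < L \<and> paint S k row ! x \<noteq> None} = {x. x < L \<and> row ! x \<noteq> None}"
    using S(1) len by (auto simp: nth_paint free_cols_def split: if_splits)
  ultimately show "row_ok n L \<mu> (k - 1) r (paint S k row)"
    using ok by (simp add: row_ok_def)
  show "uncolor (Suc k) (paint S k row) = row"
  proof (rule nth_equalityI)
    fix x assume x: "x < length (uncolor (Suc k) (paint S k row))"
    then have x: "x < L" "x < length row" using len by (auto simp: uncolor_def)
    have "uncolor (Suc k) row ! x = row ! x" using row_ok_uncolor[OF ok] by simp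
    then show "uncolor (Suc k) (paint S k row) ! x = row ! x"
      using x S(1) k by (cases "x \<in> S") (auto simp: uncolor_def nth_paint free_cols_def)
  qed (simp add: uncolor_def)
qed

text \<open>Row r holds as many balls as there are particles of the colours r, ..., n, so no free
  ball is left there once these colours are assigned. Its stage therefore stops at r - 1, whence the
  maximum.\<close>

definition grid_ok :: "nat \<Rightarrow> nat \<Rightarrow> (nat \<Rightarrow> nat) \<Rightarrow> nat \<Rightarrow> (nat \<Rightarrow> mrow) \<Rightarrow> bool" where
  "grid_ok n L \<mu> k G \<longleftrightarrow> (\<forall>r\<in>{1..n}. row_ok n L \<mu> (max k (r - 1)) r (G r)) \<and> (\<forall>r. r \<notin> {1..n} \<longrightarrow> G r = [])"

lemma recolor_paint:
  "map (\<lambda>x. if x = Some 0 then Some c else x) row = paint (free_cols row) c row"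
  by (rule nth_equalityI) (auto simp: nth_paint free_cols_def)

text \<open>At the start of round k Row k has exactly \<mu> k free balls, so Rows 1 to k each gain
  \<mu> k balls of colour k and the remaining rows do not change. The second conclusion recovers the
  earlier grid from the later one.\<close>

lemma round_outcome:
  assumes ok: "grid_ok n L \<mu> k G" and k: "2 \<le> k" "k \<le> n"
    and G': "G' \<in> snd ` set (sub_rounds t q k k (G(k := map (\<lambda>x. if x = Some 0 then Some k else x) (G k))))"
  shows "grid_ok n L \<mu> (k - 1) G' \<and> (\<forall>r. G r = uncolor (max (Suc k) r) (G' r))"
proof -
  let ?G = "G(k := paint (free_cols (G k)) k (G k))"
  have k0: "k \<noteq> 0" using k by simp
  have row: "row_ok n L \<mu> (max k (r - 1)) r (G r)" if "r \<in> {1..n}" for r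
    using ok that by (simp add: grid_ok_def)
  have len: "length (?G r) = L" if "r \<in> {1..k}" for r
    using row[of r] that k by (auto simp: row_ok_def)
  have nok: "cols (G r) (Some k) = {}" if "r \<in> {1..k}" for r
  proof -
    have "max k (r - 1) = k" using that by auto
    then have "card (cols (G r) (Some k)) = 0" using row[of r] that k by (auto simp: row_ok_def)
    then show ?thesis by simp
  qed
  have "max k (k - 1) = k" by simp
  then have "row_ok n L \<mu> k k (G k)" using row[of k] k by simp
  from row_ok_free[OF this k(2)] k(2) have fk: "card (free_cols (G k)) = \<mu> k"
    by (simp add: sum.atLeast_Suc_atMost)
  have ck: "cols (?G k) (Some k) = free_cols (G k)"
    using cols_paint(1)[OF subset_refl k0] nok[of k] k by simp
  have o: "(\<forall>r. r \<notin> {1..<k} \<longrightarrow> G' r = ?G r) \<and>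
    (\<forall>r\<in>{1..<k}. \<exists>S\<subseteq>free_cols (?G r). card S = card (cols (?G k) (Some k)) \<and> G' r = paint S k (?G r))"
  proof (rule sub_rounds_outcome)
    show "G' \<in> snd ` set (sub_rounds t q k k ?G)" using G' by (simp only: recolor_paint)
    show "cols (?G r) (Some k) = {}" if "r \<in> {1..<k}" for r using that nok[of r] by auto
  qed (use len k0 in auto)
  have low: "\<exists>S\<subseteq>free_cols (G r). card S = \<mu> k \<and> G' r = paint S k (G r)" if r: "r \<in> {1..k}" for r
  proof (cases "r = k")
    case True
    then show ?thesis using o fk by (intro exI[of _ "free_cols (G k)"]) auto
  next
    case False
    then have "\<exists>S\<subseteq>free_cols (?G r). card S = card (cols (?G k) (Some k)) \<and> G' r = paint S k (?G r)"
      using o r by auto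
    then show ?thesis unfolding ck fk using False by auto
  qed
  have high: "G' r = G r" if "r \<notin> {1..k}" for r using o that k by auto
  have main: "row_ok n L \<mu> (max (k - 1) (r - 1)) r (G' r) \<and> G r = uncolor (max (Suc k) r) (G' r)" if r: "r \<in> {1..n}" for r
  proof (cases "r \<le> k")
    case True
    then obtain S where S: "S \<subseteq> free_cols (G r)" "card S = \<mu> k" "G' r = paint S k (G r)"
      using low[of r] r by auto
    have "max k (r - 1) = k" using True by simp
    then have "row_ok n L \<mu> k r (G r)" using row[OF r] by simp
    moreover have "max (k - 1) (r - 1) = k - 1" "max (Suc k) r = Suc k" using True by auto
    ultimately show ?thesis using row_ok_paint[of n L \<mu> k r "G r" S] S k by simp
  next
    case False
    then have "max (k - 1) (r - 1) = r - 1" "max k (r - 1) = r - 1" "max (Suc k) r = Suc (r - 1)" by auto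
    moreover have "G' r = G r" using high False by auto
    ultimately show ?thesis using row[OF r] row_ok_uncolor[of n L \<mu> "r - 1" r "G r"] by simp
  qed
  have out: "G' r = []" "G r = []" if "r \<notin> {1..n}" for r
    using high[of r] that k ok by (auto simp: grid_ok_def)
  show ?thesis
  proof (intro conjI allI)
    show "grid_ok n L \<mu> (k - 1) G'" using main out by (simp add: grid_ok_def)
    fix r show "G r = uncolor (max (Suc k) r) (G' r)"
      using main[of r] out[of r] by (cases "r \<in> {1..n}") (auto simp: uncolor_def)
  qed
qed

text \<open>Rewinding composes over the rounds, so the final grid determines the grid at every
  earlier stage. This is what permits grouping the weights by final grid.\<close>

lemma rounds_outcome:
  assumes "H \<in> snd ` set (rounds t q k G)" "grid_ok n L \<mu> k G" "1 \<le> k" "k \<le> n"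
  shows "grid_ok n L \<mu> 1 H \<and> (\<forall>r. G r = uncolor (max (Suc k) r) (H r))"
  using assms
proof (induction t q k G rule: rounds.induct)
  case (2 t q G)
  then have H: "H = G" by simp
  have "G r = uncolor (max (Suc (Suc 0)) r) (G r)" for r
  proof (cases "r \<in> {1..n}")
    case True
    then have "row_ok n L \<mu> (max 1 (r - 1)) r (G r)" using 2 by (simp add: grid_ok_def)
    from row_ok_uncolor[OF this] True show ?thesis by (cases r) (auto simp: max_Suc_Suc)
  next
    case False
    then have "G r = []" using 2 by (auto simp: grid_ok_def)
    then show ?thesis by (simp add: uncolor_def)
  qed
  then show ?case using 2 H by simp
next
  case (3 t q k G)
  let ?c = "Suc (Suc k)"
  let ?G1 = "G(?c := map (\<lambda>x. if x = Some 0 then Some ?c else x) (G ?c))"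
  from "3.prems"(1) obtain w G' where w: "(w, G') \<in> set (sub_rounds t q ?c ?c ?G1)"
    and H: "H \<in> snd ` set (rounds t q (Suc k) G')"
    unfolding rounds.simps Let_def bind_outcome by blast
  have "G' \<in> snd ` set (sub_rounds t q ?c ?c ?G1)" using w by (rule image_eqI[rotated]) simp
  from round_outcome[OF "3.prems"(2) _ "3.prems"(4) this]
  have 1: "grid_ok n L \<mu> (Suc k) G'" "\<And>r. G r = uncolor (max (Suc ?c) r) (G' r)" by simp_all
  have 2: "grid_ok n L \<mu> 1 H" "\<And>r. G' r = uncolor (max (Suc (Suc k)) r) (H r)"
    using "3.IH"[OF refl refl w refl H 1(1)] "3.prems"(4) by auto
  have "G r = uncolor (max (Suc ?c) r) (H r)" for r
    unfolding 1(2)[of r] 2(2)[of r] by (rule uncolor_uncolor) simp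
  with 2(1) show ?case by simp
qed simp

section \<open>Final grids as chains of configurations\<close>

definition configs :: "nat \<Rightarrow> nat \<Rightarrow> (nat \<Rightarrow> nat) \<Rightarrow> nat list set" where
  "configs n L \<mu> = {\<xi>. length \<xi> = L \<and> set \<xi> \<subseteq> {0..n} \<and> (\<forall>\<alpha>\<in>{1..n}. card (cols \<xi> \<alpha>) = \<mu> \<alpha>)}"

text \<open>The head is Row 1. From one row to the next the lowest positive species becomes vacant
  and the other labels drop by one, which shifts \<mu>. The number of zeros in a row is fixed by its
  length.\<close>

fun chains :: "nat \<Rightarrow> nat \<Rightarrow> (nat \<Rightarrow> nat) \<Rightarrow> nat list list set" where
  "chains 0 L \<mu> = {[]}"
| "chains (Suc n) L \<mu> = (\<lambda>(\<xi>, \<Xi>). \<xi> # \<Xi>) ` (configs (Suc n) L \<mu> \<times> chains n L (\<lambda>\<alpha>. \<mu> (Suc \<alpha>)))"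

lemma finite_configs: "finite (configs n L \<mu>)"
  by (rule finite_subset[OF _ finite_lists_length_eq[of "{0..n}" L]]) (auto simp: configs_def)

lemma finite_chains: "finite (chains n L \<mu>)"
  by (induction n arbitrary: \<mu>) (simp_all add: finite_configs)

lemma chains_iff:
  "\<Xi> \<in> chains n L \<mu> \<longleftrightarrow> length \<Xi> = n \<and> (\<forall>i<n. \<Xi> ! i \<in> configs (n - i) L (\<lambda>\<alpha>. \<mu> (\<alpha> + i)))"
proof (induction n arbitrary: \<mu> \<Xi>)
  case (Suc n)
  show ?case
  proof (cases \<Xi>)
    case Nil
    then show ?thesis by auto
  next
    case (Cons \<xi> \<Xi>')
    have "\<Xi> \<in> chains (Suc n) L \<mu> \<longleftrightarrow> \<xi> \<in> configs (Suc n) L \<mu> \<and> \<Xi>' \<in> chains n L (\<lambda>\<alpha>. \<mu> (Suc \<alpha>))"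
      unfolding Cons by auto
    also have "\<dots> \<longleftrightarrow> \<xi> \<in> configs (Suc n) L \<mu> \<and> length \<Xi>' = n \<and>
        (\<forall>i<n. \<Xi>' ! i \<in> configs (n - i) L (\<lambda>\<alpha>. \<mu> (Suc (\<alpha> + i))))"
      unfolding Suc.IH ..
    also have "\<dots> \<longleftrightarrow> length \<Xi> = Suc n \<and> (\<forall>i<Suc n. \<Xi> ! i \<in> configs (Suc n - i) L (\<lambda>\<alpha>. \<mu> (\<alpha> + i)))"
      unfolding Cons All_less_Suc2 by (simp add: conj_left_commute)
    finally show ?thesis .
  qed
qed simp

text \<open>In row \<open>r\<close> only the colours \<open>r, \<dots>, n\<close> and empty boxes occur, so the row is recorded by a
  configuration with entries in \<open>{0..n + 1 - r}\<close>: entry \<open>x > 0\<close> stands for colour \<open>x + r - 1\<close>.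
  Colours below \<open>c\<close> are not yet visible.\<close>
definition stage_row :: "nat \<Rightarrow> nat \<Rightarrow> nat list \<Rightarrow> mrow" where
  "stage_row c r \<xi> = map (\<lambda>x. if x = 0 then None else if c \<le> x + r - 1 then Some (x + r - 1) else Some 0) \<xi>"

definition stage_grid :: "nat \<Rightarrow> nat list list \<Rightarrow> nat \<Rightarrow> mrow" where
  "stage_grid c \<Xi> r = (if 1 \<le> r \<and> r \<le> length \<Xi> then stage_row (max c r) r (\<Xi> ! (r - 1)) else [])"

lemma length_stage_row [simp]: "length (stage_row c r \<xi>) = length \<xi>"
  by (simp add: stage_row_def)

lemma nth_stage_row: "x < length \<xi> \<Longrightarrow> stage_row c r \<xi> ! x =
   (if \<xi> ! x = 0 then None else if c \<le> \<xi> ! x + r - 1 then Some (\<xi> ! x + r - 1) else Some 0)"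
  by (simp add: stage_row_def)

lemma uncolor_stage_row: "b \<le> a \<Longrightarrow> 0 < a \<Longrightarrow> uncolor a (stage_row b r \<xi>) = stage_row a r \<xi>"
  unfolding uncolor_def stage_row_def map_map by (rule map_cong[OF refl]) auto

lemma uncolor_stage_grid: "2 \<le> c \<Longrightarrow> uncolor (max c r) (stage_grid 2 \<Xi> r) = stage_grid c \<Xi> r"
  by (cases "1 \<le> r \<and> r \<le> length \<Xi>") (auto simp: stage_grid_def uncolor_stage_row uncolor_def[of _ "[]"])

lemma recolor_stage_grid:
  assumes "1 \<le> c"
  shows "map (\<lambda>x. if x = Some 0 then Some c else x) (stage_grid (Suc c) \<Xi> c) = stage_grid c \<Xi> c"
proof (cases "c \<le> length \<Xi>")
  case True
  have "max (Suc c) c = Suc c" "max c c = c" by simp_all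
  then show ?thesis using True assms unfolding stage_grid_def stage_row_def map_map
    by (simp only: simp_thms if_True map_map) (rule map_cong[OF refl], auto)
qed (simp add: stage_grid_def)

lemma stage_grid_high: "r \<notin> {1..c} \<Longrightarrow> stage_grid (Suc c) \<Xi> r = stage_grid c \<Xi> r"
  by (cases r) (simp_all add: stage_grid_def max_def)

lemma row_ok_stage_row:
  assumes \<xi>: "\<xi> \<in> configs (Suc n - r) L (\<lambda>\<alpha>. \<mu> (\<alpha> + (r - 1)))" and r: "1 \<le> r" "r \<le> n" "r - 1 \<le> k"
  shows "row_ok n L \<mu> k r (stage_row (Suc k) r \<xi>)"
proof -
  have len: "length \<xi> = L" and le: "\<And>x. x < L \<Longrightarrow> \<xi> ! x \<le> Suc n - r"
    and cnt: "\<And>\<alpha>. \<alpha> \<in> {1..Suc n - r} \<Longrightarrow> card (cols \<xi> \<alpha>) = \<mu> (\<alpha> + (r - 1))"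
    using \<xi> nth_mem by (auto simp: configs_def subset_iff)
  have "card (cols (stage_row (Suc k) r \<xi>) (Some c)) = (if k < c \<and> c \<le> n then \<mu> c else 0)" if c: "c > 0" for c
  proof (cases "k < c")
    case True
    have "cols (stage_row (Suc k) r \<xi>) (Some c) = cols \<xi> (c + 1 - r)"
      unfolding cols_def length_stage_row
    proof (intro Collect_cong conj_cong refl)
      fix x assume "x < length \<xi>"
      then show "(stage_row (Suc k) r \<xi> ! x = Some c) = (\<xi> ! x = c + 1 - r)"
        using True r unfolding nth_stage_row[OF \<open>x < length \<xi>\<close>] by (cases "\<xi> ! x = 0") (simp, simp, linarith)
    qed
    moreover have "card (cols \<xi> (c + 1 - r)) = (if c \<le> n then \<mu> c else 0)"
    proof (cases "c \<le> n")
      case True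
      have "c + 1 - r \<in> {1..Suc n - r}" "c + 1 - r + (r - 1) = c" using True \<open>k < c\<close> r by auto
      then show ?thesis using cnt[of "c + 1 - r"] True by simp
    next
      case False
      then have "c + 1 - r > Suc n - r" using r by simp
      then have "\<xi> ! x \<noteq> c + 1 - r" if "x < L" for x using le[OF that] by linarith
      then have "cols \<xi> (c + 1 - r) = {}" using len by (simp add: cols_def)
      then show ?thesis using False by simp
    qed
    ultimately show ?thesis using True by simp
  next
    case False
    then have "cols (stage_row (Suc k) r \<xi>) (Some c) = {}" using c by (auto simp: cols_def nth_stage_row)
    then show ?thesis using False by simp
  qed
  moreover have "card {x. x < L \<and> stage_row (Suc k) r \<xi> ! x \<noteq> None} = (\<Sum>i=r..n. \<mu> i)"
  proof -
    have "{x. x < L \<and> stage_row (Suc k) r \<xi> ! x \<noteq> None} = (\<Union>\<alpha>\<in>{1..Suc n - r}. cols \<xi> \<alpha>)"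
    proof (rule set_eqI)
      fix x
      have "stage_row (Suc k) r \<xi> ! x \<noteq> None \<longleftrightarrow> \<xi> ! x \<in> {1..Suc n - r}" if "x < L"
        using le[OF that] that len by (simp add: nth_stage_row)
      then show "x \<in> {x. x < L \<and> stage_row (Suc k) r \<xi> ! x \<noteq> None} \<longleftrightarrow> x \<in> (\<Union>\<alpha>\<in>{1..Suc n - r}. cols \<xi> \<alpha>)"
        using len by (auto simp: cols_def)
    qed
    also have "card \<dots> = (\<Sum>\<alpha>\<in>{1..Suc n - r}. card (cols \<xi> \<alpha>))"
      by (rule card_UN_disjoint) (auto simp: cols_def)
    also have "\<dots> = (\<Sum>\<alpha>\<in>{1..Suc n - r}. \<mu> (\<alpha> + (r - 1)))" using cnt by (rule sum.cong[OF refl])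
    also have "\<dots> = (\<Sum>i=r..n. \<mu> i)"
      by (rule sum.reindex_bij_witness[of _ "\<lambda>i. i - (r - 1)" "\<lambda>\<alpha>. \<alpha> + (r - 1)"]) (use r in auto)
    finally show ?thesis .
  qed
  ultimately show ?thesis using len by (simp add: row_ok_def)
qed

lemma row_ok_stage_row_exists:
  assumes ok: "row_ok n L \<mu> (max 1 (r - 1)) r row" and r: "1 \<le> r" "r \<le> n"
  shows "\<exists>\<xi>\<in>configs (Suc n - r) L (\<lambda>\<alpha>. \<mu> (\<alpha> + (r - 1))). row = stage_row (max 2 r) r \<xi>"
proof -
  \<comment> \<open>Inverse of the encoding by \<open>stage_row\<close>. After the last round a free
    ball can occur only in Row 1, where it stands for colour 1, hence the value 1.\<close>
  define f where "f y = (case y of None \<Rightarrow> 0 | Some c \<Rightarrow> if c = 0 then 1 else c + 1 - r)" for y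
  define \<xi> where "\<xi> = map f row"
  have len: "length row = L" "length \<xi> = L" using ok by (auto simp: row_ok_def \<xi>_def)
  have col: "max 2 r \<le> c \<and> c \<le> n" if "x < L" "row ! x = Some c" "c \<noteq> 0" for x c
    using row_ok_color[OF ok that(1,2)] that(3) by auto
  have free: "row ! x \<noteq> Some 0" if "r \<noteq> 1" "x < L" for x
  proof -
    have "max 1 (r - 1) = r - 1" "max 1 (r - 1) \<le> n" "Suc (r - 1) = r" using r that by auto
    then have "card (free_cols row) = 0" using row_ok_free[OF ok] by simp
    then have "free_cols row = {}" by simp
    then show ?thesis using that len by (auto simp: free_cols_def)
  qed
  have nth: "\<xi> ! x = f (row ! x)" if "x < L" for x using that len by (simp add: \<xi>_def)
  have stage_row: "stage_row (max 2 r) r \<xi> ! x = row ! x" if x: "x < L" for x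
  proof (cases "row ! x")
    case None
    then show ?thesis using x len nth by (simp add: nth_stage_row f_def)
  next
    case (Some c)
    show ?thesis
    proof (cases "c = 0")
      case True
      then have "r = 1" using free x Some by auto
      then show ?thesis using x len nth Some True by (simp add: nth_stage_row f_def)
    next
      case False
      then have "max 2 r \<le> c" using col x Some by auto
      then show ?thesis using x len nth Some False by (simp add: nth_stage_row f_def)
    qed
  qed
  then have row: "row = stage_row (max 2 r) r \<xi>" using len by (intro nth_equalityI) auto
  have "\<xi> ! x \<le> Suc n - r" if x: "x < L" for x
    using col[OF x] nth[OF x] r by (cases "row ! x") (auto simp: f_def)
  then have sub: "set \<xi> \<subseteq> {0..Suc n - r}" using len by (auto simp: in_set_conv_nth)
  have "card (cols \<xi> \<alpha>) = \<mu> (\<alpha> + (r - 1))" if \<alpha>: "\<alpha> \<in> {1..Suc n - r}" for \<alpha>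
  proof (cases "r = 1 \<and> \<alpha> = 1")
    case True
    have "(\<xi> ! x = 1) = (row ! x = Some 0)" if x: "x < L" for x
      using col[OF x] nth[OF x] True by (cases "row ! x") (auto simp: f_def)
    then have "cols \<xi> \<alpha> = free_cols row" using True len by (auto simp: cols_def free_cols_def)
    moreover have "card (free_cols row) = \<mu> 1"
      using row_ok_free[OF ok] True r by (simp add: sum.atLeast_Suc_atMost)
    ultimately show ?thesis using True by simp
  next
    case False
    have "(\<xi> ! x = \<alpha>) = (row ! x = Some (\<alpha> + (r - 1)))" if x: "x < L" for x
      using col[OF x] nth[OF x] free[of x] False r \<alpha> x by (cases "row ! x") (auto simp: f_def)
    then have "cols \<xi> \<alpha> = cols row (Some (\<alpha> + (r - 1)))" using len by (auto simp: cols_def)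
    moreover have "0 < \<alpha> + (r - 1)" "max 1 (r - 1) < \<alpha> + (r - 1) \<and> \<alpha> + (r - 1) \<le> n" using False \<alpha> r by auto
    ultimately show ?thesis using ok by (simp add: row_ok_def)
  qed
  then have "\<xi> \<in> configs (Suc n - r) L (\<lambda>\<alpha>. \<mu> (\<alpha> + (r - 1)))" using len sub by (simp add: configs_def)
  with row show ?thesis by blast
qed

lemma grid_ok_stage_grid:
  assumes "\<Xi> \<in> chains n L \<mu>" "1 \<le> k"
  shows "grid_ok n L \<mu> k (stage_grid (Suc k) \<Xi>)"
  unfolding grid_ok_def
proof (intro conjI ballI allI impI)
  fix r assume r: "r \<in> {1..n}"
  have "\<Xi> ! (r - 1) \<in> configs (n - (r - 1)) L (\<lambda>\<alpha>. \<mu> (\<alpha> + (r - 1)))" "length \<Xi> = n"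
    using assms(1)[unfolded chains_iff] r by (auto dest!: spec[of _ "r - 1"])
  moreover have "n - (r - 1) = Suc n - r" "max (Suc k) r = Suc (max k (r - 1))" using r by auto
  ultimately show "row_ok n L \<mu> (max k (r - 1)) r (stage_grid (Suc k) \<Xi> r)"
    using row_ok_stage_row[of "\<Xi> ! (r - 1)" n r L \<mu> "max k (r - 1)"] r by (simp add: stage_grid_def)
next
  fix r assume "r \<notin> {1..n}"
  then show "stage_grid (Suc k) \<Xi> r = []" using assms(1) by (auto simp: stage_grid_def chains_iff)
qed

lemma grid_ok_exists:
  assumes "grid_ok n L \<mu> 1 H"
  shows "\<exists>\<Xi>\<in>chains n L \<mu>. H = stage_grid 2 \<Xi>"
proof -
  have "\<forall>r\<in>{1..n}. \<exists>\<xi>. \<xi> \<in> configs (Suc n - r) L (\<lambda>\<alpha>. \<mu> (\<alpha> + (r - 1))) \<and> H r = stage_row (max 2 r) r \<xi>"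
  proof
    fix r assume r: "r \<in> {1..n}"
    then have "row_ok n L \<mu> (max 1 (r - 1)) r (H r)" using assms by (simp add: grid_ok_def)
    from row_ok_stage_row_exists[OF this] r
    show "\<exists>\<xi>. \<xi> \<in> configs (Suc n - r) L (\<lambda>\<alpha>. \<mu> (\<alpha> + (r - 1))) \<and> H r = stage_row (max 2 r) r \<xi>" by auto
  qed
  from bchoice[OF this] obtain f where
    f: "\<And>r. r \<in> {1..n} \<Longrightarrow> f r \<in> configs (Suc n - r) L (\<lambda>\<alpha>. \<mu> (\<alpha> + (r - 1))) \<and> H r = stage_row (max 2 r) r (f r)"
    by blast
  define \<Xi> where "\<Xi> = map (\<lambda>i. f (Suc i)) [0..<n]"
  have "\<Xi> \<in> chains n L \<mu>" unfolding chains_iff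
  proof (intro conjI allI impI)
    fix i assume "i < n"
    then show "\<Xi> ! i \<in> configs (n - i) L (\<lambda>\<alpha>. \<mu> (\<alpha> + i))" using f[of "Suc i"] by (simp add: \<Xi>_def)
  qed (simp add: \<Xi>_def)
  moreover have "H r = stage_grid 2 \<Xi> r" for r
  proof (cases "r \<in> {1..n}")
    case True
    then obtain i where "r = Suc i" "i < n" by (cases r) auto
    then have "\<Xi> ! (r - 1) = f r" by (simp add: \<Xi>_def)
    then show ?thesis using True f[OF True] by (simp add: stage_grid_def \<Xi>_def)
  next
    case False
    then have "H r = []" using assms by (simp add: grid_ok_def)
    then show ?thesis using False by (auto simp: stage_grid_def \<Xi>_def)
  qed
  ultimately show ?thesis by blast
qed

text \<open>Together with \<open>grid_ok_exists\<close>, chains index the possible final grids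
  without repetition, so a sum over outcomes can be sorted by chain.\<close>

lemma stage_grid_inj:
  assumes "\<Xi> \<in> chains n L \<mu>" "\<Xi>' \<in> chains n L \<mu>" "stage_grid 2 \<Xi> = stage_grid 2 \<Xi>'"
  shows "\<Xi> = \<Xi>'"
proof (rule nth_equalityI)
  have len: "length \<Xi> = n" "length \<Xi>' = n" using assms unfolding chains_iff by auto
  then show "length \<Xi> = length \<Xi>'" by simp
  fix i assume i: "i < length \<Xi>"
  have "inj (\<lambda>x. if x = 0 then None else if max 2 (Suc i) \<le> x + Suc i - 1 then Some (x + Suc i - 1) else Some 0)"
    by (rule injI) (auto split: if_splits)
  moreover have "stage_row (max 2 (Suc i)) (Suc i) (\<Xi> ! i) = stage_row (max 2 (Suc i)) (Suc i) (\<Xi>' ! i)"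
    using fun_cong[OF assms(3), of "Suc i"] i len by (simp add: stage_grid_def)
  ultimately show "\<Xi> ! i = \<Xi>' ! i" unfolding stage_row_def by (meson inj_map_eq_map)
qed

section \<open>Weights added over all pairings with a prescribed final grid\<close>

definition pairing_wt :: "'a::field \<Rightarrow> 'a \<Rightarrow> nat list list \<Rightarrow> nat \<Rightarrow> nat \<Rightarrow> 'a" where
  "pairing_wt t q \<Xi> c r = wsum (pair_step t q c r (color_cols c (stage_grid c \<Xi> r)) (stage_grid (Suc c) \<Xi> (r - 1)))
     (\<lambda>\<rho>. of_bool (\<rho> = stage_grid c \<Xi> (r - 1)))"

text \<open>Branches that end in the grid of \<Xi> pass only through its stage grids; any other
  intermediate grid contributes nothing.\<close>

lemma rounds_stage_grid_unique:
  assumes "stage_grid 2 \<Xi> \<in> snd ` set (rounds t q k G)" "grid_ok n L \<mu> k G" "1 \<le> k" "k \<le> n"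
  shows "G = stage_grid (Suc k) \<Xi>"
proof
  fix r
  have "G r = uncolor (max (Suc k) r) (stage_grid 2 \<Xi> r)" using rounds_outcome[OF assms] by blast
  then show "G r = stage_grid (Suc k) \<Xi> r" using uncolor_stage_grid[of "Suc k"] assms(3) by simp
qed

text \<open>Among all grids that can follow a stage of \<Xi>, only the next stage leads to the
  prescribed end. The sum over histories thus runs along a single path of grids, and the weights of
  the rounds multiply.\<close>

lemma rounds_weight:
  assumes \<Xi>: "\<Xi> \<in> chains n L \<mu>" and k: "1 \<le> k" "k \<le> n"
  shows "wsum (rounds t q k (stage_grid (Suc k) \<Xi>)) (\<lambda>H. of_bool (H = stage_grid 2 \<Xi>)) =
    (\<Prod>c=2..k. \<Prod>r=2..c. pairing_wt t q \<Xi> c r)"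
  using k
proof (induction k rule: dec_induct)
  case base
  then show ?case by (simp add: numeral_2_eq_2)
next
  case (step k)
  let ?c = "Suc k" and ?f = "\<lambda>H. of_bool (H = stage_grid 2 \<Xi>)"
  let ?G = "stage_grid (Suc ?c) \<Xi>"
  let ?G1 = "?G(?c := map (\<lambda>x. if x = Some 0 then Some ?c else x) (?G ?c))"
  let ?l = "sub_rounds t q ?c ?c ?G1"
  let ?W = "\<Prod>c=2..k. \<Prod>r=2..c. pairing_wt t q \<Xi> c r"
  obtain k' where k': "k = Suc k'" using step(1) by (cases k) auto
  have "wsum (rounds t q ?c ?G) ?f = wsum ?l (\<lambda>G'. wsum (rounds t q k G') ?f)"
    unfolding k' by (simp only: rounds.simps Let_def wsum_bind)
  also have "\<dots> = wsum ?l (\<lambda>G'. of_bool (G' = stage_grid ?c \<Xi>) * ?W)"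
  proof (rule wsum_cong)
    fix G' assume G': "G' \<in> snd ` set ?l"
    have "grid_ok n L \<mu> ?c ?G" by (rule grid_ok_stage_grid[OF \<Xi>]) simp
    from round_outcome[OF this _ step.prems(1) G'] step(1) have ok: "grid_ok n L \<mu> k G'" by simp
    show "wsum (rounds t q k G') ?f = of_bool (G' = stage_grid ?c \<Xi>) * ?W"
    proof (cases "G' = stage_grid ?c \<Xi>")
      case True
      then show ?thesis using step.IH step.prems by simp
    next
      case False
      have "wsum (rounds t q k G') ?f = 0"
      proof (rule wsum_eq_0)
        fix H assume H: "H \<in> snd ` set (rounds t q k G')"
        have "H \<noteq> stage_grid 2 \<Xi>"
        proof
          assume "H = stage_grid 2 \<Xi>"
          with H have "stage_grid 2 \<Xi> \<in> snd ` set (rounds t q k G')" by simp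
          from rounds_stage_grid_unique[OF this ok step(1)] False step.prems show False by simp
        qed
        then show "?f H = 0" by simp
      qed
      then show ?thesis using False by simp
    qed
  qed
  also have "\<dots> = wsum ?l (\<lambda>G'. of_bool (G' = stage_grid ?c \<Xi>)) * ?W"
    by (rule wsum_mult_right)
  also have "wsum ?l (\<lambda>G'. of_bool (G' = stage_grid ?c \<Xi>)) = (\<Prod>r=2..?c. pairing_wt t q \<Xi> ?c r)"
  proof -
    have "?G1 r = stage_grid ?c \<Xi> r" if "r \<notin> {1..<?c}" for r
    proof (cases "r = ?c")
      case True
      then show ?thesis using recolor_stage_grid[of ?c \<Xi>] by simp
    next
      case False
      then have "r \<notin> {1..?c}" using that by auto
      then show ?thesis using stage_grid_high[of r ?c \<Xi>] False by simp
    qed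
    then have al: "\<forall>r. r \<notin> {1..<?c} \<longrightarrow> ?G1 r = stage_grid ?c \<Xi> r" by (intro allI impI)
    have "wsum ?l (\<lambda>G'. of_bool (G' = stage_grid ?c \<Xi>)) =
      (\<Prod>r=2..?c. wsum (pair_step t q ?c r (color_cols ?c (stage_grid ?c \<Xi> r)) (?G1 (r - 1))) (\<lambda>\<rho>. of_bool (\<rho> = stage_grid ?c \<Xi> (r - 1))))"
      unfolding sub_rounds_weight by (simp only: eqTrueI[OF al] of_bool_eq mult_1_left)
    also have "\<dots> = (\<Prod>r=2..?c. pairing_wt t q \<Xi> ?c r)"
    proof (rule prod.cong[OF refl])
      fix r assume "r \<in> {2..?c}"
      then have "r - 1 \<noteq> ?c" by auto
      then show "wsum (pair_step t q ?c r (color_cols ?c (stage_grid ?c \<Xi> r)) (?G1 (r - 1))) (\<lambda>\<rho>. of_bool (\<rho> = stage_grid ?c \<Xi> (r - 1)))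
        = pairing_wt t q \<Xi> ?c r" by (simp only: pairing_wt_def fun_upd_apply if_False)
    qed
    finally show ?thesis .
  qed
  also have "(\<Prod>r=2..?c. pairing_wt t q \<Xi> ?c r) * ?W = (\<Prod>c=2..?c. \<Prod>r=2..c. pairing_wt t q \<Xi> c r)"
    using step(1) by (simp only: prod.nat_ivl_Suc'[of 2 k])
  finally show ?case .
qed

lemma grid_ok_init_grid:
  assumes "bs \<in> ball_systems n L m" "length m = n + 1"
  shows "grid_ok n L (\<lambda>i. m ! i) n (init_grid bs)"
  unfolding grid_ok_def
proof (intro conjI ballI allI impI)
  fix r assume r: "r \<in> {1..n}"
  have bs: "length (bs r) = L" "count_list (bs r) True = lvec m r"
    using assms(1) r by (auto simp: ball_systems_def)
  have nth: "init_grid bs r ! x = (if bs r ! x then Some 0 else None)" if "x < L" for x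
    using that bs by (simp add: init_grid_def)
  have len: "length (init_grid bs r) = L" using bs by (simp add: init_grid_def)
  have "cols (init_grid bs r) (Some c) = {}" if "c > 0" for c
    using that nth len by (auto simp: cols_def split: if_splits)
  moreover have "card {x. x < L \<and> init_grid bs r ! x \<noteq> None} = (\<Sum>i=r..n. m ! i)"
  proof -
    have "{x. x < L \<and> init_grid bs r ! x \<noteq> None} = cols (bs r) True"
      using nth bs by (auto simp: cols_def split: if_splits)
    then show ?thesis using bs(2) assms(2)
      by (simp add: count_list_cols lvec_def atLeastLessThanSuc_atLeastAtMost)
  qed
  moreover have "max n (r - 1) = n" using r by auto
  ultimately show "row_ok n L (\<lambda>i. m ! i) (max n (r - 1)) r (init_grid bs r)"
    using len by (simp add: row_ok_def)
next
  fix r assume "r \<notin> {1..n}"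
  then show "init_grid bs r = []" using assms(1) by (auto simp: ball_systems_def init_grid_def)
qed

lemma finite_ball_systems: "finite (ball_systems n L m)"
proof -
  have "ball_systems n L m \<subseteq> {f. \<forall>r. (r \<in> {1..n} \<longrightarrow> f r \<in> {xs. length xs = L}) \<and> (r \<notin> {1..n} \<longrightarrow> f r = [])}"
    by (auto simp: ball_systems_def)
  moreover have "finite {xs :: bool list. length xs = L}"
    using finite_lists_length_eq[of "UNIV :: bool set" L] by simp
  ultimately show ?thesis
    using finite_set_of_finite_funs[of "{1..n}" "{xs :: bool list. length xs = L}" "[]"] finite_subset by auto
qed

text \<open>At stage \<open>Suc n\<close> no colour is visible, and the grid is a bare pattern of
  balls whose row counts are the numbers l_r. Summing over ball systems therefore leaves one term
  per chain.\<close>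

lemma stage_grid_init_grid:
  assumes \<Xi>: "\<Xi> \<in> chains n L (\<lambda>i. m ! i)" and m: "length m = n + 1"
  shows "\<exists>!bs. bs \<in> ball_systems n L m \<and> init_grid bs = stage_grid (Suc n) \<Xi>"
proof (rule ex_ex1I)
  define bs where "bs r = map (\<lambda>y. y \<noteq> None) (stage_grid (Suc n) \<Xi> r)" for r
  have len: "length \<Xi> = n" using \<Xi> by (simp add: chains_iff)
  show "\<exists>bs. bs \<in> ball_systems n L m \<and> init_grid bs = stage_grid (Suc n) \<Xi>"
  proof (cases n)
    case 0
    have "bs r = []" "stage_grid (Suc n) \<Xi> r = []" for r using len 0 by (auto simp: bs_def stage_grid_def)
    then show ?thesis using 0 by (intro exI[of _ bs]) (auto simp: ball_systems_def init_grid_def)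
  next
    case (Suc n')
    have ok: "grid_ok n L (\<lambda>i. m ! i) n (stage_grid (Suc n) \<Xi>)" using grid_ok_stage_grid[OF \<Xi>, of n] Suc by simp
    have "length (bs r) = L \<and> count_list (bs r) True = lvec m r" if r: "r \<in> {1..n}" for r
    proof -
      have row: "row_ok n L (\<lambda>i. m ! i) (max n (r - 1)) r (stage_grid (Suc n) \<Xi> r)" using ok r by (simp add: grid_ok_def)
      then have l: "length (stage_grid (Suc n) \<Xi> r) = L" by (simp add: row_ok_def)
      have "cols (bs r) True = {x. x < L \<and> stage_grid (Suc n) \<Xi> r ! x \<noteq> None}"
        using l by (auto simp: cols_def bs_def)
      then show ?thesis using row m l
        by (simp add: count_list_cols row_ok_def lvec_def atLeastLessThanSuc_atLeastAtMost bs_def)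
    qed
    moreover have "bs r = []" if "r \<notin> {1..n}" for r using that len by (auto simp: bs_def stage_grid_def)
    moreover have "init_grid bs r = stage_grid (Suc n) \<Xi> r" for r
    proof (cases "r \<in> {1..n}")
      case True
      then have row: "row_ok n L (\<lambda>i. m ! i) (max n (r - 1)) r (stage_grid (Suc n) \<Xi> r)" using ok by (simp add: grid_ok_def)
      have "max n (r - 1) = n" using True by auto
      then have *: "n < c \<and> c \<le> n" if "x < L" "stage_grid (Suc n) \<Xi> r ! x = Some c" "c > 0" for x c
        using row_ok_color[OF row that] by simp
      show ?thesis
      proof (rule nth_equalityI)
        fix x assume x: "x < length (init_grid bs r)"
        then have "x < L" "x < length (stage_grid (Suc n) \<Xi> r)" using row by (auto simp: init_grid_def bs_def row_ok_def)
        then show "init_grid bs r ! x = stage_grid (Suc n) \<Xi> r ! x"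
          using *[of x "the (stage_grid (Suc n) \<Xi> r ! x)"]
          by (cases "stage_grid (Suc n) \<Xi> r ! x"; cases "the (stage_grid (Suc n) \<Xi> r ! x) = 0") (auto simp: init_grid_def bs_def)
      qed (simp add: init_grid_def bs_def)
    next
      case False
      then have "stage_grid (Suc n) \<Xi> r = []" using len by (auto simp: stage_grid_def)
      then show ?thesis by (simp add: init_grid_def bs_def)
    qed
    ultimately show ?thesis by (intro exI[of _ bs]) (auto simp: ball_systems_def)
  qed
next
  fix bs bs' assume "bs \<in> ball_systems n L m \<and> init_grid bs = stage_grid (Suc n) \<Xi>"
    "bs' \<in> ball_systems n L m \<and> init_grid bs' = stage_grid (Suc n) \<Xi>"
  then have eq: "init_grid bs r = init_grid bs' r" for r by simp
  have "inj (\<lambda>b. if b then Some (0::nat) else None)" by (rule injI) (auto split: if_splits)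
  then have "bs r = bs' r" for r using eq[of r] unfolding init_grid_def by (simp only: inj_map_eq_map)
  then show "bs = bs'" ..
qed

text \<open>The last stage shows colour 1 as free balls, which \<open>final_config\<close> turns
  into the label 1.\<close>

lemma final_config_stage_grid:
  assumes "\<Xi> \<in> chains n L \<mu>" "1 \<le> n"
  shows "final_config (stage_grid 2 \<Xi> 1) = \<Xi> ! 0"
proof -
  have "length \<Xi> = n" using assms by (simp add: chains_iff)
  then have "stage_grid 2 \<Xi> 1 = stage_row 2 1 (\<Xi> ! 0)" using assms(2) unfolding stage_grid_def by (simp add: numeral_2_eq_2)
  then show ?thesis unfolding final_config_def stage_row_def
    by (auto intro!: nth_equalityI split: option.splits nat.splits if_splits)
qed

text \<open>Each outcome belongs to exactly one chain and each chain to exactly one ball system, so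
  the double sum over ball systems and outcomes collapses to a sum over chains.\<close>

lemma P_MLQ_chains:
  assumes m: "length m = n + 1" and n: "1 \<le> n"
  shows "P_MLQ t q n L m \<sigma> = (\<Sum>\<Xi>\<in>chains n L (\<lambda>i. m ! i). of_bool (\<Xi> ! 0 = \<sigma>) *
    (\<Prod>c=2..n. \<Prod>r=2..c. pairing_wt t q \<Xi> c r))"
proof -
  let ?C = "chains n L (\<lambda>i. m ! i)" and ?W = "\<lambda>\<Xi>. \<Prod>c=2..n. \<Prod>r=2..c. pairing_wt t q \<Xi> c r"
  have filt: "sum_list (map fst (filter (\<lambda>(w, G). final_config (G 1) = \<sigma>) l)) =
    wsum l (\<lambda>G. of_bool (final_config (G 1) = \<sigma>))" for l :: "('a \<times> (nat \<Rightarrow> mrow)) list"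
    by (induction l) auto
  have one: "wsum (rounds t q n (init_grid bs)) (\<lambda>G. of_bool (final_config (G 1) = \<sigma>)) =
    (\<Sum>\<Xi>\<in>?C. of_bool (init_grid bs = stage_grid (Suc n) \<Xi>) * (of_bool (\<Xi> ! 0 = \<sigma>) * ?W \<Xi>))"
    if bs: "bs \<in> ball_systems n L m" for bs
  proof -
    let ?l = "rounds t q n (init_grid bs)"
    have ok: "grid_ok n L (\<lambda>i. m ! i) n (init_grid bs)" by (rule grid_ok_init_grid[OF bs m])
    have "wsum ?l (\<lambda>G. of_bool (final_config (G 1) = \<sigma>)) =
      wsum ?l (\<lambda>G. \<Sum>\<Xi>\<in>?C. of_bool (G = stage_grid 2 \<Xi>) * of_bool (\<Xi> ! 0 = \<sigma>))"
    proof (rule wsum_cong)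
      fix G assume "G \<in> snd ` set ?l"
      from grid_ok_exists[OF conjunct1[OF rounds_outcome[OF this ok n order_refl]]]
      obtain \<Xi> where \<Xi>: "\<Xi> \<in> ?C" "G = stage_grid 2 \<Xi>" by (rule bexE)
      have "(\<Sum>\<Xi>'\<in>?C. of_bool (G = stage_grid 2 \<Xi>') * of_bool (\<Xi>' ! 0 = \<sigma>) :: 'a) =
        (\<Sum>\<Xi>'\<in>?C. if \<Xi>' = \<Xi> then of_bool (\<Xi>' ! 0 = \<sigma>) else 0)"
      proof (rule sum.cong[OF refl])
        fix \<Xi>' assume \<Xi>': "\<Xi>' \<in> ?C"
        have "G = stage_grid 2 \<Xi>' \<longleftrightarrow> \<Xi>' = \<Xi>"
        proof
          assume "G = stage_grid 2 \<Xi>'"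
          then have "stage_grid 2 \<Xi>' = stage_grid 2 \<Xi>" unfolding \<Xi>(2) by (rule sym)
          then show "\<Xi>' = \<Xi>" by (rule stage_grid_inj[OF \<Xi>' \<Xi>(1)])
        qed (simp only: \<Xi>(2))
        then show "of_bool (G = stage_grid 2 \<Xi>') * of_bool (\<Xi>' ! 0 = \<sigma>) = (if \<Xi>' = \<Xi> then of_bool (\<Xi>' ! 0 = \<sigma>) else 0 :: 'a)"
          by simp
      qed
      also have "\<dots> = of_bool (\<Xi> ! 0 = \<sigma>)"
        using \<Xi>(1) by (simp only: sum.delta[OF finite_chains] if_True)
      finally have "(\<Sum>\<Xi>'\<in>?C. of_bool (G = stage_grid 2 \<Xi>') * of_bool (\<Xi>' ! 0 = \<sigma>) :: 'a) = of_bool (\<Xi> ! 0 = \<sigma>)" .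
      moreover have "final_config (G 1) = \<Xi> ! 0" unfolding \<Xi>(2) by (rule final_config_stage_grid[OF \<Xi>(1) n])
      ultimately show "of_bool (final_config (G 1) = \<sigma>) = (\<Sum>\<Xi>'\<in>?C. of_bool (G = stage_grid 2 \<Xi>') * of_bool (\<Xi>' ! 0 = \<sigma>) :: 'a)"
        by (simp only:)
    qed
    also have "\<dots> = (\<Sum>\<Xi>\<in>?C. wsum ?l (\<lambda>G. of_bool (G = stage_grid 2 \<Xi>)) * of_bool (\<Xi> ! 0 = \<sigma>))"
      by (simp only: wsum_sum wsum_mult_right)
    also have "\<dots> = (\<Sum>\<Xi>\<in>?C. of_bool (init_grid bs = stage_grid (Suc n) \<Xi>) * (of_bool (\<Xi> ! 0 = \<sigma>) * ?W \<Xi>))"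
    proof (rule sum.cong[OF refl])
      fix \<Xi> assume \<Xi>: "\<Xi> \<in> ?C"
      have "wsum ?l (\<lambda>G. of_bool (G = stage_grid 2 \<Xi>)) = of_bool (init_grid bs = stage_grid (Suc n) \<Xi>) * ?W \<Xi>"
      proof (cases "init_grid bs = stage_grid (Suc n) \<Xi>")
        case True
        then show ?thesis using rounds_weight[OF \<Xi> n order_refl, of t q] by (simp only: simp_thms of_bool_eq mult_1_left)
      next
        case False
        have "wsum ?l (\<lambda>G. of_bool (G = stage_grid 2 \<Xi>)) = 0"
        proof (rule wsum_eq_0)
          fix G assume G: "G \<in> snd ` set ?l"
          have "G \<noteq> stage_grid 2 \<Xi>"
          proof
            assume "G = stage_grid 2 \<Xi>"
            with G have "stage_grid 2 \<Xi> \<in> snd ` set ?l" by simp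
            from rounds_stage_grid_unique[OF this ok n order_refl] False show False by contradiction
          qed
          then show "of_bool (G = stage_grid 2 \<Xi>) = (0 :: 'a)" by simp
        qed
        then show ?thesis using False by simp
      qed
      then show "wsum ?l (\<lambda>G. of_bool (G = stage_grid 2 \<Xi>)) * of_bool (\<Xi> ! 0 = \<sigma>) =
        of_bool (init_grid bs = stage_grid (Suc n) \<Xi>) * (of_bool (\<Xi> ! 0 = \<sigma>) * ?W \<Xi>)"
        by (simp only: mult.assoc mult.commute mult.left_commute)
    qed
    finally show ?thesis .
  qed
  have "P_MLQ t q n L m \<sigma> = (\<Sum>bs\<in>ball_systems n L m. \<Sum>\<Xi>\<in>?C. of_bool (init_grid bs = stage_grid (Suc n) \<Xi>) * (of_bool (\<Xi> ! 0 = \<sigma>) * ?W \<Xi>))"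
    unfolding P_MLQ_def filt by (rule sum.cong[OF refl]) (rule one)
  also have "\<dots> = (\<Sum>\<Xi>\<in>?C. \<Sum>bs\<in>ball_systems n L m. of_bool (init_grid bs = stage_grid (Suc n) \<Xi>) * (of_bool (\<Xi> ! 0 = \<sigma>) * ?W \<Xi>))"
    by (rule sum.swap)
  also have "\<dots> = (\<Sum>\<Xi>\<in>?C. of_bool (\<Xi> ! 0 = \<sigma>) * ?W \<Xi>)"
  proof (rule sum.cong[OF refl])
    fix \<Xi> assume "\<Xi> \<in> ?C"
    from stage_grid_init_grid[OF this m] obtain b where
      b: "b \<in> ball_systems n L m" "init_grid b = stage_grid (Suc n) \<Xi>"
        "\<And>bs. bs \<in> ball_systems n L m \<Longrightarrow> init_grid bs = stage_grid (Suc n) \<Xi> \<Longrightarrow> bs = b" by (elim ex1E) blast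
    let ?w = "of_bool (\<Xi> ! 0 = \<sigma>) * ?W \<Xi>"
    have "(\<Sum>bs\<in>ball_systems n L m. of_bool (init_grid bs = stage_grid (Suc n) \<Xi>) * ?w) =
      (\<Sum>bs\<in>ball_systems n L m. if bs = b then ?w else 0)"
    proof (rule sum.cong[OF refl])
      fix bs assume "bs \<in> ball_systems n L m"
      then have "init_grid bs = stage_grid (Suc n) \<Xi> \<longleftrightarrow> bs = b" using b by blast
      then show "of_bool (init_grid bs = stage_grid (Suc n) \<Xi>) * ?w = (if bs = b then ?w else 0)"
        by (simp only: of_bool_def) simp
    qed
    also have "\<dots> = ?w" using b(1) finite_ball_systems by (simp only: sum.delta if_True)
    finally show "(\<Sum>bs\<in>ball_systems n L m. of_bool (init_grid bs = stage_grid (Suc n) \<Xi>) * ?w) = ?w" .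
  qed
  finally show ?thesis .
qed

section \<open>Layer-by-layer factorisation\<close>

text \<open>No column meets a vanishing entry of T, where \<eta> supplies the first index and \<xi>
  the second.\<close>

definition layer_compat :: "nat list \<Rightarrow> nat list \<Rightarrow> bool" where
  "layer_compat \<eta> \<xi> \<longleftrightarrow> (\<forall>x<length \<xi>. \<xi> ! x = 0 \<or> \<eta> ! x < \<xi> ! x)"

text \<open>A ball labelled k is paired with a box that gets the label \<open>Suc k\<close> one row
  up; \<open>occ (Suc k)\<close> of that upper row is the set of boxes still free at this
  moment.\<close>

definition occ :: "nat \<Rightarrow> nat list \<Rightarrow> nat set" where
  "occ k \<xi> = {x. x < length \<xi> \<and> 1 \<le> \<xi> ! x \<and> \<xi> ! x \<le> k}"

definition column_word :: "nat \<Rightarrow> nat list \<Rightarrow> nat list \<Rightarrow> letter list" where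
  "column_word k \<eta> \<xi> = word (cols \<eta> k) (occ (Suc k) \<xi>) (cols \<xi> (Suc k)) [0..<length \<xi>]"

definition layer_trace :: "nat \<Rightarrow> nat list \<Rightarrow> nat list \<Rightarrow> rat fps" where
  "layer_trace m \<eta> \<xi> = of_bool (layer_compat \<eta> \<xi>) * (\<Prod>k=1..m. word_trace (column_word k \<eta> \<xi>))"

text \<open>The form in which both sides meet: its recursion over rows mirrors the recursion
  defining X, and the weighted sum over chains unfolds in the same way.\<close>

fun chain_trace :: "nat \<Rightarrow> nat \<Rightarrow> (nat \<Rightarrow> nat) \<Rightarrow> nat list \<Rightarrow> rat fps" where
  "chain_trace 0 L \<mu> \<sigma> = 1"
| "chain_trace (Suc m) L \<mu> \<sigma> = (\<Sum>\<eta>\<in>configs m L (\<lambda>\<alpha>. \<mu> (Suc \<alpha>)). layer_trace m \<eta> \<sigma> * chain_trace m L (\<lambda>\<alpha>. \<mu> (Suc \<alpha>)) \<eta>)"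

lemma configs_length: "\<xi> \<in> configs n L \<mu> \<Longrightarrow> length \<xi> = L"
  by (simp add: configs_def)

lemma configs_le: "\<xi> \<in> configs n L \<mu> \<Longrightarrow> x < L \<Longrightarrow> \<xi> ! x \<le> n"
  unfolding configs_def using nth_mem[of x \<xi>] by (auto dest!: subsetD[of "set \<xi>"])

lemma card_occ:
  assumes "\<xi> \<in> configs n L \<mu>" "k \<le> n"
  shows "card (occ k \<xi>) = (\<Sum>\<alpha>=1..k. \<mu> \<alpha>)"
proof -
  have "occ k \<xi> = (\<Union>\<alpha>\<in>{1..k}. cols \<xi> \<alpha>)" by (auto simp: occ_def cols_def)
  then have "card (occ k \<xi>) = (\<Sum>\<alpha>=1..k. card (cols \<xi> \<alpha>))"
    by (simp only:) (rule card_UN_disjoint, auto simp: cols_def)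
  also have "\<dots> = (\<Sum>\<alpha>=1..k. \<mu> \<alpha>)"
    using assms by (intro sum.cong) (auto simp: configs_def)
  finally show ?thesis .
qed

text \<open>Colour c has label k = c + 1 - r in Row r and k + 1 in Row r - 1. When colour c is
  paired, the free boxes of Row r - 1 are those of final colour at most c. Hence the exponent counts
  the balls of the colours r - 1, ..., c - 1, a number given by the content.\<close>

lemma pairing_wt_eq:
  assumes \<Xi>: "\<Xi> \<in> chains n L \<mu>" and r: "2 \<le> r" "r \<le> c" "c \<le> n" and pos: "\<And>\<alpha>. \<alpha> \<in> {1..n} \<Longrightarrow> 1 \<le> \<mu> \<alpha>"
  defines "k \<equiv> Suc c - r" and "\<eta> \<equiv> \<Xi> ! (r - 1)" and "\<xi> \<equiv> \<Xi> ! (r - 2)"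
  shows "pairing_wt fls_X 1 \<Xi> c r = fps_to_fls (of_bool (cols \<eta> k \<inter> occ (Suc k) \<xi> \<subseteq> cols \<xi> (Suc k)) *
    ((1 - fps_X ^ (\<Sum>\<alpha>=1..k. \<mu> (\<alpha> + (r - 2)))) * word_trace (column_word k \<eta> \<xi>)))"
proof -
  have lenX: "length \<Xi> = n" using \<Xi> by (simp add: chains_iff)
  have conf: "\<Xi> ! i \<in> configs (n - i) L (\<lambda>\<alpha>. \<mu> (\<alpha> + i))" if "i < n" for i using \<Xi> that by (simp add: chains_iff)
  have \<eta>: "\<eta> \<in> configs (n - (r - 1)) L (\<lambda>\<alpha>. \<mu> (\<alpha> + (r - 1)))" unfolding \<eta>_def by (rule conf) (use r in simp)
  have \<xi>: "\<xi> \<in> configs (n - (r - 2)) L (\<lambda>\<alpha>. \<mu> (\<alpha> + (r - 2)))" unfolding \<xi>_def by (rule conf) (use r in simp)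
  note len = configs_length[OF \<eta>] configs_length[OF \<xi>]
  have k: "1 \<le> k" "k \<le> n - (r - 1)" "Suc k \<le> n - (r - 2)" "k + (r - 1) = c" "Suc k + (r - 2) = c"
    using r by (auto simp: k_def)
  define R where "R = stage_row (Suc c) (r - 1) \<xi>"
  have lenR: "length R = L" by (simp add: R_def len)
  have "r - 1 - 1 = r - 2" by simp
  moreover have "max (Suc c) (r - 1) = Suc c" "max c (r - 1) = c" "max c r = c" using r by auto
  ultimately have stage_grid: "stage_grid (Suc c) \<Xi> (r - 1) = R" "stage_grid c \<Xi> (r - 1) = stage_row c (r - 1) \<xi>" "stage_grid c \<Xi> r = stage_row c r \<eta>"
    using r lenX by (auto simp: stage_grid_def R_def \<xi>_def \<eta>_def)
  have free: "free_cols R = occ (Suc k) \<xi>"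
    unfolding free_cols_def occ_def lenR len
  proof (intro Collect_cong conj_cong refl)
    fix x assume "x < L"
    then show "(R ! x = Some 0) = (1 \<le> \<xi> ! x \<and> \<xi> ! x \<le> Suc k)"
      unfolding R_def nth_stage_row[OF \<open>x < L\<close>[folded len(2)]] using k r by auto
  qed
  have S: "cols \<xi> (Suc k) \<subseteq> free_cols R" unfolding free by (auto simp: cols_def occ_def)
  have paint: "stage_row c (r - 1) \<xi> = paint (cols \<xi> (Suc k)) c R"
  proof (rule nth_equalityI)
    fix x assume "x < length (stage_row c (r - 1) \<xi>)"
    then have x: "x < length \<xi>" "x < length R" using len lenR by auto
    show "stage_row c (r - 1) \<xi> ! x = paint (cols \<xi> (Suc k)) c R ! x"
      unfolding nth_paint[OF x(2)] unfolding R_def nth_stage_row[OF x(1)] using x k r by (auto simp: cols_def)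
  qed (simp add: lenR len)
  have J: "set (color_cols c (stage_grid c \<Xi> r)) = cols \<eta> k"
    unfolding color_cols stage_grid cols_def length_stage_row
  proof (intro Collect_cong conj_cong refl)
    fix x assume "x < length \<eta>"
    then show "(stage_row c r \<eta> ! x = Some c) = (\<eta> ! x = k)"
      unfolding nth_stage_row[OF \<open>x < length \<eta>\<close>] using k r by auto
  qed
  have cJ: "length (color_cols c (stage_grid c \<Xi> r)) = \<mu> c"
  proof -
    have "length (color_cols c (stage_grid c \<Xi> r)) = card (cols \<eta> k)"
      using distinct_card[OF color_cols(1)] J by metis
    then show ?thesis using \<eta> k(1,2,4) by (auto simp: configs_def)
  qed
  have cS: "card (cols \<xi> (Suc k)) = \<mu> c" using \<xi> k(3,5) by (auto simp: configs_def)
  have cA: "card (free_cols R) = (\<Sum>\<alpha>=1..k. \<mu> (\<alpha> + (r - 2))) + \<mu> c"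
    unfolding free card_occ[OF \<xi> k(3)] using k(5) by simp
  \<comment> \<open>The positive number of balls of colour r - 1, the lowest in Row r - 1, provides
    a free box that stays unchosen.\<close>
  have "\<mu> (1 + (r - 2)) \<le> (\<Sum>\<alpha>=1..k. \<mu> (\<alpha> + (r - 2)))"
    by (rule member_le_sum) (use k in auto)
  moreover have "1 \<le> \<mu> (1 + (r - 2))" by (rule pos) (use r in auto)
  ultimately have "\<mu> c < card (free_cols R)" unfolding cA by simp
  moreover have "set (color_cols c (stage_grid c \<Xi> r)) \<subseteq> {..<length R}" unfolding J lenR by (auto simp: cols_def len)
  ultimately have "pairing_wt fls_X 1 \<Xi> c r = fps_to_fls (pair_tr (cols \<eta> k) (occ (Suc k) \<xi>) (cols \<xi> (Suc k)) L)"
    unfolding pairing_wt_def stage_grid(1,2) paint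
    by (subst pair_step_weight) (use r S cS cJ lenR free J color_cols(1) in auto)
  moreover have "card (occ (Suc k) \<xi>) - card (cols \<xi> (Suc k)) = (\<Sum>\<alpha>=1..k. \<mu> (\<alpha> + (r - 2)))"
    using cA cS free by simp
  ultimately show ?thesis by (simp only: pair_tr_def column_word_def len)
qed

text \<open>If 0 < \<xi> ! x <= \<eta> ! x, then box x is still free when the ball below it, with
  label \<eta> ! x, is paired, yet it does not end with the label of that ball; the rule for a free
  box directly above is violated. This is the only way to violate it.\<close>

lemma layer_compat_iff:
  assumes "\<eta> \<in> configs m L \<mu>" "length \<xi> = L"
  shows "(\<forall>k\<in>{1..m}. cols \<eta> k \<inter> occ (Suc k) \<xi> \<subseteq> cols \<xi> (Suc k)) \<longleftrightarrow> layer_compat \<eta> \<xi>"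
proof
  assume h: "\<forall>k\<in>{1..m}. cols \<eta> k \<inter> occ (Suc k) \<xi> \<subseteq> cols \<xi> (Suc k)"
  show "layer_compat \<eta> \<xi>" unfolding layer_compat_def
  proof (intro allI impI)
    fix x assume x: "x < length \<xi>"
    show "\<xi> ! x = 0 \<or> \<eta> ! x < \<xi> ! x"
    proof (rule ccontr)
      assume n: "\<not> (\<xi> ! x = 0 \<or> \<eta> ! x < \<xi> ! x)"
      have "\<eta> ! x \<in> {1..m}" using n configs_le[OF assms(1), of x] x assms(2) by auto
      moreover have "x \<in> cols \<eta> (\<eta> ! x) \<inter> occ (Suc (\<eta> ! x)) \<xi>"
        using n x assms(2) configs_length[OF assms(1)] by (auto simp: cols_def occ_def)
      ultimately have "x \<in> cols \<xi> (Suc (\<eta> ! x))" using h by blast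
      then show False using n by (simp add: cols_def)
    qed
  qed
next
  assume c: "layer_compat \<eta> \<xi>"
  show "\<forall>k\<in>{1..m}. cols \<eta> k \<inter> occ (Suc k) \<xi> \<subseteq> cols \<xi> (Suc k)"
  proof (intro ballI subsetI)
    fix k x assume x: "x \<in> cols \<eta> k \<inter> occ (Suc k) \<xi>"
    then have "x < length \<xi>" by (simp add: occ_def)
    then have "\<xi> ! x = 0 \<or> \<eta> ! x < \<xi> ! x" using c unfolding layer_compat_def by blast
    then show "x \<in> cols \<xi> (Suc k)" using x by (auto simp: cols_def occ_def)
  qed
qed

lemma prod_of_bool: "finite I \<Longrightarrow> (\<Prod>i\<in>I. of_bool (P i)) = (of_bool (\<forall>i\<in>I. P i) :: 'a::comm_semiring_1)"
  by (induction I rule: finite_induct) auto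

text \<open>Queues are built colour by colour, while the operators are built row by row; this
  exchanges the two orders.\<close>

lemma prod_triangle:
  "(\<Prod>c=2..n. \<Prod>r=2..c. f c r) = (\<Prod>r=2..n. \<Prod>c=r..n. f c r :: 'a::comm_monoid_mult)" for n :: nat
proof -
  have "(\<Prod>c=2..n. \<Prod>r=2..c. f c r) = (\<Prod>c=2..n. \<Prod>r=2..n. if r \<le> c then f c r else 1)"
    by (intro prod.cong refl prod.mono_neutral_cong_left) auto
  also have "\<dots> = (\<Prod>r=2..n. \<Prod>c=2..n. if r \<le> c then f c r else 1)" by (rule prod.swap)
  also have "\<dots> = (\<Prod>r=2..n. \<Prod>c=r..n. f c r)"
    by (intro prod.cong refl prod.mono_neutral_cong_right) auto
  finally show ?thesis .
qed

text \<open>The constant C(m). The factor for r and k is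
  \<open>1 - t^(m_(r-1) + ... + m_(r+k-2))\<close>, the normalisation of colour c = r + k - 1
  between Rows r and r - 1.\<close>

definition norm_const :: "nat \<Rightarrow> (nat \<Rightarrow> nat) \<Rightarrow> rat poly" where
  "norm_const n \<mu> = (\<Prod>r=2..n. \<Prod>k=1..Suc n - r. 1 - tt ^ (\<Sum>\<alpha>=1..k. \<mu> (\<alpha> + (r - 2))))"

lemma prod_pairing_wt:
  assumes \<Xi>: "\<Xi> \<in> chains n L \<mu>" and pos: "\<And>\<alpha>. \<alpha> \<in> {1..n} \<Longrightarrow> 1 \<le> \<mu> \<alpha>"
  shows "(\<Prod>c=2..n. \<Prod>r=2..c. pairing_wt fls_X 1 \<Xi> c r) =
    fps_to_fls (fps_of_poly (norm_const n \<mu>) * (\<Prod>r=2..n. layer_trace (Suc n - r) (\<Xi> ! (r - 1)) (\<Xi> ! (r - 2))))"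
proof -
  let ?K = "\<lambda>r k. 1 - fps_X ^ (\<Sum>\<alpha>=1..k. \<mu> (\<alpha> + (r - 2))) :: rat fps"
  have lenX: "length \<Xi> = n" using \<Xi> by (simp add: chains_iff)
  have conf: "\<Xi> ! i \<in> configs (n - i) L (\<lambda>\<alpha>. \<mu> (\<alpha> + i))" if "i < n" for i using \<Xi> that by (simp add: chains_iff)
  have row: "(\<Prod>c=r..n. pairing_wt fls_X 1 \<Xi> c r) =
    fps_to_fls ((\<Prod>k=1..Suc n - r. ?K r k) * layer_trace (Suc n - r) (\<Xi> ! (r - 1)) (\<Xi> ! (r - 2)))"
    if r: "r \<in> {2..n}" for r
  proof -
    let ?\<eta> = "\<Xi> ! (r - 1)" and ?\<xi> = "\<Xi> ! (r - 2)"
    let ?P = "\<lambda>k. cols ?\<eta> k \<inter> occ (Suc k) ?\<xi> \<subseteq> cols ?\<xi> (Suc k)"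
    let ?g = "\<lambda>k. of_bool (?P k) * (?K r k * word_trace (column_word k ?\<eta> ?\<xi>))"
    have \<eta>: "?\<eta> \<in> configs (Suc n - r) L (\<lambda>\<alpha>. \<mu> (\<alpha> + (r - 1)))"
    proof -
      have "n - (r - 1) = Suc n - r" "r - 1 < n" using r by auto
      then show ?thesis using conf[of "r - 1"] by simp
    qed
    have \<xi>: "length ?\<xi> = L" by (rule configs_length[OF conf]) (use r in auto)
    have "(\<Prod>c=r..n. pairing_wt fls_X 1 \<Xi> c r) = (\<Prod>c=r..n. fps_to_fls (?g (Suc c - r)))"
    proof (rule prod.cong[OF refl])
      fix c assume c: "c \<in> {r..n}"
      show "pairing_wt fls_X 1 \<Xi> c r = fps_to_fls (?g (Suc c - r))"
        by (rule pairing_wt_eq[OF \<Xi> _ _ _ pos]) (use r c in auto)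
    qed
    also have "\<dots> = (\<Prod>k=1..Suc n - r. fps_to_fls (?g k))"
      by (rule prod.reindex_bij_witness[of _ "\<lambda>k. k + r - 1" "\<lambda>c. Suc c - r"]) (use r in auto)
    also have "\<dots> = fps_to_fls (\<Prod>k=1..Suc n - r. ?g k)" by (rule fps_to_fls_prod[symmetric])
    also have "(\<Prod>k=1..Suc n - r. ?g k) =
      (\<Prod>k=1..Suc n - r. of_bool (?P k)) * ((\<Prod>k=1..Suc n - r. ?K r k) * (\<Prod>k=1..Suc n - r. word_trace (column_word k ?\<eta> ?\<xi>)))"
      by (simp only: prod.distrib)
    also have "(\<Prod>k=1..Suc n - r. of_bool (?P k)) = (of_bool (layer_compat ?\<eta> ?\<xi>) :: rat fps)"
      by (simp only: prod_of_bool finite_atLeastAtMost layer_compat_iff[OF \<eta> \<xi>])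
    finally show ?thesis unfolding layer_trace_def by (simp only: mult.left_commute)
  qed
  have "(\<Prod>c=2..n. \<Prod>r=2..c. pairing_wt fls_X 1 \<Xi> c r) = (\<Prod>r=2..n. \<Prod>c=r..n. pairing_wt fls_X 1 \<Xi> c r)"
    by (rule prod_triangle)
  also have "\<dots> = (\<Prod>r=2..n. fps_to_fls ((\<Prod>k=1..Suc n - r. ?K r k) * layer_trace (Suc n - r) (\<Xi> ! (r - 1)) (\<Xi> ! (r - 2))))"
    by (rule prod.cong[OF refl]) (rule row)
  also have "\<dots> = fps_to_fls ((\<Prod>r=2..n. \<Prod>k=1..Suc n - r. ?K r k) * (\<Prod>r=2..n. layer_trace (Suc n - r) (\<Xi> ! (r - 1)) (\<Xi> ! (r - 2))))"
    by (simp only: fps_to_fls_prod[symmetric] prod.distrib)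
  also have "(\<Prod>r=2..n. \<Prod>k=1..Suc n - r. ?K r k) = fps_of_poly (norm_const n \<mu>)"
    by (simp only: norm_const_def fps_of_poly_prod fps_of_poly_diff fps_of_poly_1 fps_of_poly_power fps_of_poly_tt)
  finally show ?thesis .
qed

lemma configs_0: "configs 0 L \<mu> = {replicate L 0}"
proof -
  have "\<xi> = replicate L 0" if "length \<xi> = L" "set \<xi> \<subseteq> {0}" for \<xi> :: "nat list"
    using that by (intro replicate_eqI) auto
  then show ?thesis by (auto simp: configs_def)
qed

text \<open>The factor r = 2 couples Rows 1 and 2. Shifting r by one turns the remaining factors
  into the product for the chain that starts at Row 2, with shifted content.\<close>

lemma sum_chains_chain_trace:
  assumes "length \<sigma> = L"
  shows "(\<Sum>\<Xi>\<in>chains m L (\<lambda>\<alpha>. \<mu> (Suc \<alpha>)). \<Prod>r=2..Suc m. layer_trace (Suc (Suc m) - r) ((\<sigma> # \<Xi>) ! (r - 1)) ((\<sigma> # \<Xi>) ! (r - 2)))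
     = chain_trace (Suc m) L \<mu> \<sigma>"
  using assms
proof (induction m arbitrary: \<sigma> \<mu>)
  case 0
  have "layer_compat (replicate L 0) \<sigma>" using 0 by (auto simp: layer_compat_def)
  then show ?case by (simp add: configs_0 layer_trace_def)
next
  case (Suc m)
  let ?\<mu> = "\<lambda>\<alpha>. \<mu> (Suc \<alpha>)"
  let ?T = "\<lambda>m \<Xi> r. layer_trace (Suc (Suc m) - r) (\<Xi> ! (r - 1)) (\<Xi> ! (r - 2))"
  have split: "(\<Prod>r=2..Suc (Suc m). ?T (Suc m) (\<sigma> # \<eta> # \<Xi>) r) = layer_trace (Suc m) \<eta> \<sigma> * (\<Prod>r=2..Suc m. ?T m (\<eta> # \<Xi>) r)" for \<eta> \<Xi>
  proof -
    have "(\<Prod>r=2..Suc (Suc m). ?T (Suc m) (\<sigma> # \<eta> # \<Xi>) r) =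
      ?T (Suc m) (\<sigma> # \<eta> # \<Xi>) 2 * (\<Prod>r=Suc 2..Suc (Suc m). ?T (Suc m) (\<sigma> # \<eta> # \<Xi>) r)"
      by (rule prod.atLeast_Suc_atMost) simp
    also have "(\<Prod>r=Suc 2..Suc (Suc m). ?T (Suc m) (\<sigma> # \<eta> # \<Xi>) r) = (\<Prod>r=2..Suc m. ?T (Suc m) (\<sigma> # \<eta> # \<Xi>) (Suc r))"
      by (rule prod.shift_bounds_cl_Suc_ivl)
    also have "\<dots> = (\<Prod>r=2..Suc m. ?T m (\<eta> # \<Xi>) r)"
    proof (rule prod.cong[OF refl])
      fix r assume "r \<in> {2..Suc m}"
      then obtain i where "r = Suc (Suc i)" by (cases r; cases "r - 1") auto
      then show "?T (Suc m) (\<sigma> # \<eta> # \<Xi>) (Suc r) = ?T m (\<eta> # \<Xi>) r" by simp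
    qed
    also have "?T (Suc m) (\<sigma> # \<eta> # \<Xi>) 2 = layer_trace (Suc m) \<eta> \<sigma>" by simp
    finally show ?thesis .
  qed
  have inj: "inj_on (\<lambda>(\<xi>, \<Xi>). \<xi> # \<Xi>) X" for X :: "(nat list \<times> nat list list) set" by (auto simp: inj_on_def)
  have "(\<Sum>\<Xi>\<in>chains (Suc m) L ?\<mu>. \<Prod>r=2..Suc (Suc m). ?T (Suc m) (\<sigma> # \<Xi>) r) =
    (\<Sum>(\<eta>, \<Xi>)\<in>configs (Suc m) L ?\<mu> \<times> chains m L (\<lambda>\<alpha>. ?\<mu> (Suc \<alpha>)). \<Prod>r=2..Suc (Suc m). ?T (Suc m) (\<sigma> # \<eta> # \<Xi>) r)"
    unfolding chains.simps sum.reindex[OF inj] by (simp only: comp_def case_prod_unfold)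
  also have "\<dots> = (\<Sum>\<eta>\<in>configs (Suc m) L ?\<mu>. \<Sum>\<Xi>\<in>chains m L (\<lambda>\<alpha>. ?\<mu> (Suc \<alpha>)). layer_trace (Suc m) \<eta> \<sigma> * (\<Prod>r=2..Suc m. ?T m (\<eta> # \<Xi>) r))"
    unfolding split by (rule sum.cartesian_product[symmetric])
  also have "\<dots> = (\<Sum>\<eta>\<in>configs (Suc m) L ?\<mu>. layer_trace (Suc m) \<eta> \<sigma> * chain_trace (Suc m) L ?\<mu> \<eta>)"
  proof (rule sum.cong[OF refl])
    fix \<eta> assume "\<eta> \<in> configs (Suc m) L ?\<mu>"
    then have "length \<eta> = L" by (rule configs_length)
    from Suc.IH[OF this, of ?\<mu>]
    show "(\<Sum>\<Xi>\<in>chains m L (\<lambda>\<alpha>. ?\<mu> (Suc \<alpha>)). layer_trace (Suc m) \<eta> \<sigma> * (\<Prod>r=2..Suc m. ?T m (\<eta> # \<Xi>) r))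
      = layer_trace (Suc m) \<eta> \<sigma> * chain_trace (Suc m) L ?\<mu> \<eta>"
      unfolding sum_distrib_left[symmetric] by (simp only:)
  qed
  also have "\<dots> = chain_trace (Suc (Suc m)) L \<mu> \<sigma>" by (rule chain_trace.simps(2)[symmetric])
  finally show ?case .
qed

lemma P_MLQ_chain_trace:
  assumes m: "length m = n + 1" and n: "1 \<le> n" and pos: "\<And>\<alpha>. \<alpha> \<in> {1..n} \<Longrightarrow> 1 \<le> m ! \<alpha>"
    and \<sigma>: "\<sigma> \<in> configs n L (\<lambda>i. m ! i)"
  shows "P_MLQ fls_X 1 n L m \<sigma> =
    fps_to_fls (fps_of_poly (norm_const n (\<lambda>i. m ! i)) * chain_trace n L (\<lambda>i. m ! i) \<sigma>)"
proof -
  let ?\<mu> = "\<lambda>i. m ! i" and ?k = "fps_of_poly (norm_const n (\<lambda>i. m ! i))"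
  obtain n' where n': "n = Suc n'" using n by (cases n) auto
  let ?T = "\<lambda>\<Xi>. \<Prod>r=2..n. layer_trace (Suc n - r) (\<Xi> ! (r - 1)) (\<Xi> ! (r - 2))"
  have inj: "inj_on (\<lambda>(\<xi>, \<Xi>). \<xi> # \<Xi>) X" for X :: "(nat list \<times> nat list list) set" by (auto simp: inj_on_def)
  have "P_MLQ fls_X 1 n L m \<sigma> = (\<Sum>\<Xi>\<in>chains n L ?\<mu>. of_bool (\<Xi> ! 0 = \<sigma>) * fps_to_fls (?k * ?T \<Xi>))"
    unfolding P_MLQ_chains[OF m n]
    by (rule sum.cong[OF refl]) (simp only: prod_pairing_wt[OF _ pos])
  also have "\<dots> = (\<Sum>(\<xi>, \<Xi>)\<in>configs n L ?\<mu> \<times> chains n' L (\<lambda>\<alpha>. ?\<mu> (Suc \<alpha>)). of_bool (\<xi> = \<sigma>) * fps_to_fls (?k * ?T (\<xi> # \<Xi>)))"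
    unfolding n' chains.simps sum.reindex[OF inj] by (simp only: comp_def case_prod_unfold nth_Cons_0)
  also have "\<dots> = (\<Sum>\<xi>\<in>configs n L ?\<mu>. \<Sum>\<Xi>\<in>chains n' L (\<lambda>\<alpha>. ?\<mu> (Suc \<alpha>)). of_bool (\<xi> = \<sigma>) * fps_to_fls (?k * ?T (\<xi> # \<Xi>)))"
    by (rule sum.cartesian_product[symmetric])
  also have "\<dots> = (\<Sum>\<xi>\<in>configs n L ?\<mu>. if \<xi> = \<sigma> then fps_to_fls (?k * chain_trace n L ?\<mu> \<sigma>) else 0)"
  proof (rule sum.cong[OF refl])
    fix \<xi> assume "\<xi> \<in> configs n L ?\<mu>"
    show "(\<Sum>\<Xi>\<in>chains n' L (\<lambda>\<alpha>. ?\<mu> (Suc \<alpha>)). of_bool (\<xi> = \<sigma>) * fps_to_fls (?k * ?T (\<xi> # \<Xi>)))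
      = (if \<xi> = \<sigma> then fps_to_fls (?k * chain_trace n L ?\<mu> \<sigma>) else 0)"
    proof (cases "\<xi> = \<sigma>")
      case True
      have "(\<Sum>\<Xi>\<in>chains n' L (\<lambda>\<alpha>. ?\<mu> (Suc \<alpha>)). ?T (\<sigma> # \<Xi>)) = chain_trace n L ?\<mu> \<sigma>"
        unfolding n' by (rule sum_chains_chain_trace) (rule configs_length[OF \<sigma>])
      then have "(\<Sum>\<Xi>\<in>chains n' L (\<lambda>\<alpha>. ?\<mu> (Suc \<alpha>)). fps_to_fls (?k * ?T (\<sigma> # \<Xi>))) = fps_to_fls (?k * chain_trace n L ?\<mu> \<sigma>)"
        by (simp only: fps_to_fls_sum[symmetric] sum_distrib_left[symmetric])
      then show ?thesis using True by (simp only: simp_thms of_bool_eq mult_1_left if_True)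
    next
      case False
      then show ?thesis by simp
    qed
  qed
  also have "\<dots> = fps_to_fls (?k * chain_trace n L ?\<mu> \<sigma>)"
    using \<sigma> by (simp only: sum.delta[OF finite_configs] if_True)
  finally show ?thesis .
qed

text \<open>Every exponent contains the positive summand \<mu> (r - 1), so each factor has constant
  coefficient 1.\<close>

lemma norm_const_neq_0:
  assumes "\<And>\<alpha>. \<alpha> \<in> {1..n} \<Longrightarrow> 1 \<le> \<mu> \<alpha>"
  shows "norm_const n \<mu> \<noteq> 0"
proof -
  have "1 - tt ^ (\<Sum>\<alpha>=1..k. \<mu> (\<alpha> + (r - 2))) \<noteq> 0" if r: "r \<in> {2..n}" and k: "k \<in> {1..Suc n - r}" for r k
  proof
    assume 0: "1 - tt ^ (\<Sum>\<alpha>=1..k. \<mu> (\<alpha> + (r - 2))) = 0"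
    have "\<mu> (1 + (r - 2)) \<le> (\<Sum>\<alpha>=1..k. \<mu> (\<alpha> + (r - 2)))"
      by (rule member_le_sum) (use k in auto)
    moreover have "1 \<le> \<mu> (1 + (r - 2))" by (rule assms) (use r in auto)
    ultimately have pos: "0 < (\<Sum>\<alpha>=1..k. \<mu> (\<alpha> + (r - 2)))" by linarith
    have "coeff (1 - tt ^ s) 0 = 1" if "0 < s" for s using that by (simp add: tt_power)
    from this[OF pos] show False unfolding 0 by simp
  qed
  then show ?thesis unfolding norm_const_def by (simp add: prod_zero_iff)
qed

section \<open>The matrix product operators\<close>

text \<open>Each letter sends a basis vector to a multiple of one basis vector; target and
  coefficient are kept apart. Lowering state 0 has target 0 by truncated subtraction, which is
  harmless because the coefficient 1 - t^0 vanishes.\<close>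

fun letter_target :: "letter \<Rightarrow> nat \<Rightarrow> nat" where
  "letter_target Lid d = d" | "letter_target Lk d = d" | "letter_target Lplus d = d + 1" | "letter_target Lminus d = d - 1"

fun letter_coef :: "letter \<Rightarrow> nat \<Rightarrow> rat poly" where
  "letter_coef Lid d = 1" | "letter_coef Lk d = tt ^ d" | "letter_coef Lplus d = 1" | "letter_coef Lminus d = 1 - tt ^ d"

fun word_target :: "letter list \<Rightarrow> nat \<Rightarrow> nat" where
  "word_target [] d = d" | "word_target (x # w) d = letter_target x (word_target w d)"

fun word_coef :: "letter list \<Rightarrow> nat \<Rightarrow> rat poly" where
  "word_coef [] d = 1" | "word_coef (x # w) d = letter_coef x (word_target w d) * word_coef w d"

lemma word_entry_eq: "word_entry w e d = (if e = word_target w d then word_coef w d else 0)"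
proof (induction w arbitrary: e)
  case (Cons x w)
  show ?case
  proof (cases x)
    case Lplus
    then show ?thesis using Cons.IH[of "e - 1"] by (cases e) auto
  next
    case Lminus
    then show ?thesis using Cons.IH[of "e + 1"] by (cases "word_target w d") auto
  qed (use Cons.IH in auto)
qed auto

section \<open>The entries of T as monomial operators\<close>

definition mono_op :: "(fstate \<Rightarrow> fstate) \<Rightarrow> (fstate \<Rightarrow> rat poly) \<Rightarrow> fop" where
  "mono_op g c e d = (if e = g d then c d else 0)"

lemma op_mul_single:
  assumes "\<And>e'. B e' d = (if P \<and> e' = g then c else 0)"
  shows "op_mul A B e d = of_bool P * (A e g * c)"
proof -
  have "{d'. B d' d \<noteq> 0} = (if P \<and> c \<noteq> 0 then {g} else {})" using assms by auto
  then show ?thesis by (auto simp: op_mul_def assms)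
qed

lemma op_mul_mono: "op_mul (mono_op g c) (mono_op g' c') = mono_op (\<lambda>d. g (g' d)) (\<lambda>d. c (g' d) * c' d)"
proof (intro ext)
  fix e d
  have "op_mul (mono_op g c) (mono_op g' c') e d = of_bool True * (mono_op g c e (g' d) * c' d)"
    by (rule op_mul_single) (simp add: mono_op_def)
  then show "op_mul (mono_op g c) (mono_op g' c') e d = mono_op (\<lambda>d. g (g' d)) (\<lambda>d. c (g' d) * c' d) e d"
    by (simp add: mono_op_def)
qed

lemma op_id_mono: "op_id = mono_op (\<lambda>d. d) (\<lambda>_. 1)"
  by (intro ext) (simp add: op_id_def mono_op_def)

lemma op_ap_mono: "op_ap r = mono_op (\<lambda>d. d[r - 1 := d ! (r - 1) + 1]) (\<lambda>_. 1)"
  by (intro ext) (simp add: op_ap_def mono_op_def)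

lemma op_am_mono: "op_am r = mono_op (\<lambda>d. d[r - 1 := d ! (r - 1) - 1]) (\<lambda>d. 1 - tt ^ (d ! (r - 1)))"
  by (intro ext) (simp add: op_am_def mono_op_def)

lemma op_k_mono: "op_k r = mono_op (\<lambda>d. d) (\<lambda>d. tt ^ (d ! (r - 1)))"
  by (intro ext) (simp add: op_k_def mono_op_def)

lemma op_kprod_mono: "op_kprod a b = mono_op (\<lambda>d. d) (\<lambda>d. \<Prod>r=a..b. tt ^ (d ! (r - 1)))"
proof -
  have "foldr op_mul (map op_k rs) op_id = mono_op (\<lambda>d. d) (\<lambda>d. \<Prod>r\<leftarrow>rs. tt ^ (d ! (r - 1)))" for rs
    by (induction rs) (simp_all add: op_id_mono op_k_mono op_mul_mono)
  moreover have "(\<Prod>r\<leftarrow>[a..<Suc b]. tt ^ (d ! (r - 1))) = (\<Prod>r=a..b. tt ^ (d ! (r - 1)))" for d :: fstate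
    by (subst prod.distinct_set_conv_list[symmetric]) (simp_all add: atLeastLessThanSuc_atLeastAtMost del: upt_Suc)
  ultimately show ?thesis unfolding op_kprod_def by presburger
qed

text \<open>The letter of tensor factor r in the entry of T with indices i and \<alpha>. For
  \<alpha> = i + 1 the operators \<open>a+_i\<close> and \<open>a-_(\<alpha>-1)\<close> would share
  factor i; there the letter is the identity. The letters do not show that the entry vanishes for 0
  < \<alpha> <= i, so a separate indicator records it.\<close>

definition factor_letter :: "nat \<Rightarrow> nat \<Rightarrow> nat \<Rightarrow> letter" where
  "factor_letter r i \<alpha> = (if 1 \<le> \<alpha> \<and> \<alpha> \<le> Suc r then if \<alpha> = Suc r then if i = r then Lid else Lminus else Lk
     else if i = r then Lplus else Lid)"

definition Tmat_target :: "nat \<Rightarrow> nat \<Rightarrow> nat \<Rightarrow> nat list \<Rightarrow> nat list" where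
  "Tmat_target m i \<alpha> u = map (\<lambda>r. letter_target (factor_letter (Suc r) i \<alpha>) (u ! r)) [0..<m]"

definition Tmat_coef :: "nat \<Rightarrow> nat \<Rightarrow> nat \<Rightarrow> nat list \<Rightarrow> rat poly" where
  "Tmat_coef m i \<alpha> u = (\<Prod>r<m. letter_coef (factor_letter (Suc r) i \<alpha>) (u ! r))"

lemma Tmat_entry:
  assumes "length u = m" "i \<le> m" "\<alpha> \<le> Suc m"
  shows "Tmat (Suc m) i \<alpha> 1 e (u @ v) = (if (\<alpha> = 0 \<or> i < \<alpha>) \<and> e = Tmat_target m i \<alpha> u @ v then Tmat_coef m i \<alpha> u else 0)"
proof -
  consider "\<alpha> = 0" "i = 0" | "\<alpha> = 0" "0 < i" | "\<alpha> = Suc i" | "Suc (Suc i) \<le> \<alpha>" | "0 < \<alpha>" "\<alpha> \<le> i" by linarith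
  then show ?thesis
  proof cases
    case 1
    have "Tmat_target m i \<alpha> u = u" using assms 1 by (intro nth_equalityI) (auto simp: Tmat_target_def factor_letter_def)
    moreover have "Tmat_coef m i \<alpha> u = 1" using 1 by (simp add: Tmat_coef_def factor_letter_def)
    ultimately show ?thesis using 1 by (simp add: Tmat_def op_ap0_def op_id_def)
  next
    case 2
    have "(u @ v)[i - 1 := (u @ v) ! (i - 1) + 1] = Tmat_target m i \<alpha> u @ v"
    proof -
      have i: "i - 1 < length u" using 2 assms by simp
      have "u[i - 1 := u ! (i - 1) + 1] = Tmat_target m i \<alpha> u"
        using assms 2 by (intro nth_equalityI) (auto simp: Tmat_target_def factor_letter_def nth_list_update)
      then show ?thesis using i by (simp add: list_update_append1 nth_append)
    qed
    moreover have "Tmat_coef m i \<alpha> u = 1" using 2 by (auto simp: Tmat_coef_def factor_letter_def intro!: prod.neutral)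
    ultimately show ?thesis using 2 by (simp add: Tmat_def op_ap0_def op_ap_mono mono_op_def)
  next
    case 3
    have "Tmat_target m i \<alpha> u = u" using assms 3 by (intro nth_equalityI) (auto simp: Tmat_target_def factor_letter_def)
    moreover have "(\<Prod>r=\<alpha>..m. tt ^ ((u @ v) ! (r - 1))) = Tmat_coef m i \<alpha> u"
    proof -
      have "(\<Prod>r=\<alpha>..m. tt ^ ((u @ v) ! (r - 1))) = (\<Prod>r\<in>{r. r < m \<and> \<alpha> \<le> Suc r}. tt ^ (u ! r))"
        by (rule prod.reindex_bij_witness[of _ Suc "\<lambda>r. r - 1"]) (use assms 3 in \<open>auto simp: nth_append\<close>)
      also have "\<dots> = Tmat_coef m i \<alpha> u" unfolding Tmat_coef_def
        by (rule prod.mono_neutral_cong_left) (use 3 in \<open>auto simp: factor_letter_def\<close>)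
      finally show ?thesis .
    qed
    ultimately show ?thesis using 3 by (auto simp: Tmat_def op_scale_def op_kprod_mono mono_op_def)
  next
    case 4
    let ?a = "\<alpha> - 1 - 1" and ?d = "u @ v"
    have a: "?a < length u" "i - 1 < length u" using 4 assms by auto
    have upd: "(u @ v)[?a := (u @ v) ! ?a - 1] = u[?a := u ! ?a - 1] @ v"
      using a by (simp add: list_update_append1 nth_append)
    \<comment> \<open>Treats \<open>a+_0 = 1\<close> together with a genuine raising operator. Since
      i + 2 <= \<alpha>, raising and lowering act on different tensor factors.\<close>
    define g where "g d = (if i = 0 then d else d[i - 1 := d ! (i - 1) + 1])" for d :: "nat list"
    have ap0: "op_ap0 i = mono_op g (\<lambda>_. 1)"
      by (auto simp: op_ap0_def op_id_mono op_ap_mono g_def[abs_def])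
    have "g (?d[?a := ?d ! ?a - 1]) = Tmat_target m i \<alpha> u @ v"
    proof -
      have "g (u[?a := u ! ?a - 1] @ v) = g (u[?a := u ! ?a - 1]) @ v"
        using a by (simp add: g_def list_update_append1 nth_append)
      moreover have "g (u[?a := u ! ?a - 1]) = Tmat_target m i \<alpha> u"
      proof (rule nth_equalityI)
        fix r assume "r < length (g (u[?a := u ! ?a - 1]))"
        then have r: "r < m" using assms by (simp add: g_def split: if_splits)
        then have L: "Tmat_target m i \<alpha> u ! r = letter_target (factor_letter (Suc r) i \<alpha>) (u ! r)" by (simp add: Tmat_target_def)
        consider "r = ?a" | "Suc r = i" | "r \<noteq> ?a" "Suc r \<noteq> i" by blast
        then show "g (u[?a := u ! ?a - 1]) ! r = Tmat_target m i \<alpha> u ! r"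
        proof cases
          case 1
          then have "\<alpha> = Suc (Suc r)" "i \<noteq> Suc r" using 4 by auto
          then show ?thesis unfolding L using 1 r assms by (auto simp: g_def factor_letter_def nth_list_update)
        next
          case 2
          then have "\<not> \<alpha> \<le> Suc (Suc r)" "?a \<noteq> r" using 4 by auto
          then show ?thesis unfolding L using 2 r assms by (auto simp: g_def factor_letter_def nth_list_update)
        next
          case 3
          then have "\<alpha> \<noteq> Suc (Suc r)" using 4 by auto
          then show ?thesis unfolding L using 3 r assms by (auto simp: g_def factor_letter_def nth_list_update)
        qed
      qed (use assms in \<open>simp add: g_def Tmat_target_def\<close>)
      ultimately show ?thesis unfolding upd by simp
    qed
    moreover have "(1 - tt ^ (?d ! ?a)) * (\<Prod>r=\<alpha>..m. tt ^ (?d ! (r - 1))) = Tmat_coef m i \<alpha> u"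
    proof -
      have am: "?a < m" using a assms by simp
      have "(\<Prod>r=\<alpha>..m. tt ^ (?d ! (r - 1))) = (\<Prod>r\<in>{r. r < m \<and> \<alpha> \<le> Suc r}. tt ^ (u ! r))"
        by (rule prod.reindex_bij_witness[of _ Suc "\<lambda>r. r - 1"]) (use assms 4 in \<open>auto simp: nth_append\<close>)
      also have "\<dots> = (\<Prod>r\<in>{..<m} - {?a}. letter_coef (factor_letter (Suc r) i \<alpha>) (u ! r))"
        by (rule prod.mono_neutral_cong_left) (use 4 in \<open>auto simp: factor_letter_def\<close>)
      finally have 1: "(\<Prod>r=\<alpha>..m. tt ^ (?d ! (r - 1))) = (\<Prod>r\<in>{..<m} - {?a}. letter_coef (factor_letter (Suc r) i \<alpha>) (u ! r))" .
      have 2: "1 - tt ^ (?d ! ?a) = letter_coef (factor_letter (Suc ?a) i \<alpha>) (u ! ?a)"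
        using 4 a by (auto simp: factor_letter_def nth_append)
      show ?thesis unfolding 1 2 Tmat_coef_def by (rule prod.remove[symmetric]) (use am in auto)
    qed
    ultimately show ?thesis using 4
      by (simp add: Tmat_def op_scale_def op_kprod_mono op_am_mono ap0 op_mul_mono) (simp add: mono_op_def)
  next
    case 5
    then show ?thesis by (simp add: Tmat_def op_zero_def)
  qed
qed

lemma length_Tmat_target [simp]: "length (Tmat_target m i \<alpha> u) = m"
  by (simp add: Tmat_target_def)

lemma op_sum_eq: "distinct is \<Longrightarrow> op_sum is F e d = (\<Sum>i\<in>set is. F i e d)"
  by (induction "is") (simp_all add: op_sum_def op_zero_def op_add_def)

text \<open>T acts on the first m factors and the operator one level lower on the rest, so states
  are split as \<open>u @ v\<close>. As T is monomial in u, each composition has at most one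
  intermediate state.\<close>

lemma Xop_Suc:
  assumes "length u = m" "\<alpha> \<le> Suc m"
  shows "Xop (Suc m) \<alpha> 1 e (u @ v) = (\<Sum>i\<le>m. of_bool ((\<alpha> = 0 \<or> i < \<alpha>) \<and> take m e = Tmat_target m i \<alpha> u) *
    (Tmat_coef m i \<alpha> u * Xop m i 1 (drop m e) v))"
proof -
  have "Xop (Suc m) \<alpha> 1 e (u @ v) = (\<Sum>i\<in>{..m}. op_mul (op_shift m (Xop m i 1)) (Tmat (Suc m) i \<alpha> 1) e (u @ v))"
  proof -
    have "set [0..<Suc m] = {..m}" by auto
    then show ?thesis unfolding Xop.simps op_sum_eq[OF distinct_upt] by (simp only:)
  qed
  also have "\<dots> = (\<Sum>i\<le>m. of_bool ((\<alpha> = 0 \<or> i < \<alpha>) \<and> take m e = Tmat_target m i \<alpha> u) *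
    (Tmat_coef m i \<alpha> u * Xop m i 1 (drop m e) v))"
  proof (rule sum.cong[OF refl])
    fix i assume "i \<in> {..m}"
    then have i: "i \<le> m" by simp
    have "op_mul (op_shift m (Xop m i 1)) (Tmat (Suc m) i \<alpha> 1) e (u @ v) =
      of_bool (\<alpha> = 0 \<or> i < \<alpha>) * (op_shift m (Xop m i 1) e (Tmat_target m i \<alpha> u @ v) * Tmat_coef m i \<alpha> u)"
      by (rule op_mul_single) (rule Tmat_entry[OF assms(1) i assms(2)])
    then show "op_mul (op_shift m (Xop m i 1)) (Tmat (Suc m) i \<alpha> 1) e (u @ v) =
      of_bool ((\<alpha> = 0 \<or> i < \<alpha>) \<and> take m e = Tmat_target m i \<alpha> u) * (Tmat_coef m i \<alpha> u * Xop m i 1 (drop m e) v)"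
      by (auto simp: op_shift_def)
  qed
  finally show ?thesis .
qed


section \<open>Expansion of the operator product over the second row\<close>

definition factor_word :: "nat \<Rightarrow> nat list \<Rightarrow> nat list \<Rightarrow> letter list" where
  "factor_word r \<eta> \<sigma> = map2 (factor_letter r) \<eta> \<sigma>"

definition factors_target :: "nat \<Rightarrow> nat list \<Rightarrow> nat list \<Rightarrow> nat list \<Rightarrow> nat list" where
  "factors_target m \<eta> \<sigma> u = map (\<lambda>r. word_target (factor_word (Suc r) \<eta> \<sigma>) (u ! r)) [0..<m]"

definition factors_coef :: "nat \<Rightarrow> nat list \<Rightarrow> nat list \<Rightarrow> nat list \<Rightarrow> rat poly" where
  "factors_coef m \<eta> \<sigma> u = (\<Prod>r<m. word_coef (factor_word (Suc r) \<eta> \<sigma>) (u ! r))"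

lemma length_factors_target [simp]: "length (factors_target m \<eta> \<sigma> u) = m"
  by (simp add: factors_target_def)

lemma factors_target_Cons: "factors_target m (i # \<eta>) (s # \<sigma>) u = Tmat_target m i s (factors_target m \<eta> \<sigma> u)"
  by (simp add: factors_target_def Tmat_target_def factor_word_def)

lemma factors_coef_Cons: "factors_coef m (i # \<eta>) (s # \<sigma>) u = Tmat_coef m i s (factors_target m \<eta> \<sigma> u) * factors_coef m \<eta> \<sigma> u"
  by (simp add: factors_coef_def Tmat_coef_def factors_target_def factor_word_def prod.distrib)

lemma factors_target_Nil: "length u = m \<Longrightarrow> factors_target m \<eta> [] u = u"
  by (intro nth_equalityI) (simp_all add: factors_target_def factor_word_def)

lemma factors_coef_Nil: "factors_coef m \<eta> [] u = 1"
  by (simp add: factors_coef_def factor_word_def)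

definition index_words :: "nat \<Rightarrow> nat \<Rightarrow> nat list set" where
  "index_words m L = {\<eta>. set \<eta> \<subseteq> {..m} \<and> length \<eta> = L}"

lemma finite_index_words: "finite (index_words m L)"
  unfolding index_words_def by (rule finite_lists_length_eq) simp

lemma index_words_0: "index_words m 0 = {[]}"
  by (auto simp: index_words_def)

lemma index_words_Suc: "index_words m (Suc L) = (\<lambda>(i, \<eta>). i # \<eta>) ` ({..m} \<times> index_words m L)"
  by (auto simp: index_words_def length_Suc_conv image_iff)

lemma layer_compat_Cons: "layer_compat (i # \<eta>) (s # \<sigma>) \<longleftrightarrow> (s = 0 \<or> i < s) \<and> layer_compat \<eta> \<sigma>"
  unfolding layer_compat_def by (simp add: All_less_Suc2)

lemma op_mul_superset:
  assumes "finite D" "\<And>d'. B d' d \<noteq> 0 \<Longrightarrow> d' \<in> D"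
  shows "op_mul A B e d = (\<Sum>d'\<in>D. A e d' * B d' d)"
  unfolding op_mul_def by (rule sum.mono_neutral_left) (use assms in auto)

text \<open>A choice of the summand i in each operator of the product is a word \<eta>. The parts on
  the first m factors then multiply to a monomial operator with one word of letters per factor, and
  the other parts form the product for \<eta> one level lower. Finite columns are assumed because
  \<open>op_mul\<close> sums over the support of a column, and a sum over an infinite set is 0 by
  default.\<close>

lemma Xprod_Suc:
  assumes u: "length u = m"
    and fin: "\<And>\<eta>. set \<eta> \<subseteq> {..m} \<Longrightarrow> finite {v'. Xprod m \<eta> v' v \<noteq> 0}"
    and \<sigma>: "set \<sigma> \<subseteq> {..Suc m}"
  shows "Xprod (Suc m) \<sigma> e (u @ v) = (\<Sum>\<eta>\<in>index_words m (length \<sigma>).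
    of_bool (layer_compat \<eta> \<sigma> \<and> take m e = factors_target m \<eta> \<sigma> u) * (factors_coef m \<eta> \<sigma> u * Xprod m \<eta> (drop m e) v))"
  using \<sigma>
proof (induction \<sigma> arbitrary: e)
  case Nil
  have "e = u @ v \<longleftrightarrow> take m e = u \<and> drop m e = v"
    using u append_eq_conv_conj[of u v e] by auto
  then show ?case
    using factors_target_Nil[OF u] by (auto simp: index_words_0 Xprod_def layer_compat_def factors_coef_Nil op_id_def)
next
  case (Cons s \<sigma>)
  let ?W = "index_words m (length \<sigma>)"
  let ?V = "\<lambda>\<eta>. {v'. Xprod m \<eta> v' v \<noteq> 0}"
  let ?b = "\<lambda>\<eta> d'. of_bool (layer_compat \<eta> \<sigma> \<and> take m d' = factors_target m \<eta> \<sigma> u) * (factors_coef m \<eta> \<sigma> u * Xprod m \<eta> (drop m d') v)"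
  let ?app = "\<lambda>\<eta> v'. factors_target m \<eta> \<sigma> u @ v'"
  \<comment> \<open>One finite set of intermediate states that serves all \<eta> at once, so that
    the sums over states and over \<eta> can be exchanged.\<close>
  define D where "D = (\<Union>\<eta>\<in>?W. ?app \<eta> ` ?V \<eta>)"
  have s: "s \<le> Suc m" and \<sigma>': "set \<sigma> \<subseteq> {..Suc m}" using Cons.prems by auto
  have finV: "finite (?V \<eta>)" if "\<eta> \<in> ?W" for \<eta> using fin that by (simp add: index_words_def)
  have finD: "finite D" unfolding D_def using finite_index_words finV by blast
  have IH: "Xprod (Suc m) \<sigma> d' (u @ v) = (\<Sum>\<eta>\<in>?W. ?b \<eta> d')" for d' by (rule Cons.IH[OF \<sigma>'])
  have b0: "d' \<in> ?app \<eta> ` ?V \<eta>" if "?b \<eta> d' \<noteq> 0" for \<eta> d'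
  proof -
    have 1: "take m d' = factors_target m \<eta> \<sigma> u" "Xprod m \<eta> (drop m d') v \<noteq> 0" using that by auto
    then have "d' = factors_target m \<eta> \<sigma> u @ drop m d'" by (metis append_take_drop_id)
    with 1(2) show ?thesis by blast
  qed
  have suppD: "d' \<in> D" if nz: "Xprod (Suc m) \<sigma> d' (u @ v) \<noteq> 0" for d'
  proof -
    from nz obtain \<eta> where "\<eta> \<in> ?W" "?b \<eta> d' \<noteq> 0" unfolding IH by (rule sum.not_neutral_contains_not_neutral)
    then show ?thesis using b0 unfolding D_def by blast
  qed
  have inner: "(\<Sum>d'\<in>D. Xop (Suc m) s 1 e d' * ?b \<eta> d') =
    (\<Sum>i\<le>m. of_bool (layer_compat (i # \<eta>) (s # \<sigma>) \<and> take m e = factors_target m (i # \<eta>) (s # \<sigma>) u) *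
      (factors_coef m (i # \<eta>) (s # \<sigma>) u * Xprod m (i # \<eta>) (drop m e) v))" if \<eta>: "\<eta> \<in> ?W" for \<eta>
  proof -
    let ?w = "factors_target m \<eta> \<sigma> u" and ?c = "factors_coef m \<eta> \<sigma> u"
    let ?p = "\<lambda>i. (s = 0 \<or> i < s) \<and> take m e = Tmat_target m i s ?w"
    have sub: "?app \<eta> ` ?V \<eta> \<subseteq> D" using \<eta> by (auto simp: D_def)
    have inj: "inj_on (?app \<eta>) (?V \<eta>)" by (auto simp: inj_on_def)
    have "(\<Sum>d'\<in>D. Xop (Suc m) s 1 e d' * ?b \<eta> d') = (\<Sum>d'\<in>?app \<eta> ` ?V \<eta>. Xop (Suc m) s 1 e d' * ?b \<eta> d')"
    proof (rule sum.mono_neutral_right[OF finD sub], rule ballI)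
      fix d' assume "d' \<in> D - ?app \<eta> ` ?V \<eta>"
      then have "?b \<eta> d' = 0" using b0[of \<eta> d'] by blast
      then show "Xop (Suc m) s 1 e d' * ?b \<eta> d' = 0" by (simp only: mult_zero_right)
    qed
    also have "\<dots> = (\<Sum>v'\<in>?V \<eta>. Xop (Suc m) s 1 e (?w @ v') * ?b \<eta> (?w @ v'))"
      unfolding sum.reindex[OF inj] comp_def ..
    also have "\<dots> = (\<Sum>v'\<in>?V \<eta>. \<Sum>i\<le>m. of_bool (layer_compat \<eta> \<sigma> \<and> ?p i) * (Tmat_coef m i s ?w * ?c) *
      (Xop m i 1 (drop m e) v' * Xprod m \<eta> v' v))"
    proof (rule sum.cong[OF refl])
      fix v'
      have b: "?b \<eta> (?w @ v') = of_bool (layer_compat \<eta> \<sigma>) * (?c * Xprod m \<eta> v' v)" by simp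
      have alg: "(\<Sum>i\<le>m. of_bool (P i) * (f i * g i)) * (of_bool C * (c * x)) = (\<Sum>i\<le>m. of_bool (C \<and> P i) * (f i * c) * (g i * x))"
        for P C f g and c x :: "rat poly" unfolding sum_distrib_right by (intro sum.cong refl) (simp add: mult_ac)
      show "Xop (Suc m) s 1 e (?w @ v') * ?b \<eta> (?w @ v') =
        (\<Sum>i\<le>m. of_bool (layer_compat \<eta> \<sigma> \<and> ?p i) * (Tmat_coef m i s ?w * ?c) * (Xop m i 1 (drop m e) v' * Xprod m \<eta> v' v))"
        unfolding b Xop_Suc[OF length_factors_target s] by (rule alg)
    qed
    also have "\<dots> = (\<Sum>i\<le>m. \<Sum>v'\<in>?V \<eta>. of_bool (layer_compat \<eta> \<sigma> \<and> ?p i) * (Tmat_coef m i s ?w * ?c) *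
      (Xop m i 1 (drop m e) v' * Xprod m \<eta> v' v))" by (rule sum.swap)
    also have "\<dots> = (\<Sum>i\<le>m. of_bool (layer_compat (i # \<eta>) (s # \<sigma>) \<and> take m e = factors_target m (i # \<eta>) (s # \<sigma>) u) *
      (factors_coef m (i # \<eta>) (s # \<sigma>) u * Xprod m (i # \<eta>) (drop m e) v))"
    proof (rule sum.cong[OF refl])
      fix i
      have "Xprod m (i # \<eta>) (drop m e) v = (\<Sum>v'\<in>?V \<eta>. Xop m i 1 (drop m e) v' * Xprod m \<eta> v' v)"
        unfolding Xprod_def by (simp add: op_mul_def)
      then show "(\<Sum>v'\<in>?V \<eta>. of_bool (layer_compat \<eta> \<sigma> \<and> ?p i) * (Tmat_coef m i s ?w * ?c) * (Xop m i 1 (drop m e) v' * Xprod m \<eta> v' v))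
        = of_bool (layer_compat (i # \<eta>) (s # \<sigma>) \<and> take m e = factors_target m (i # \<eta>) (s # \<sigma>) u) *
         (factors_coef m (i # \<eta>) (s # \<sigma>) u * Xprod m (i # \<eta>) (drop m e) v)"
        unfolding sum_distrib_left[symmetric] layer_compat_Cons factors_target_Cons factors_coef_Cons by (simp only: conj_ac mult.assoc)
    qed
    finally show ?thesis .
  qed
  have inj: "inj_on (\<lambda>(i, \<eta>). i # \<eta>) X" for X :: "(nat \<times> nat list) set" by (auto simp: inj_on_def)
  let ?F = "\<lambda>\<eta>'. of_bool (layer_compat \<eta>' (s # \<sigma>) \<and> take m e = factors_target m \<eta>' (s # \<sigma>) u) *
    (factors_coef m \<eta>' (s # \<sigma>) u * Xprod m \<eta>' (drop m e) v)"
  have "Xprod (Suc m) (s # \<sigma>) e (u @ v) = op_mul (Xop (Suc m) s 1) (Xprod (Suc m) \<sigma>) e (u @ v)"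
    by (simp add: Xprod_def)
  also have "\<dots> = (\<Sum>d'\<in>D. Xop (Suc m) s 1 e d' * Xprod (Suc m) \<sigma> d' (u @ v))"
    by (rule op_mul_superset[OF finD]) (rule suppD)
  also have "\<dots> = (\<Sum>d'\<in>D. \<Sum>\<eta>\<in>?W. Xop (Suc m) s 1 e d' * ?b \<eta> d')"
    unfolding IH sum_distrib_left ..
  also have "\<dots> = (\<Sum>\<eta>\<in>?W. \<Sum>d'\<in>D. Xop (Suc m) s 1 e d' * ?b \<eta> d')" by (rule sum.swap)
  also have "\<dots> = (\<Sum>\<eta>\<in>?W. \<Sum>i\<le>m. ?F (i # \<eta>))" by (rule sum.cong[OF refl]) (rule inner)
  also have "\<dots> = (\<Sum>i\<le>m. \<Sum>\<eta>\<in>?W. ?F (i # \<eta>))" by (rule sum.swap)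
  also have "\<dots> = (\<Sum>(i, \<eta>)\<in>{..m} \<times> ?W. ?F (i # \<eta>))" by (rule sum.cartesian_product)
  also have "\<dots> = (\<Sum>\<eta>'\<in>index_words m (length (s # \<sigma>)). ?F \<eta>')"
    unfolding list.size(4) add_Suc_right add_0_right index_words_Suc sum.reindex[OF inj]
    by (simp only: comp_def case_prod_unfold)
  finally show ?case .
qed


text \<open>The point where queues and operators meet: a column described by J, A and S carries
  exactly the letter that T has on tensor factor r.\<close>

lemma column_letter_eq_factor_letter:
  assumes "length \<eta> = length \<xi>" "x < length \<xi>"
  shows "column_letter (cols \<eta> r) (occ (Suc r) \<xi>) (cols \<xi> (Suc r)) x = factor_letter r (\<eta> ! x) (\<xi> ! x)"
  using assms by (simp add: column_letter_def factor_letter_def cols_def occ_def)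

lemma factor_word_eq_column_word: "length \<eta> = length \<xi> \<Longrightarrow> factor_word r \<eta> \<xi> = column_word r \<eta> \<xi>"
  by (rule nth_equalityI) (simp_all add: factor_word_def column_word_def column_letter_eq_factor_letter)

text \<open>A list of occupation numbers is fixed exactly when each entry is fixed by its own word,
  so the diagonal indicator splits over the tensor factors.\<close>

lemma factors_target_diag:
  assumes "length u = m" "length \<eta> = length \<sigma>"
  shows "of_bool (u = factors_target m \<eta> \<sigma> u) * factors_coef m \<eta> \<sigma> u = (\<Prod>r<m. word_entry (column_word (Suc r) \<eta> \<sigma>) (u ! r) (u ! r))"
proof -
  let ?w = "\<lambda>r. column_word (Suc r) \<eta> \<sigma>"
  have "u = factors_target m \<eta> \<sigma> u \<longleftrightarrow> (\<forall>r\<in>{..<m}. u ! r = word_target (?w r) (u ! r))"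
    using assms by (auto simp: factors_target_def list_eq_iff_nth_eq factor_word_eq_column_word)
  then have "of_bool (u = factors_target m \<eta> \<sigma> u) = (\<Prod>r<m. of_bool (u ! r = word_target (?w r) (u ! r)) :: rat poly)"
    by (simp only: prod_of_bool finite_lessThan)
  then have "of_bool (u = factors_target m \<eta> \<sigma> u) * factors_coef m \<eta> \<sigma> u =
    (\<Prod>r<m. of_bool (u ! r = word_target (?w r) (u ! r)) * word_coef (?w r) (u ! r))"
    by (simp only: factors_coef_def prod.distrib factor_word_eq_column_word[OF assms(2)])
  also have "\<dots> = (\<Prod>r<m. word_entry (?w r) (u ! r) (u ! r))"
    by (rule prod.cong[OF refl]) (simp add: word_entry_eq)
  finally show ?thesis .
qed

lemma Nn_Suc: "Nn (Suc m) = m + Nn m"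
proof -
  have "Suc m * m = 2 * m + m * (m - 1)" by (cases m) (simp_all add: algebra_simps)
  then show ?thesis by (simp add: Nn_def)
qed

lemma Xprod_0:
  assumes "set \<sigma> \<subseteq> {..0}" shows "Xprod 0 \<sigma> = op_id"
  using assms
proof (induction \<sigma>)
  case (Cons s \<sigma>)
  then have "Xop 0 s 1 = op_id" "Xprod 0 \<sigma> = op_id" by auto
  then show ?case unfolding Xprod_def by (simp add: op_id_mono op_mul_mono)
qed (simp add: Xprod_def)

lemma split_state:
  assumes "length d = m + N" obtains u v where "d = u @ v" "length u = m" "length v = N"
  using assms by (intro that[of "take m d" "drop m d"]) auto

text \<open>Supplies, by induction, the finiteness that the expansion assumes one level lower: there
  are finitely many \<eta>, each prescribes the first m entries of the image, and the other entries
  lie in a finite column.\<close>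

lemma Xprod_finite_column:
  assumes "set \<sigma> \<subseteq> {..n}" "length d = Nn n"
  shows "finite {e. Xprod n \<sigma> e d \<noteq> 0}"
  using assms
proof (induction n arbitrary: \<sigma> d)
  case 0
  then have "{e. Xprod 0 \<sigma> e d \<noteq> 0} \<subseteq> {d}" by (auto simp: Xprod_0 op_id_def split: if_splits)
  then show ?case by (rule finite_subset) simp
next
  case (Suc m)
  obtain u v where d: "d = u @ v" "length u = m" "length v = Nn m"
    using split_state[of d m "Nn m"] Suc.prems(2) unfolding Nn_Suc by blast
  have fin: "finite {v'. Xprod m \<eta> v' v \<noteq> 0}" if "set \<eta> \<subseteq> {..m}" for \<eta>
    by (rule Suc.IH[OF that d(3)])
  let ?D = "\<Union>\<eta>\<in>index_words m (length \<sigma>). (\<lambda>v'. factors_target m \<eta> \<sigma> u @ v') ` {v'. Xprod m \<eta> v' v \<noteq> 0}"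
  have "finite ?D" using finite_index_words fin by (auto simp: index_words_def)
  moreover have "{e. Xprod (Suc m) \<sigma> e d \<noteq> 0} \<subseteq> ?D"
  proof
    fix e assume "e \<in> {e. Xprod (Suc m) \<sigma> e d \<noteq> 0}"
    then have nz: "Xprod (Suc m) \<sigma> e (u @ v) \<noteq> 0" by (simp add: d(1))
    have "Xprod (Suc m) \<sigma> e (u @ v) = (\<Sum>\<eta>\<in>index_words m (length \<sigma>). of_bool (layer_compat \<eta> \<sigma> \<and> take m e = factors_target m \<eta> \<sigma> u) *
        (factors_coef m \<eta> \<sigma> u * Xprod m \<eta> (drop m e) v))"
      by (rule Xprod_Suc[OF d(2) _ Suc.prems(1)]) (rule fin)
    from nz[unfolded this]
    obtain \<eta> where \<eta>: "\<eta> \<in> index_words m (length \<sigma>)" and "of_bool (layer_compat \<eta> \<sigma> \<and> take m e = factors_target m \<eta> \<sigma> u) *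
        (factors_coef m \<eta> \<sigma> u * Xprod m \<eta> (drop m e) v) \<noteq> 0"
      by (rule sum.not_neutral_contains_not_neutral)
    then have 1: "take m e = factors_target m \<eta> \<sigma> u" "Xprod m \<eta> (drop m e) v \<noteq> 0" by auto
    then have "e = factors_target m \<eta> \<sigma> u @ drop m e" by (metis append_take_drop_id)
    with 1(2) \<eta> show "e \<in> ?D" by blast
  qed
  ultimately show ?case by (rule finite_subset[rotated])
qed

lemma Xprod_diag:
  assumes "length u = m" "length v = Nn m" "set \<sigma> \<subseteq> {..Suc m}"
  shows "Xprod (Suc m) \<sigma> (u @ v) (u @ v) = (\<Sum>\<eta>\<in>index_words m (length \<sigma>).
    of_bool (layer_compat \<eta> \<sigma>) * (\<Prod>r<m. word_entry (column_word (Suc r) \<eta> \<sigma>) (u ! r) (u ! r)) * Xprod m \<eta> v v)"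
proof -
  have "Xprod (Suc m) \<sigma> (u @ v) (u @ v) = (\<Sum>\<eta>\<in>index_words m (length \<sigma>).
    of_bool (layer_compat \<eta> \<sigma> \<and> take m (u @ v) = factors_target m \<eta> \<sigma> u) * (factors_coef m \<eta> \<sigma> u * Xprod m \<eta> (drop m (u @ v)) v))"
    by (rule Xprod_Suc[OF assms(1) _ assms(3)]) (rule Xprod_finite_column[OF _ assms(2)])
  also have "\<dots> = (\<Sum>\<eta>\<in>index_words m (length \<sigma>).
    of_bool (layer_compat \<eta> \<sigma>) * (\<Prod>r<m. word_entry (column_word (Suc r) \<eta> \<sigma>) (u ! r) (u ! r)) * Xprod m \<eta> v v)"
  proof (rule sum.cong[OF refl])
    fix \<eta> assume "\<eta> \<in> index_words m (length \<sigma>)"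
    then have "length \<eta> = length \<sigma>" by (simp add: index_words_def)
    have td: "take m (u @ v) = u" "drop m (u @ v) = v" using assms(1) by simp_all
    show "of_bool (layer_compat \<eta> \<sigma> \<and> take m (u @ v) = factors_target m \<eta> \<sigma> u) * (factors_coef m \<eta> \<sigma> u * Xprod m \<eta> (drop m (u @ v)) v) =
      of_bool (layer_compat \<eta> \<sigma>) * (\<Prod>r<m. word_entry (column_word (Suc r) \<eta> \<sigma>) (u ! r) (u ! r)) * Xprod m \<eta> v v"
      unfolding td factors_target_diag[OF assms(1) \<open>length \<eta> = length \<sigma>\<close>, symmetric] by (simp only: of_bool_conj mult.assoc)
  qed
  finally show ?thesis .
qed

lemma count_word:
  "count_list (word J A S [0..<L]) y = card {i. i < L \<and> column_letter J A S i = y}"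
  by (simp add: count_list_cols cols_def cong: conj_cong)

text \<open>Only the particle content forced by charge conservation contributes to the diagonal.\<close>
lemma unbalanced_diag_zero:
  assumes \<eta>: "\<eta> \<in> index_words m L" "\<eta> \<notin> configs m L (\<lambda>\<alpha>. \<mu> (Suc \<alpha>))" and \<sigma>: "\<sigma> \<in> configs (Suc m) L \<mu>" and c: "layer_compat \<eta> \<sigma>"
  shows "(\<Prod>r<m. word_entry (column_word (Suc r) \<eta> \<sigma>) (u r) (u r)) = 0"
proof -
  have len: "length \<eta> = L" "length \<sigma> = L" using \<eta>(1) \<sigma> by (auto simp: index_words_def configs_def)
  have "set \<eta> \<subseteq> {0..m}" using \<eta>(1) by (auto simp: index_words_def)
  then obtain k where k: "k \<in> {1..m}" "card (cols \<eta> k) \<noteq> \<mu> (Suc k)" using \<eta>(2) len(1) by (auto simp: configs_def)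
  let ?J = "cols \<eta> k" and ?A = "occ (Suc k) \<sigma>" and ?S = "cols \<sigma> (Suc k)"
  have JS: "card ?J \<noteq> card ?S" using \<sigma> k by (auto simp: configs_def)
  have JA: "?J \<inter> ?A \<subseteq> ?S"
  proof
    fix x assume x: "x \<in> ?J \<inter> ?A"
    then have "x < length \<sigma>" by (simp add: occ_def)
    then have "\<sigma> ! x = 0 \<or> \<eta> ! x < \<sigma> ! x" using c unfolding layer_compat_def by blast
    then show "x \<in> ?S" using x by (auto simp: cols_def occ_def)
  qed
  have SA: "?S \<subseteq> ?A" by (auto simp: cols_def occ_def)
  have sub: "?J \<subseteq> {..<L}" "?S \<subseteq> {..<L}" using len by (auto simp: cols_def)
  have P: "count_list (column_word k \<eta> \<sigma>) Lplus = card (?J - ?S)"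
  proof -
    have "{i. i < length \<sigma> \<and> column_letter ?J ?A ?S i = Lplus} = ?J - ?S"
      using JA SA sub len by (auto simp: column_letter_def split: if_splits)
    then show ?thesis unfolding column_word_def count_word by simp
  qed
  have M: "count_list (column_word k \<eta> \<sigma>) Lminus = card (?S - ?J)"
  proof -
    have "{i. i < length \<sigma> \<and> column_letter ?J ?A ?S i = Lminus} = ?S - ?J"
      using JA SA sub len by (auto simp: column_letter_def split: if_splits)
    then show ?thesis unfolding column_word_def count_word by simp
  qed
  \<comment> \<open>Columns in both J and S carry no charge, so the raising letters exceed the
    lowering ones by |J| - |S|, which is not 0.\<close>
  have "card ?J = card (?J \<inter> ?S) + card (?J - ?S)" by (rule card_Int_Diff) simp
  moreover have "card ?S = card (?J \<inter> ?S) + card (?S - ?J)" by (subst Int_commute, rule card_Int_Diff) simp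
  ultimately have "count_list (column_word k \<eta> \<sigma>) Lplus \<noteq> count_list (column_word k \<eta> \<sigma>) Lminus"
    using JS P M by linarith
  then have "word_entry (column_word k \<eta> \<sigma>) d d = 0" for d using word_entry_charge[of "column_word k \<eta> \<sigma>" d d] by auto
  moreover obtain r where "r < m" "k = Suc r" using k by (cases k) auto
  ultimately show ?thesis by (intro prod_zero) auto
qed

text \<open>A column with upper entry 1 lies in \<open>occ (Suc r)\<close> but does not have the
  label \<open>Suc r\<close>, so it carries k in every tensor factor r. Positivity of \<mu> 1,
  applied to the shifted contents in deeper layers, thus makes all the traces converge.\<close>

lemma Lk_in_column_word:
  assumes "\<sigma> \<in> configs (Suc m) L \<mu>" "1 \<le> \<mu> 1" "1 \<le> r"
  shows "Lk \<in> set (column_word r \<eta> \<sigma>)"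
proof -
  have "card (cols \<sigma> 1) \<noteq> 0" using assms by (auto simp: configs_def)
  then obtain x where x: "x < length \<sigma>" "\<sigma> ! x = 1" by (auto simp: cols_def card_eq_0_iff)
  then have "column_letter (cols \<eta> r) (occ (Suc r) \<sigma>) (cols \<sigma> (Suc r)) x = Lk" using assms(3) by (simp add: column_letter_def occ_def cols_def)
  then show ?thesis using x(1) unfolding column_word_def by force
qed

text \<open>For fixed \<eta> the diagonal entry is a product of functions of the first m occupation
  numbers and of the remaining \<open>Nn m\<close> ones, so its sum factorises into one-space traces
  and the trace one level lower. The restriction to \<eta> of the right content comes first, since
  the induction hypothesis speaks of those only.\<close>

lemma Xprod_trace:
  assumes "\<sigma> \<in> configs n L \<mu>" "\<And>\<alpha>. \<alpha> \<in> {1..n} \<Longrightarrow> 1 \<le> \<mu> \<alpha>"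
  shows "fam_conv {d. length d = Nn n} (\<lambda>d. fps_of_poly (Xprod n \<sigma> d d)) \<and>
    fam_sum {d. length d = Nn n} (\<lambda>d. fps_of_poly (Xprod n \<sigma> d d)) = chain_trace n L \<mu> \<sigma>"
  using assms
proof (induction n arbitrary: \<sigma> \<mu>)
  case 0
  have X: "Xprod 0 \<sigma> = op_id" using 0 by (intro Xprod_0) (auto simp: configs_def)
  have "fam_sum {[]} (\<lambda>d :: nat list. 1 :: rat fps) = 1"
    by (rule fps_ext, subst fam_sum_nth[of "{[]}"]) auto
  then show ?case by (simp add: X op_id_def Nn_def fam_conv_def)
next
  case (Suc m)
  let ?\<mu> = "\<lambda>\<alpha>. \<mu> (Suc \<alpha>)"
  let ?U = "{u :: nat list. length u = m}" and ?V = "{v :: nat list. length v = Nn m}"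
  let ?C = "configs m L ?\<mu>"
  let ?word_entry = "\<lambda>\<eta> r d. fps_of_poly (word_entry (column_word (Suc r) \<eta> \<sigma>) d d)"
  let ?P = "\<lambda>\<eta> u. \<Prod>r<m. ?word_entry \<eta> r (u ! r)"
  let ?X = "\<lambda>\<eta> v. fps_of_poly (Xprod m \<eta> v v)"
  have len: "length \<sigma> = L" and set: "set \<sigma> \<subseteq> {..Suc m}" using Suc.prems(1) by (auto simp: configs_def)
  have CW: "?C \<subseteq> index_words m L" by (auto simp: configs_def index_words_def)
  have im: "{d :: nat list. length d = Nn (Suc m)} = (\<lambda>(u, v). u @ v) ` (?U \<times> ?V)"
  proof (rule set_eqI)
    fix d :: "nat list"
    show "d \<in> {d. length d = Nn (Suc m)} \<longleftrightarrow> d \<in> (\<lambda>(u, v). u @ v) ` (?U \<times> ?V)"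
      by (auto simp: Nn_Suc elim!: split_state)
  qed
  have inj: "inj_on (\<lambda>(u, v). u @ v) (?U \<times> ?V)" by (auto simp: inj_on_def)
  define F where "F \<eta> = (\<lambda>(u, v). of_bool (layer_compat \<eta> \<sigma>) * (case (u, v) of (u, v) \<Rightarrow> ?P \<eta> u * ?X \<eta> v))" for \<eta>
  have diag: "fps_of_poly (Xprod (Suc m) \<sigma> (case p of (u, v) \<Rightarrow> u @ v) (case p of (u, v) \<Rightarrow> u @ v)) = (\<Sum>\<eta>\<in>?C. F \<eta> p)"
    if p: "p \<in> ?U \<times> ?V" for p
  proof -
    obtain u v where uv: "p = (u, v)" "length u = m" "length v = Nn m" using p by auto
    have "Xprod (Suc m) \<sigma> (u @ v) (u @ v) = (\<Sum>\<eta>\<in>index_words m L.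
      of_bool (layer_compat \<eta> \<sigma>) * (\<Prod>r<m. word_entry (column_word (Suc r) \<eta> \<sigma>) (u ! r) (u ! r)) * Xprod m \<eta> v v)"
      using Xprod_diag[OF uv(2,3) set] unfolding len .
    also have "\<dots> = (\<Sum>\<eta>\<in>?C. of_bool (layer_compat \<eta> \<sigma>) * (\<Prod>r<m. word_entry (column_word (Suc r) \<eta> \<sigma>) (u ! r) (u ! r)) * Xprod m \<eta> v v)"
    proof (rule sum.mono_neutral_right[OF finite_index_words CW], rule ballI)
      fix \<eta> assume "\<eta> \<in> index_words m L - ?C"
      then show "of_bool (layer_compat \<eta> \<sigma>) * (\<Prod>r<m. word_entry (column_word (Suc r) \<eta> \<sigma>) (u ! r) (u ! r)) * Xprod m \<eta> v v = 0"
        using unbalanced_diag_zero[of \<eta> m L \<mu> \<sigma> "\<lambda>r. u ! r"] Suc.prems(1) by (cases "layer_compat \<eta> \<sigma>") auto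
    qed
    finally have "fps_of_poly (Xprod (Suc m) \<sigma> (u @ v) (u @ v)) =
      (\<Sum>\<eta>\<in>?C. fps_of_poly (of_bool (layer_compat \<eta> \<sigma>)) * ?P \<eta> u * ?X \<eta> v)"
      by (simp only: fps_of_poly_sum fps_of_poly_mult fps_of_poly_prod)
    also have "\<dots> = (\<Sum>\<eta>\<in>?C. F \<eta> p)"
    proof (rule sum.cong[OF refl])
      fix \<eta>
      have "fps_of_poly (of_bool (layer_compat \<eta> \<sigma>)) = (of_bool (layer_compat \<eta> \<sigma>) :: rat fps)" by simp
      then show "fps_of_poly (of_bool (layer_compat \<eta> \<sigma>)) * ?P \<eta> u * ?X \<eta> v = F \<eta> p"
        by (simp only: F_def uv(1) prod.case mult.assoc)
    qed
    finally show ?thesis by (simp only: uv(1) prod.case)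
  qed
  have F: "fam_conv (?U \<times> ?V) (F \<eta>)" "fam_sum (?U \<times> ?V) (F \<eta>) = layer_trace m \<eta> \<sigma> * chain_trace m L ?\<mu> \<eta>"
    if \<eta>: "\<eta> \<in> ?C" for \<eta>
  proof -
    have "fam_conv UNIV (?word_entry \<eta> r)" if "r < m" for r
      by (rule word_trace_conv, rule Lk_in_column_word[OF Suc.prems(1)]) (use Suc.prems(2)[of 1] in auto)
    from fam_prod_lists[of m "?word_entry \<eta>", OF this]
    have 1: "fam_conv ?U (?P \<eta>)" "fam_sum ?U (?P \<eta>) = (\<Prod>r<m. word_trace (column_word (Suc r) \<eta> \<sigma>))"
      unfolding word_trace_def by blast+
    have 2: "fam_conv ?V (?X \<eta>)" "fam_sum ?V (?X \<eta>) = chain_trace m L ?\<mu> \<eta>"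
      using Suc.IH[OF \<eta>] Suc.prems(2) by auto
    have "(\<Prod>r<m. word_trace (column_word (Suc r) \<eta> \<sigma>)) = (\<Prod>k=1..m. word_trace (column_word k \<eta> \<sigma>))"
      by (rule prod.reindex_bij_witness[of _ "\<lambda>k. k - 1" Suc]) auto
    then have T: "of_bool (layer_compat \<eta> \<sigma>) * (fam_sum ?U (?P \<eta>) * fam_sum ?V (?X \<eta>)) = layer_trace m \<eta> \<sigma> * chain_trace m L ?\<mu> \<eta>"
      unfolding 1(2) 2(2) layer_trace_def by (simp only: mult.assoc)
    have F': "F \<eta> = (\<lambda>p. of_bool (layer_compat \<eta> \<sigma>) * (case p of (u, v) \<Rightarrow> ?P \<eta> u * ?X \<eta> v))"
      by (simp add: F_def case_prod_unfold)
    note t = fam_sum_times[OF 1(1) 2(1)]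
    show "fam_conv (?U \<times> ?V) (F \<eta>)" unfolding F' by (rule fam_sum_cmult(1)[OF t(1)])
    show "fam_sum (?U \<times> ?V) (F \<eta>) = layer_trace m \<eta> \<sigma> * chain_trace m L ?\<mu> \<eta>"
      unfolding F' fam_sum_cmult(2)[OF t(1)] t(2) by (rule T)
  qed
  have S: "fam_conv (?U \<times> ?V) (\<lambda>p. \<Sum>\<eta>\<in>?C. F \<eta> p)"
    "fam_sum (?U \<times> ?V) (\<lambda>p. \<Sum>\<eta>\<in>?C. F \<eta> p) = chain_trace (Suc m) L \<mu> \<sigma>"
    using fam_sum_sum[of ?C "?U \<times> ?V" F, OF finite_configs F(1)] F(2) by (auto simp: chain_trace.simps(2))
  let ?D = "\<lambda>p. fps_of_poly (Xprod (Suc m) \<sigma> (case p of (u, v) \<Rightarrow> u @ v) (case p of (u, v) \<Rightarrow> u @ v))"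
  have dc: "fam_conv (?U \<times> ?V) ?D \<longleftrightarrow> fam_conv (?U \<times> ?V) (\<lambda>p. \<Sum>\<eta>\<in>?C. F \<eta> p)"
    by (rule fam_conv_cong) (rule diag)
  have ds: "fam_sum (?U \<times> ?V) ?D = fam_sum (?U \<times> ?V) (\<lambda>p. \<Sum>\<eta>\<in>?C. F \<eta> p)"
    by (rule fam_sum_cong) (rule diag)
  show ?case
    unfolding im fam_conv_reindex[OF inj] fam_sum_reindex[OF inj] dc ds using S by blast
qed

theorem theorem4p5:
  fixes n L :: nat and m :: "nat list"
  assumes "2 \<le> n" and "n < L" and "length m = n + 1"
    and "\<forall>\<alpha>\<le>n. 1 \<le> m ! \<alpha>" and "sum_list m = L"
  shows "\<exists>a b :: rat poly. a \<noteq> 0 \<and> b \<noteq> 0 \<and>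
     (\<forall>\<sigma> :: nat list. length \<sigma> = L \<and> set \<sigma> \<subseteq> {0..n} \<and> (\<forall>\<alpha>\<le>n. count_list \<sigma> \<alpha> = m ! \<alpha>) \<longrightarrow>
        trace_conv (Nn n) (Xprod n \<sigma>) \<and>
        P_MLQ (fls_X :: rat fls) 1 n L m \<sigma>
          = (poly_fls a / poly_fls b) * fps_to_fls (op_trace (Nn n) (Xprod n \<sigma>)))"
proof -
  let ?\<mu> = "\<lambda>i. m ! i"
  have pos: "1 \<le> ?\<mu> \<alpha>" if "\<alpha> \<in> {1..n}" for \<alpha> using assms(4) that by simp
  have "trace_conv (Nn n) (Xprod n \<sigma>) \<and>
    P_MLQ fls_X 1 n L m \<sigma> = (poly_fls (norm_const n ?\<mu>) / poly_fls 1) * fps_to_fls (op_trace (Nn n) (Xprod n \<sigma>))"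
    if "length \<sigma> = L" "set \<sigma> \<subseteq> {0..n}" "\<forall>\<alpha>\<le>n. count_list \<sigma> \<alpha> = m ! \<alpha>" for \<sigma>
  proof -
    have \<sigma>: "\<sigma> \<in> configs n L ?\<mu>" using that by (simp add: configs_def count_list_cols)
    have "trace_conv (Nn n) (Xprod n \<sigma>)" "op_trace (Nn n) (Xprod n \<sigma>) = chain_trace n L ?\<mu> \<sigma>"
      using Xprod_trace[OF \<sigma> pos] by (simp_all add: trace_conv_def op_trace_def fam_conv_def fam_sum_def)
    moreover have "P_MLQ fls_X 1 n L m \<sigma> = fps_to_fls (fps_of_poly (norm_const n ?\<mu>) * chain_trace n L ?\<mu> \<sigma>)"
      by (rule P_MLQ_chain_trace[OF assms(3) _ pos \<sigma>]) (use assms(1) in auto)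
    ultimately show ?thesis by (simp add: poly_fls_def fls_times_fps_to_fls)
  qed
  moreover have "norm_const n ?\<mu> \<noteq> 0" by (rule norm_const_neq_0) (rule pos)
  \<comment> \<open>C(m) is a polynomial, hence the denominator 1.\<close>
  ultimately show ?thesis by (intro exI[of _ "norm_const n ?\<mu>"] exI[of _ 1]) auto
qed

end
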